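(* Let $\mathfrak g$ be a finite-dimensional simple Lie algebra over $\mathbb C$, let $l$ be a positive integer, $V=L_{\hat{\mathfrak g}}(l,0)$ and $W=L_{\hat{\mathfrak g}}(l,\lambda)$, where $\lambda\in\mathfrak h^*$ is a dominant integral weight satisfying $\lambda(h_\theta)\le l$, $\theta$ being the highest root of $\mathfrak g$. Take the grading operator $\mathbf d_W=L(0)$. Then for every derivation $F:V\to W$ there exists $w_{(1)}\in W_{[1]}$ such that $F(v)=(w_{(1)})_0v$ for all $v\in V$. Thus $H^1(V,W)=Z^1(V,W)$.
   Context: Affine VOA and modules. $\mathfrak h$ is a Cartan subalgebra of $\mathfrak g$; for a positive root $\alpha$, $h_\alpha\in[\mathfrak g_\alpha,\mathfrak g_{-\alpha}]$ is the element with $\alpha(h_\alpha)=2$; $\lambda\in\mathfrak h^*$ is dominant integral if $\lambda(h_\alpha)\in\mathbb N=\{0,1,\dots\}$ for all positive roots $\alpha$, and $M_\lambda$ is then the irreducible $\mathfrak g$-module of highest weight $\lambda$. $\hat{\mathfrak g}=\mathfrak g\otimes\mathbb C[t,t^{-1}]\oplus\mathbb Ck$ with $k$ central and $[a\otimes t^m,b\otimes t^n]=[a,b]\otimes t^{m+n}+m\langle a,b\rangle\delta_{m+n,0}k$, where $\langle\cdot,\cdot\rangle$ is the normalized Killing form (long roots have square length $2$). $V_{\hat{\mathfrak g}}(l,\lambda)$ is the $\hat{\mathfrak g}$-module induced from the $(\mathfrak g\otimes\mathbb C[t]\oplus\mathbb Ck)$-module $M_\lambda$ on which $\mathfrak g\otimes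 t\mathbb C[t]$ acts by $0$ and $k$ by $l$. $V_{\hat{\mathfrak g}}(l,0)$ is a VOA (Sugawara conformal vector) with simple quotient VOA $L_{\hat{\mathfrak g}}(l,0)$; $L_{\hat{\mathfrak g}}(l,\lambda)$ is the unique irreducible quotient of $V_{\hat{\mathfrak g}}(l,\lambda)$, and under the stated conditions is an irreducible $L_{\hat{\mathfrak g}}(l,0)$-module. Derivations. For a vertex operator algebra $(V,Y,\mathbf 1,\omega)$ and a $V$-module $(W,Y_W)$ with grading operator $\mathbf d_W$, put $W_{[m]}=\{w\in W:\mathbf d_Ww=mw\}$ and $Y_{WV}^W(w,x)v=e^{xL(-1)}Y_W(v,-x)w=\sum_{n\in\mathbb Z}w_nv\,x^{-n-1}$ for $w\in W,v\in V$. A (grading-preserving) derivation is a linear map $F:V\to W$ with $F\circ L(0)=\mathbf d_W\circ F$ and $F(Y(u,x)v)=Y_W(u,x)F(v)+Y_{WV}^W(F(u),x)v$ for all $u,v\in V$. $H^1(V,W)$ is (identified with) the space of all such derivations. A zero-mode derivation is one of the form $v\mapsto w_0v$ with $w\in W_{[1]}$; $Z^1(V,W)$ is the space of these. *)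

theory Defs
  imports Complex_Main "HOL-Library.Poly_Mapping" "HOL-Library.Product_Plus"
begin

text \<open>
  A complex vector space is a type of class \<open>ab_group_add\<close> together with an explicit scalar
  multiplication satisfying the library locale \<open>vector_space\<close>.  The constructions that are
  determined only up to isomorphism (induced modules, irreducible quotients, the vertex operator
  algebras and modules built on them) are predicates on such structures, so that a theorem about
  them applies to every model.
\<close>

section \<open>Linear algebra\<close>

definition fin_dim :: "(complex \<Rightarrow> 'a::ab_group_add \<Rightarrow> 'a) \<Rightarrow> 'a set \<Rightarrow> bool" where
  "fin_dim scale S \<longleftrightarrow> (\<exists>B. finite B \<and> S \<subseteq> module.span scale B)"

definition some_basis :: "(complex \<Rightarrow> 'a::ab_group_add \<Rightarrow> 'a) \<Rightarrow> 'a set" where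
  "some_basis scale =
     (SOME B. finite B \<and> \<not> module.dependent scale B \<and> module.span scale B = UNIV)"

definition endo_trace :: "(complex \<Rightarrow> 'a::ab_group_add \<Rightarrow> 'a) \<Rightarrow> ('a \<Rightarrow> 'a) \<Rightarrow> complex" where
  "endo_trace scale f =
     (\<Sum>b\<in>some_basis scale. module.representation scale (some_basis scale) (f b) b)"

text \<open>The vector space with basis \<open>'i\<close>: the basis vector \<open>i\<close> is \<open>Poly_Mapping.single i 1\<close>.\<close>

definition free_scale :: "complex \<Rightarrow> ('i \<Rightarrow>\<^sub>0 complex) \<Rightarrow> ('i \<Rightarrow>\<^sub>0 complex)" where
  "free_scale c f = Poly_Mapping.map ((*) c) f"

section \<open>Lie algebras, Cartan subalgebras and roots\<close>

locale lie_algebra = vector_space scale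
  for scale :: "complex \<Rightarrow> 'g::ab_group_add \<Rightarrow> 'g" +
  fixes bracket :: "'g \<Rightarrow> 'g \<Rightarrow> 'g"
  assumes bracket_add_left: "bracket (x + y) z = bracket x z + bracket y z"
    and bracket_add_right: "bracket x (y + z) = bracket x y + bracket x z"
    and bracket_scale_left: "bracket (scale c x) y = scale c (bracket x y)"
    and bracket_scale_right: "bracket x (scale c y) = scale c (bracket x y)"
    and bracket_self: "bracket x x = 0"
    and jacobi: "bracket x (bracket y z) + bracket y (bracket z x) + bracket z (bracket x y) = 0"

definition lie_ideal ::
  "(complex \<Rightarrow> 'g::ab_group_add \<Rightarrow> 'g) \<Rightarrow> ('g \<Rightarrow> 'g \<Rightarrow> 'g) \<Rightarrow> 'g set \<Rightarrow> bool" where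
  "lie_ideal scale bracket I \<longleftrightarrow>
     module.subspace scale I \<and> (\<forall>x. \<forall>y\<in>I. bracket x y \<in> I)"

definition simple_lie_algebra ::
  "(complex \<Rightarrow> 'g::ab_group_add \<Rightarrow> 'g) \<Rightarrow> ('g \<Rightarrow> 'g \<Rightarrow> 'g) \<Rightarrow> bool" where
  "simple_lie_algebra scale bracket \<longleftrightarrow>
     lie_algebra scale bracket \<and>
     (\<exists>x y. bracket x y \<noteq> 0) \<and>
     (\<forall>I. lie_ideal scale bracket I \<longrightarrow> I = {0} \<or> I = UNIV)"

definition lie_subalgebra ::
  "(complex \<Rightarrow> 'g::ab_group_add \<Rightarrow> 'g) \<Rightarrow> ('g \<Rightarrow> 'g \<Rightarrow> 'g) \<Rightarrow> 'g set \<Rightarrow> bool" where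
  "lie_subalgebra scale bracket S \<longleftrightarrow>
     module.subspace scale S \<and> (\<forall>x\<in>S. \<forall>y\<in>S. bracket x y \<in> S)"

primrec lower_central_series ::
  "(complex \<Rightarrow> 'g::ab_group_add \<Rightarrow> 'g) \<Rightarrow> ('g \<Rightarrow> 'g \<Rightarrow> 'g) \<Rightarrow> 'g set \<Rightarrow> nat \<Rightarrow> 'g set" where
  "lower_central_series scale bracket S 0 = S"
| "lower_central_series scale bracket S (Suc n) =
     module.span scale {bracket x y | x y. x \<in> S \<and> y \<in> lower_central_series scale bracket S n}"

definition cartan_subalgebra ::
  "(complex \<Rightarrow> 'g::ab_group_add \<Rightarrow> 'g) \<Rightarrow> ('g \<Rightarrow> 'g \<Rightarrow> 'g) \<Rightarrow> 'g set \<Rightarrow> bool" where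
  "cartan_subalgebra scale bracket H \<longleftrightarrow>
     lie_subalgebra scale bracket H \<and>
     (\<exists>n. lower_central_series scale bracket H n = {0}) \<and>
     {x. \<forall>y\<in>H. bracket x y \<in> H} = H"

text \<open>An element of \<open>H\<^sup>*\<close> is a function on the whole type that is linear on \<open>H\<close> and, so that distinct
  functions are distinct functionals, \<open>0\<close> outside \<open>H\<close>.\<close>

definition dual_space ::
  "(complex \<Rightarrow> 'g::ab_group_add \<Rightarrow> 'g) \<Rightarrow> 'g set \<Rightarrow> ('g \<Rightarrow> complex) set" where
  "dual_space scale H =
     {f. (\<forall>x\<in>H. \<forall>y\<in>H. f (x + y) = f x + f y) \<and> (\<forall>c. \<forall>x\<in>H. f (scale c x) = c * f x) \<and>
         (\<forall>x. x \<notin> H \<longrightarrow> f x = 0)}"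

definition root_space ::
  "(complex \<Rightarrow> 'g::ab_group_add \<Rightarrow> 'g) \<Rightarrow> ('g \<Rightarrow> 'g \<Rightarrow> 'g) \<Rightarrow> 'g set \<Rightarrow> ('g \<Rightarrow> complex) \<Rightarrow> 'g set" where
  "root_space scale bracket H \<alpha> = {x. \<forall>h\<in>H. bracket h x = scale (\<alpha> h) x}"

definition roots ::
  "(complex \<Rightarrow> 'g::ab_group_add \<Rightarrow> 'g) \<Rightarrow> ('g \<Rightarrow> 'g \<Rightarrow> 'g) \<Rightarrow> 'g set \<Rightarrow> ('g \<Rightarrow> complex) set" where
  "roots scale bracket H =
     {\<alpha> \<in> dual_space scale H. \<alpha> \<noteq> (\<lambda>_. 0) \<and> root_space scale bracket H \<alpha> \<noteq> {0}}"

definition positive_system ::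
  "(complex \<Rightarrow> 'g::ab_group_add \<Rightarrow> 'g) \<Rightarrow> ('g \<Rightarrow> 'g \<Rightarrow> 'g) \<Rightarrow> 'g set \<Rightarrow> ('g \<Rightarrow> complex) set \<Rightarrow> bool" where
  "positive_system scale bracket H P \<longleftrightarrow>
     P \<subseteq> roots scale bracket H \<and>
     (\<forall>\<alpha>\<in>roots scale bracket H. \<alpha> \<in> P \<longleftrightarrow> (\<lambda>x. - \<alpha> x) \<notin> P) \<and>
     (\<forall>\<alpha>\<in>P. \<forall>\<beta>\<in>P. (\<lambda>x. \<alpha> x + \<beta> x) \<in> roots scale bracket H \<longrightarrow> (\<lambda>x. \<alpha> x + \<beta> x) \<in> P)"

text \<open>The greatest root for the partial order in which \<open>\<beta> \<le> \<theta>\<close> iff \<open>\<theta> - \<beta>\<close> is a sum of positive roots.\<close>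

definition highest_root ::
  "(complex \<Rightarrow> 'g::ab_group_add \<Rightarrow> 'g) \<Rightarrow> ('g \<Rightarrow> 'g \<Rightarrow> 'g) \<Rightarrow> 'g set \<Rightarrow> ('g \<Rightarrow> complex) set
     \<Rightarrow> ('g \<Rightarrow> complex) \<Rightarrow> bool" where
  "highest_root scale bracket H P \<theta> \<longleftrightarrow>
     \<theta> \<in> roots scale bracket H \<and>
     (\<forall>\<beta>\<in>roots scale bracket H. \<exists>c :: ('g \<Rightarrow> complex) \<Rightarrow> nat.
        \<forall>h\<in>H. \<theta> h - \<beta> h = (\<Sum>\<alpha>\<in>P. of_nat (c \<alpha>) * \<alpha> h))"

definition coroot ::
  "(complex \<Rightarrow> 'g::ab_group_add \<Rightarrow> 'g) \<Rightarrow> ('g \<Rightarrow> 'g \<Rightarrow> 'g) \<Rightarrow> 'g set \<Rightarrow> ('g \<Rightarrow> complex) \<Rightarrow> 'g" where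
  "coroot scale bracket H \<alpha> =
     (THE h. h \<in> module.span scale
               {bracket x y | x y. x \<in> root_space scale bracket H \<alpha> \<and>
                                   y \<in> root_space scale bracket H (\<lambda>x. - \<alpha> x)} \<and>
             \<alpha> h = 2)"

definition dominant_integral ::
  "(complex \<Rightarrow> 'g::ab_group_add \<Rightarrow> 'g) \<Rightarrow> ('g \<Rightarrow> 'g \<Rightarrow> 'g) \<Rightarrow> 'g set \<Rightarrow> ('g \<Rightarrow> complex) set
     \<Rightarrow> ('g \<Rightarrow> complex) \<Rightarrow> bool" where
  "dominant_integral scale bracket H P \<Lambda> \<longleftrightarrow>
     \<Lambda> \<in> dual_space scale H \<and> (\<forall>\<alpha>\<in>P. \<Lambda> (coroot scale bracket H \<alpha>) \<in> \<nat>)"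

section \<open>The normalized Killing form and the dual Coxeter number\<close>

definition killing_form ::
  "(complex \<Rightarrow> 'g::ab_group_add \<Rightarrow> 'g) \<Rightarrow> ('g \<Rightarrow> 'g \<Rightarrow> 'g) \<Rightarrow> 'g \<Rightarrow> 'g \<Rightarrow> complex" where
  "killing_form scale bracket x y = endo_trace scale (\<lambda>z. bracket x (bracket y z))"

text \<open>The form induced on \<open>H\<^sup>*\<close> by identifying \<open>\<alpha>\<close> with the \<open>t \<in> H\<close> such that \<open>\<langle>t, h\<rangle> = \<alpha> h\<close>.\<close>

definition square_length :: "('g \<Rightarrow> 'g \<Rightarrow> complex) \<Rightarrow> 'g set \<Rightarrow> ('g \<Rightarrow> complex) \<Rightarrow> complex" where
  "square_length ip H \<alpha> =
     (let t = (THE t. t \<in> H \<and> (\<forall>h\<in>H. ip t h = \<alpha> h)) in ip t t)"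

text \<open>Square lengths of roots for the Killing form are positive real numbers, so comparing real
  parts compares lengths.\<close>

definition long_root ::
  "(complex \<Rightarrow> 'g::ab_group_add \<Rightarrow> 'g) \<Rightarrow> ('g \<Rightarrow> 'g \<Rightarrow> 'g) \<Rightarrow> 'g set \<Rightarrow> ('g \<Rightarrow> complex) \<Rightarrow> bool" where
  "long_root scale bracket H \<alpha> \<longleftrightarrow>
     \<alpha> \<in> roots scale bracket H \<and>
     (\<forall>\<beta>\<in>roots scale bracket H.
        Re (square_length (killing_form scale bracket) H \<beta>)
          \<le> Re (square_length (killing_form scale bracket) H \<alpha>))"

definition normalized_killing_form ::
  "(complex \<Rightarrow> 'g::ab_group_add \<Rightarrow> 'g) \<Rightarrow> ('g \<Rightarrow> 'g \<Rightarrow> 'g) \<Rightarrow> 'g set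
     \<Rightarrow> ('g \<Rightarrow> 'g \<Rightarrow> complex) \<Rightarrow> bool" where
  "normalized_killing_form scale bracket H ip \<longleftrightarrow>
     (\<exists>c. \<forall>x y. ip x y = c * killing_form scale bracket x y) \<and>
     (\<forall>\<alpha>. long_root scale bracket H \<alpha> \<longrightarrow> square_length ip H \<alpha> = 2)"

text \<open>\<open>1 + \<rho>(h\<^sub>\<theta>)\<close> with \<open>\<rho>\<close> half the sum of the positive roots.\<close>

definition dual_coxeter_number ::
  "(complex \<Rightarrow> 'g::ab_group_add \<Rightarrow> 'g) \<Rightarrow> ('g \<Rightarrow> 'g \<Rightarrow> 'g) \<Rightarrow> 'g set \<Rightarrow> ('g \<Rightarrow> complex) set
     \<Rightarrow> ('g \<Rightarrow> complex) \<Rightarrow> complex" where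
  "dual_coxeter_number scale bracket H P \<theta> =
     1 + (\<Sum>\<alpha>\<in>P. \<alpha> (coroot scale bracket H \<theta>)) / 2"

section \<open>Modules for Lie algebras\<close>

locale lie_module = lie_algebra scale bracket + mod: vector_space mscale
  for scale :: "complex \<Rightarrow> 'g::ab_group_add \<Rightarrow> 'g" and bracket :: "'g \<Rightarrow> 'g \<Rightarrow> 'g"
    and mscale :: "complex \<Rightarrow> 'm::ab_group_add \<Rightarrow> 'm" +
  fixes act :: "'g \<Rightarrow> 'm \<Rightarrow> 'm"
  assumes act_add_left: "act (x + y) v = act x v + act y v"
    and act_add_right: "act x (v + w) = act x v + act x w"
    and act_scale_left: "act (scale c x) v = mscale c (act x v)"
    and act_scale_right: "act x (mscale c v) = mscale c (act x v)"
    and act_bracket: "act (bracket x y) v = act x (act y v) - act y (act x v)"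

definition irreducible_lie_module ::
  "(complex \<Rightarrow> 'g::ab_group_add \<Rightarrow> 'g) \<Rightarrow> ('g \<Rightarrow> 'g \<Rightarrow> 'g)
     \<Rightarrow> (complex \<Rightarrow> 'm::ab_group_add \<Rightarrow> 'm) \<Rightarrow> ('g \<Rightarrow> 'm \<Rightarrow> 'm) \<Rightarrow> bool" where
  "irreducible_lie_module scale bracket mscale act \<longleftrightarrow>
     lie_module scale bracket mscale act \<and>
     (\<exists>v :: 'm. v \<noteq> 0) \<and>
     (\<forall>S. module.subspace mscale S \<and> (\<forall>x. \<forall>v\<in>S. act x v \<in> S) \<longrightarrow> S = {0} \<or> S = UNIV)"

definition irreducible_highest_weight_module ::
  "(complex \<Rightarrow> 'g::ab_group_add \<Rightarrow> 'g) \<Rightarrow> ('g \<Rightarrow> 'g \<Rightarrow> 'g) \<Rightarrow> 'g set \<Rightarrow> ('g \<Rightarrow> complex) set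
     \<Rightarrow> ('g \<Rightarrow> complex) \<Rightarrow> (complex \<Rightarrow> 'm::ab_group_add \<Rightarrow> 'm) \<Rightarrow> ('g \<Rightarrow> 'm \<Rightarrow> 'm) \<Rightarrow> bool" where
  "irreducible_highest_weight_module scale bracket H P \<Lambda> mscale act \<longleftrightarrow>
     irreducible_lie_module scale bracket mscale act \<and>
     (\<exists>v. v \<noteq> 0 \<and> (\<forall>h\<in>H. act h v = mscale (\<Lambda> h) v) \<and>
          (\<forall>\<alpha>\<in>P. \<forall>x\<in>root_space scale bracket H \<alpha>. act x v = 0))"

text \<open>\<open>Q\<close> is an irreducible quotient of the module \<open>X\<close>.\<close>

definition irreducible_quotient ::
  "(complex \<Rightarrow> 'g::ab_group_add \<Rightarrow> 'g) \<Rightarrow> ('g \<Rightarrow> 'g \<Rightarrow> 'g)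
     \<Rightarrow> (complex \<Rightarrow> 'x::ab_group_add \<Rightarrow> 'x) \<Rightarrow> ('g \<Rightarrow> 'x \<Rightarrow> 'x)
     \<Rightarrow> (complex \<Rightarrow> 'q::ab_group_add \<Rightarrow> 'q) \<Rightarrow> ('g \<Rightarrow> 'q \<Rightarrow> 'q) \<Rightarrow> bool" where
  "irreducible_quotient scale bracket scaleX actX scaleQ actQ \<longleftrightarrow>
     irreducible_lie_module scale bracket scaleQ actQ \<and>
     (\<exists>f. Vector_Spaces.linear scaleX scaleQ f \<and> surj f \<and> (\<forall>x v. f (actX x v) = actQ x (f v)))"

text \<open>
  The induced module \<open>U(L) \<otimes>\<^bsub>U(B)\<^esub> M\<close> for a subalgebra \<open>B\<close> of \<open>L\<close> and a \<open>B\<close>-module \<open>M\<close>.  The basis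
  vector \<open>([x\<^sub>1, \<dots>, x\<^sub>k], m)\<close> of the free vector space stands for \<open>x\<^sub>1 \<dots> x\<^sub>k \<otimes> m\<close>; the relators
  express multilinearity, the relation \<open>x y - y x = [x, y]\<close> of \<open>U(L)\<close>, and balancing over \<open>B\<close>.
  Only the values of \<open>actB\<close> on \<open>B\<close> matter.
\<close>

definition induced_relators ::
  "(complex \<Rightarrow> 'l::ab_group_add \<Rightarrow> 'l) \<Rightarrow> ('l \<Rightarrow> 'l \<Rightarrow> 'l) \<Rightarrow> 'l set
     \<Rightarrow> (complex \<Rightarrow> 'm::ab_group_add \<Rightarrow> 'm) \<Rightarrow> ('l \<Rightarrow> 'm \<Rightarrow> 'm) \<Rightarrow> (('l list \<times> 'm) \<Rightarrow>\<^sub>0 complex) set" where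
  "induced_relators scale bracket B mscale actB =
     {Poly_Mapping.single (xs @ [x + y] @ ys, m) 1
        - Poly_Mapping.single (xs @ [x] @ ys, m) 1 - Poly_Mapping.single (xs @ [y] @ ys, m) 1
      | xs x y ys m. True} \<union>
     {Poly_Mapping.single (xs @ [scale c x] @ ys, m) 1 - Poly_Mapping.single (xs @ [x] @ ys, m) c
      | xs c x ys m. True} \<union>
     {Poly_Mapping.single (xs, m + m') 1
        - Poly_Mapping.single (xs, m) 1 - Poly_Mapping.single (xs, m') 1
      | xs m m'. True} \<union>
     {Poly_Mapping.single (xs, mscale c m) 1 - Poly_Mapping.single (xs, m) c
      | xs c m. True} \<union>
     {Poly_Mapping.single (xs @ [x, y] @ ys, m) 1
        - Poly_Mapping.single (xs @ [y, x] @ ys, m) 1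
        - Poly_Mapping.single (xs @ [bracket x y] @ ys, m) 1
      | xs x y ys m. True} \<union>
     {Poly_Mapping.single (xs @ [b], m) 1 - Poly_Mapping.single (xs, actB b m) 1
      | xs b m. b \<in> B}"

text \<open>\<open>X\<close> is the induced module, with \<open>\<pi>\<close> the canonical projection from the free vector space.\<close>

definition induced_module ::
  "(complex \<Rightarrow> 'l::ab_group_add \<Rightarrow> 'l) \<Rightarrow> ('l \<Rightarrow> 'l \<Rightarrow> 'l) \<Rightarrow> 'l set
     \<Rightarrow> (complex \<Rightarrow> 'm::ab_group_add \<Rightarrow> 'm) \<Rightarrow> ('l \<Rightarrow> 'm \<Rightarrow> 'm)
     \<Rightarrow> (complex \<Rightarrow> 'x::ab_group_add \<Rightarrow> 'x) \<Rightarrow> ('l \<Rightarrow> 'x \<Rightarrow> 'x)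
     \<Rightarrow> ((('l list \<times> 'm) \<Rightarrow>\<^sub>0 complex) \<Rightarrow> 'x) \<Rightarrow> bool" where
  "induced_module scale bracket B mscale actB scaleX actX \<pi> \<longleftrightarrow>
     lie_module scale bracket scaleX actX \<and>
     Vector_Spaces.linear free_scale scaleX \<pi> \<and> surj \<pi> \<and>
     {f. \<pi> f = 0} = module.span free_scale (induced_relators scale bracket B mscale actB) \<and>
     (\<forall>x xs m. actX x (\<pi> (Poly_Mapping.single (xs, m) 1)) = \<pi> (Poly_Mapping.single (x # xs, m) 1))"

section \<open>Affine Lie algebras\<close>

text \<open>\<open>(f, z)\<close> stands for \<open>(\<Sum>n. f n \<otimes> t\<^sup>n) + z k\<close>.\<close>

type_synonym 'g affine = "(int \<Rightarrow>\<^sub>0 'g) \<times> complex"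

definition affine_scale ::
  "(complex \<Rightarrow> 'g::ab_group_add \<Rightarrow> 'g) \<Rightarrow> complex \<Rightarrow> 'g affine \<Rightarrow> 'g affine" where
  "affine_scale scale c u = (Poly_Mapping.map (scale c) (fst u), c * snd u)"

definition affine_bracket ::
  "('g::ab_group_add \<Rightarrow> 'g \<Rightarrow> 'g) \<Rightarrow> ('g \<Rightarrow> 'g \<Rightarrow> complex) \<Rightarrow> 'g affine \<Rightarrow> 'g affine \<Rightarrow> 'g affine" where
  "affine_bracket bracket ip u v =
     (\<Sum>m\<in>Poly_Mapping.keys (fst u). \<Sum>n\<in>Poly_Mapping.keys (fst v).
        Poly_Mapping.single (m + n)
          (bracket (Poly_Mapping.lookup (fst u) m) (Poly_Mapping.lookup (fst v) n)),
      \<Sum>m\<in>Poly_Mapping.keys (fst u). \<Sum>n\<in>Poly_Mapping.keys (fst v).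
        if m + n = 0
        then of_int m * ip (Poly_Mapping.lookup (fst u) m) (Poly_Mapping.lookup (fst v) n) else 0)"

definition loop :: "'g::ab_group_add \<Rightarrow> int \<Rightarrow> 'g affine" where
  "loop a n = (Poly_Mapping.single n a, 0)"

definition affine_nonneg :: "'g::ab_group_add affine set" where
  "affine_nonneg = {u. \<forall>n<0. Poly_Mapping.lookup (fst u) n = 0}"

definition top_action ::
  "complex \<Rightarrow> (complex \<Rightarrow> 'm::ab_group_add \<Rightarrow> 'm) \<Rightarrow> ('g::ab_group_add \<Rightarrow> 'm \<Rightarrow> 'm)
     \<Rightarrow> 'g affine \<Rightarrow> 'm \<Rightarrow> 'm" where
  "top_action l mscale act u m = act (Poly_Mapping.lookup (fst u) 0) m + mscale (l * snd u) m"

definition affine_induced_module ::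
  "(complex \<Rightarrow> 'g::ab_group_add \<Rightarrow> 'g) \<Rightarrow> ('g \<Rightarrow> 'g \<Rightarrow> 'g) \<Rightarrow> ('g \<Rightarrow> 'g \<Rightarrow> complex) \<Rightarrow> complex
     \<Rightarrow> (complex \<Rightarrow> 'm::ab_group_add \<Rightarrow> 'm) \<Rightarrow> ('g \<Rightarrow> 'm \<Rightarrow> 'm)
     \<Rightarrow> (complex \<Rightarrow> 'x::ab_group_add \<Rightarrow> 'x) \<Rightarrow> ('g affine \<Rightarrow> 'x \<Rightarrow> 'x)
     \<Rightarrow> ((('g affine list \<times> 'm) \<Rightarrow>\<^sub>0 complex) \<Rightarrow> 'x) \<Rightarrow> bool" where
  "affine_induced_module scale bracket ip l mscale act scaleX actX \<pi> \<longleftrightarrow>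
     induced_module (affine_scale scale) (affine_bracket bracket ip) affine_nonneg
       mscale (top_action l mscale act) scaleX actX \<pi>"

section \<open>Vertex operator algebras and modules\<close>

text \<open>
  A vertex operator map is given by its modes: \<open>Y u n v\<close> is \<open>u\<^sub>n v\<close>, the coefficient of
  \<open>x\<^sup>-\<^sup>n\<^sup>-\<^sup>1\<close> in \<open>Y(u, x) v\<close>.  The Jacobi identity is stated for the coefficient of
  \<open>x\<^sub>0\<^sup>-\<^sup>k\<^sup>-\<^sup>1 x\<^sub>1\<^sup>-\<^sup>m\<^sup>-\<^sup>1 x\<^sub>2\<^sup>-\<^sup>n\<^sup>-\<^sup>1\<close>.  By lower truncation only finitely many terms of each sum
  are nonzero, and \<open>Sum_any\<close> adds these up.
\<close>

definition jacobi_identity ::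
  "(complex \<Rightarrow> 'w::ab_group_add \<Rightarrow> 'w) \<Rightarrow> ('v \<Rightarrow> int \<Rightarrow> 'v \<Rightarrow> 'v) \<Rightarrow> ('v \<Rightarrow> int \<Rightarrow> 'w \<Rightarrow> 'w) \<Rightarrow> bool" where
  "jacobi_identity scale Y YW \<longleftrightarrow>
     (\<forall>u v w k m n.
        Sum_any (\<lambda>i::nat. scale (of_int m gchoose i)
          (YW (Y u (k + int i) v) (m + n - int i) w)) =
        Sum_any (\<lambda>i::nat. scale ((-1) ^ i * (of_int k gchoose i))
          (YW u (m + k - int i) (YW v (n + int i) w)
             - scale ((-1) powi k) (YW v (n + k - int i) (YW u (m + int i) w)))))"

definition virasoro_mode :: "('v \<Rightarrow> int \<Rightarrow> 'w \<Rightarrow> 'w) \<Rightarrow> 'v \<Rightarrow> int \<Rightarrow> 'w \<Rightarrow> 'w" where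
  "virasoro_mode Y om n = Y om (n + 1)"

definition weight_space ::
  "(complex \<Rightarrow> 'w::ab_group_add \<Rightarrow> 'w) \<Rightarrow> ('w \<Rightarrow> 'w) \<Rightarrow> complex \<Rightarrow> 'w set" where
  "weight_space scale d m = {w. d w = scale m w}"

locale vertex_operator_algebra = vector_space scale
  for scale :: "complex \<Rightarrow> 'v::ab_group_add \<Rightarrow> 'v" +
  fixes Y :: "'v \<Rightarrow> int \<Rightarrow> 'v \<Rightarrow> 'v" and vac :: 'v and om :: 'v
  assumes Y_add_left: "Y (u + v) n w = Y u n w + Y v n w"
    and Y_add_right: "Y u n (v + w) = Y u n v + Y u n w"
    and Y_scale_left: "Y (scale c u) n v = scale c (Y u n v)"
    and Y_scale_right: "Y u n (scale c v) = scale c (Y u n v)"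
    and truncation: "\<exists>N. \<forall>n\<ge>N. Y u n v = 0"
    and vacuum: "Y vac n v = (if n = -1 then v else 0)"
    and creation: "Y u (-1) vac = u" "n \<ge> 0 \<Longrightarrow> Y u n vac = 0"
    and jacobi: "jacobi_identity scale Y Y"
    and virasoro: "\<exists>c. \<forall>m n v.
          virasoro_mode Y om m (virasoro_mode Y om n v)
            - virasoro_mode Y om n (virasoro_mode Y om m v)
          = scale (of_int (m - n)) (virasoro_mode Y om (m + n) v)
            + (if m + n = 0 then scale (of_int (m ^ 3 - m) / 12 * c) v else 0)"
    and derivative: "Y (virasoro_mode Y om (-1) u) n v = scale (- of_int n) (Y u (n - 1) v)"
    and grading:
      "span (\<Union>n::int. weight_space scale (virasoro_mode Y om 0) (of_int n)) = UNIV"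
      "fin_dim scale (weight_space scale (virasoro_mode Y om 0) (of_int n))"
      "\<exists>N::int. \<forall>n<N. weight_space scale (virasoro_mode Y om 0) (of_int n) = {0}"
    and vacuum_weight: "vac \<in> weight_space scale (virasoro_mode Y om 0) 0"
    and conformal_weight: "om \<in> weight_space scale (virasoro_mode Y om 0) 2"

text \<open>The Virasoro relations on \<open>W\<close>, with the central charge of \<open>V\<close>, follow from the axioms below.\<close>

locale voa_module = vertex_operator_algebra scale Y vac om + W: vector_space wscale
  for scale :: "complex \<Rightarrow> 'v::ab_group_add \<Rightarrow> 'v" and Y :: "'v \<Rightarrow> int \<Rightarrow> 'v \<Rightarrow> 'v"
    and vac :: 'v and om :: 'v and wscale :: "complex \<Rightarrow> 'w::ab_group_add \<Rightarrow> 'w" +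
  fixes YW :: "'v \<Rightarrow> int \<Rightarrow> 'w \<Rightarrow> 'w" and d :: "'w \<Rightarrow> 'w"
  assumes YW_add_left: "YW (u + v) n w = YW u n w + YW v n w"
    and YW_add_right: "YW u n (w + w') = YW u n w + YW u n w'"
    and YW_scale_left: "YW (scale c u) n w = wscale c (YW u n w)"
    and YW_scale_right: "YW u n (wscale c w) = wscale c (YW u n w)"
    and YW_truncation: "\<exists>N. \<forall>n\<ge>N. YW u n w = 0"
    and YW_vacuum: "YW vac n w = (if n = -1 then w else 0)"
    and YW_jacobi: "jacobi_identity wscale Y YW"
    and YW_derivative: "YW (virasoro_mode Y om (-1) u) n w = wscale (- of_int n) (YW u (n - 1) w)"
    and d_linear: "Vector_Spaces.linear wscale wscale d"
    and d_bracket: "d (YW u n w) - YW u n (d w) =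
          YW (virasoro_mode Y om 0 u) n w - wscale (of_int (n + 1)) (YW u n w)"
    and d_grading:
      "W.span (\<Union>m. weight_space wscale d m) = UNIV"
      "fin_dim wscale (weight_space wscale d m)"
      "\<exists>r::real. \<forall>m. Re m < r \<longrightarrow> weight_space wscale d m = {0}"

definition voa_ideal ::
  "(complex \<Rightarrow> 'v::ab_group_add \<Rightarrow> 'v) \<Rightarrow> ('v \<Rightarrow> int \<Rightarrow> 'v \<Rightarrow> 'v) \<Rightarrow> 'v set \<Rightarrow> bool" where
  "voa_ideal scale Y I \<longleftrightarrow>
     module.subspace scale I \<and> (\<forall>u n. \<forall>v\<in>I. Y u n v \<in> I \<and> Y v n u \<in> I)"

definition simple_voa ::
  "(complex \<Rightarrow> 'v::ab_group_add \<Rightarrow> 'v) \<Rightarrow> ('v \<Rightarrow> int \<Rightarrow> 'v \<Rightarrow> 'v) \<Rightarrow> 'v \<Rightarrow> 'v \<Rightarrow> bool" where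
  "simple_voa scale Y vac om \<longleftrightarrow>
     vertex_operator_algebra scale Y vac om \<and> (\<exists>v :: 'v. v \<noteq> 0) \<and>
     (\<forall>I. voa_ideal scale Y I \<longrightarrow> I = {0} \<or> I = UNIV)"

definition voa_hom ::
  "(complex \<Rightarrow> 'u::ab_group_add \<Rightarrow> 'u) \<Rightarrow> ('u \<Rightarrow> int \<Rightarrow> 'u \<Rightarrow> 'u) \<Rightarrow> 'u \<Rightarrow> 'u
     \<Rightarrow> (complex \<Rightarrow> 'v::ab_group_add \<Rightarrow> 'v) \<Rightarrow> ('v \<Rightarrow> int \<Rightarrow> 'v \<Rightarrow> 'v) \<Rightarrow> 'v \<Rightarrow> 'v
     \<Rightarrow> ('u \<Rightarrow> 'v) \<Rightarrow> bool" where
  "voa_hom scaleU YU vacU omU scaleV YV vacV omV f \<longleftrightarrow>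
     Vector_Spaces.linear scaleU scaleV f \<and>
     (\<forall>u n v. f (YU u n v) = YV (f u) n (f v)) \<and> f vacU = vacV \<and> f omU = omV"

section \<open>Affine vertex operator algebras\<close>

definition dual_vector ::
  "('g \<Rightarrow> 'g \<Rightarrow> complex) \<Rightarrow> 'g set \<Rightarrow> 'g \<Rightarrow> 'g" where
  "dual_vector ip B b = (THE y. \<forall>b'\<in>B. ip b' y = (if b' = b then 1 else 0))"

text \<open>The vector does not depend on the choice made in \<open>some_basis\<close>.\<close>

definition sugawara_vector ::
  "(complex \<Rightarrow> 'g::ab_group_add \<Rightarrow> 'g) \<Rightarrow> ('g \<Rightarrow> 'g \<Rightarrow> complex) \<Rightarrow> complex \<Rightarrow> complex
     \<Rightarrow> (complex \<Rightarrow> 'u::ab_group_add \<Rightarrow> 'u) \<Rightarrow> ('g affine \<Rightarrow> 'u \<Rightarrow> 'u) \<Rightarrow> 'u \<Rightarrow> 'u" where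
  "sugawara_vector scale ip hv l scaleU actU vac =
     scaleU (1 / (2 * (l + hv)))
       (\<Sum>b\<in>some_basis scale.
          actU (loop b (-1)) (actU (loop (dual_vector ip (some_basis scale) b) (-1)) vac))"

text \<open>
  The vertex operator algebra structure on the module induced from the trivial \<open>\<gg>\<close>-module \<open>\<complex>\<close> (this
  is the irreducible module of highest weight \<open>0\<close>, see below).  It is determined by
  \<open>Y(a(-1)1, x) = \<Sum>n. a(n) x\<^sup>-\<^sup>n\<^sup>-\<^sup>1\<close>, where \<open>a(n)\<close> is the action of \<open>a \<otimes> t\<^sup>n\<close>.
\<close>

definition universal_affine_voa ::
  "(complex \<Rightarrow> 'g::ab_group_add \<Rightarrow> 'g) \<Rightarrow> ('g \<Rightarrow> 'g \<Rightarrow> 'g) \<Rightarrow> ('g \<Rightarrow> 'g \<Rightarrow> complex)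
     \<Rightarrow> complex \<Rightarrow> complex
     \<Rightarrow> (complex \<Rightarrow> 'u::ab_group_add \<Rightarrow> 'u) \<Rightarrow> ('g affine \<Rightarrow> 'u \<Rightarrow> 'u)
     \<Rightarrow> ('u \<Rightarrow> int \<Rightarrow> 'u \<Rightarrow> 'u) \<Rightarrow> 'u \<Rightarrow> 'u \<Rightarrow> bool" where
  "universal_affine_voa scale bracket ip hv l scaleU actU Y vac om \<longleftrightarrow>
     vertex_operator_algebra scaleU Y vac om \<and>
     (\<exists>\<pi>. affine_induced_module scale bracket ip l ((*) :: complex \<Rightarrow> complex \<Rightarrow> complex) (\<lambda>_ _. 0)
            scaleU actU \<pi> \<and>
          vac = \<pi> (Poly_Mapping.single ([], 1) 1)) \<and>
     (\<forall>a n. Y (actU (loop a (-1)) vac) n = actU (loop a n)) \<and>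
     om = sugawara_vector scale ip hv l scaleU actU vac"

lemma trivial_irreducible_highest_weight_module:
  assumes "lie_algebra scale bracket"
  shows "irreducible_highest_weight_module scale bracket H P (\<lambda>_. 0)
           ((*) :: complex \<Rightarrow> complex \<Rightarrow> complex) (\<lambda>_ _. 0)"
proof -
  interpret lie_algebra scale bracket by (rule assms)
  interpret C: vector_space "(*) :: complex \<Rightarrow> complex \<Rightarrow> complex"
    by unfold_locales (auto simp: algebra_simps)
  have mod: "lie_module scale bracket ((*) :: complex \<Rightarrow> complex \<Rightarrow> complex) (\<lambda>_ _. 0)"
    by unfold_locales auto
  have "S = {0} \<or> S = UNIV" if S: "C.subspace S" for S
  proof (cases "S \<subseteq> {0}")
    case True
    then show ?thesis using C.subspace_0[OF S] by auto
  next
    case False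
    then obtain x where x: "x \<in> S" "x \<noteq> 0" by auto
    have "y \<in> S" for y
      using C.subspace_scale[OF S x(1), of "y / x"] x(2) by simp
    then show ?thesis by auto
  qed
  with mod show ?thesis
    unfolding irreducible_highest_weight_module_def irreducible_lie_module_def
    by (auto intro!: exI[of _ "1::complex"])
qed

section \<open>Derivations\<close>

text \<open>
  \<open>opposite_mode wscale YW om w n v\<close> is \<open>w\<^sub>n v\<close>, the coefficient of \<open>x\<^sup>-\<^sup>n\<^sup>-\<^sup>1\<close> in
  \<open>exp(x L(-1)) Y\<^sub>W(v, -x) w\<close>; the term \<open>L(-1)\<^sup>i v\<^bsub>n+i\<^esub> w\<close> carries the sign
  \<open>(-1)\<^sup>-\<^sup>(\<^sup>n\<^sup>+\<^sup>i\<^sup>)\<^sup>-\<^sup>1\<close> of the corresponding power of \<open>-x\<close>.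
\<close>

definition opposite_mode ::
  "(complex \<Rightarrow> 'w::ab_group_add \<Rightarrow> 'w) \<Rightarrow> ('v \<Rightarrow> int \<Rightarrow> 'w \<Rightarrow> 'w) \<Rightarrow> 'v \<Rightarrow> 'w \<Rightarrow> int \<Rightarrow> 'v \<Rightarrow> 'w" where
  "opposite_mode wscale YW om w n v =
     Sum_any (\<lambda>i::nat. wscale ((-1) powi (- (n + int i) - 1) / fact i)
       ((virasoro_mode YW om (-1) ^^ i) (YW v (n + int i) w)))"

definition derivation ::
  "(complex \<Rightarrow> 'v::ab_group_add \<Rightarrow> 'v) \<Rightarrow> ('v \<Rightarrow> int \<Rightarrow> 'v \<Rightarrow> 'v) \<Rightarrow> 'v
     \<Rightarrow> (complex \<Rightarrow> 'w::ab_group_add \<Rightarrow> 'w) \<Rightarrow> ('v \<Rightarrow> int \<Rightarrow> 'w \<Rightarrow> 'w) \<Rightarrow> ('w \<Rightarrow> 'w)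
     \<Rightarrow> ('v \<Rightarrow> 'w) \<Rightarrow> bool" where
  "derivation scale Y om wscale YW d F \<longleftrightarrow>
     Vector_Spaces.linear scale wscale F \<and>
     F \<circ> virasoro_mode Y om 0 = d \<circ> F \<and>
     (\<forall>u n v. F (Y u n v) = YW u n (F v) + opposite_mode wscale YW om (F u) n v)"

definition H1 ::
  "(complex \<Rightarrow> 'v::ab_group_add \<Rightarrow> 'v) \<Rightarrow> ('v \<Rightarrow> int \<Rightarrow> 'v \<Rightarrow> 'v) \<Rightarrow> 'v
     \<Rightarrow> (complex \<Rightarrow> 'w::ab_group_add \<Rightarrow> 'w) \<Rightarrow> ('v \<Rightarrow> int \<Rightarrow> 'w \<Rightarrow> 'w) \<Rightarrow> ('w \<Rightarrow> 'w)
     \<Rightarrow> ('v \<Rightarrow> 'w) set" where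
  "H1 scale Y om wscale YW d = {F. derivation scale Y om wscale YW d F}"

definition Z1 ::
  "(complex \<Rightarrow> 'w::ab_group_add \<Rightarrow> 'w) \<Rightarrow> ('v \<Rightarrow> int \<Rightarrow> 'w \<Rightarrow> 'w) \<Rightarrow> 'v \<Rightarrow> ('w \<Rightarrow> 'w)
     \<Rightarrow> ('v \<Rightarrow> 'w) set" where
  "Z1 wscale YW om d =
     {\<lambda>v. opposite_mode wscale YW om w 0 v | w. w \<in> weight_space wscale d 1}"

end

theory Submission
  imports Defs "HOL-Computational_Algebra.Fundamental_Theorem_Algebra"
begin

text \<open>
  A derivation \<open>F\<close> is determined by its restriction to \<open>\<gg> = V\<^sub>(\<^sub>1\<^sub>)\<close>, because \<open>\<gg>\<close> generates \<open>V\<close>, and this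
  restriction is a 1-cocycle of \<open>\<gg>\<close> with values in \<open>W\<^sub>[\<^sub>1\<^sub>]\<close>.  If the Casimir operator acts on \<open>W\<^sub>[\<^sub>1\<^sub>]\<close> by a
  nonzero scalar, the cocycle is an explicit coboundary, and \<open>F\<close> agrees on \<open>\<gg>\<close>, hence everywhere, with
  a zero-mode derivation.

  By the Sugawara formula the lowest weight \<open>h\<close> of \<open>W\<close> is the Casimir eigenvalue on the top space divided
  by \<open>2 (l + h\<^sup>\<or>)\<close>.  The traces of the squared coroot \<open>t\<close> of a long root on \<open>\<gg>\<close> and on the top
  space are sums of squares of integers, and comparing them yields \<open>h \<ge> 0\<close>, with a trivial top space if
  \<open>h = 0\<close>.  So \<open>W\<^sub>[\<^sub>1\<^sub>]\<close> is zero, or the top space (\<open>h = 1\<close>), or spanned by the vectors \<open>a(-1) \<tau>\<close> with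
  \<open>\<tau>\<close> in a trivial top space (\<open>h = 0\<close>); in the last two cases the Casimir scalar is \<open>2 (l + h\<^sup>\<or>)\<close>
  and \<open>2 h\<^sup>\<or>\<close>.

  No semisimplicity of the Cartan subalgebra is needed: its Fitting decomposition makes the form
  nondegenerate on it, and the long root then provides \<open>e\<close>, \<open>f\<close> with \<open>[t, e] = 2 e\<close> and \<open>[e, f] = t\<close>,
  which suffices for the integrality of the eigenvalues of \<open>t\<close>.
\<close>

section \<open>Endomorphisms of complex vector spaces\<close>

text \<open>The restriction of \<open>F\<close> to the currents a(-1)1 is a cocycle only up to
  correction terms. The derivation rule gives F([a,b]) = a_0 F(b) + F(a)_0 b, and skew-symmetry
  expands the last term as - b_0 F(a) + L(-1) b_1 F(a) - .... The corrections vanish because b_n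
  F(a) = 0 for n at least 2, while b_1 F(a) has weight 0: it is 0 or lies in a trivial top space,
  and the Sugawara formula shows that L(-1) kills the latter. So the analysis of the weight one
  space must deliver more than the Casimir scalar.

  The Sugawara constant \<open>s\<close> is never evaluated through roots. In V the two expressions
  for L(-1) a(-1)1, from the translation axiom and from the Sugawara formula, force
  \<open>s * (2 * l + S / 2) = 1\<close>, where \<open>S / 2\<close> is the ratio of the Killing
  form to \<open>ip\<close>. On the top space the trace form is a multiple of \<open>ip\<close> by
  Schur's lemma; its value at \<open>t\<close> fixes the multiple, and the trace of the Casimir
  operator then gives the sign of h.\<close>

locale complex_vector_space = vector_space scale
  for scale :: "complex \<Rightarrow> 'a::ab_group_add \<Rightarrow> 'a"
begin

abbreviation endo :: "('a \<Rightarrow> 'a) \<Rightarrow> bool" where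
  "endo f \<equiv> module_hom scale scale f"

lemma endoI:
  "(\<And>x y. f (x + y) = f x + f y) \<Longrightarrow> (\<And>c x. f (scale c x) = scale c (f x)) \<Longrightarrow> endo f"
  by unfold_locales

lemma fin_dim_subset: "fin_dim scale Q \<Longrightarrow> R \<subseteq> Q \<Longrightarrow> fin_dim scale R"
  unfolding fin_dim_def by blast

lemma fin_dim_basis:
  assumes "fin_dim scale Q" "subspace Q"
  obtains B where "finite B" "independent B" "span B = Q"
proof -
  obtain A where A: "finite A" "Q \<subseteq> span A" using assms(1) unfolding fin_dim_def by auto
  obtain B where B: "B \<subseteq> Q" "independent B" "Q \<subseteq> span B"
    using maximal_independent_subset by blast
  have "finite B" using independent_span_bound[OF A(1) B(2)] A B by auto
  moreover have "span B = Q" using B assms(2) span_minimal by blast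
  ultimately show ?thesis using that B by blast
qed

lemma dim_strict_mono:
  assumes "fin_dim scale Q" "subspace Q" "subspace R" "R \<subset> Q"
  shows "dim R < dim Q"
proof -
  obtain B where B: "finite B" "independent B" "span B = Q"
    using fin_dim_basis assms by metis
  obtain C where C: "finite C" "independent C" "span C = R"
    using fin_dim_basis fin_dim_subset assms by (metis psubset_imp_subset)
  obtain x where x: "x \<in> Q" "x \<notin> R" using assms(4) by auto
  have "independent (insert x C)" using C x independent_insertI by auto
  moreover have "insert x C \<subseteq> span B" using C B x assms(4) span_superset by blast
  ultimately have "card (insert x C) \<le> card B"
    using independent_span_bound[OF B(1)] by auto
  moreover have "x \<notin> C" using x C span_superset by blast
  ultimately have "card C < card B" using C(1) by simp
  then show ?thesis using dim_span_eq_card_independent[OF C(2)] dim_span_eq_card_independent[OF B(2)] C B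
    by simp
qed

lemma sequence_meets_earlier_span:
  fixes y :: "nat \<Rightarrow> 'a"
  assumes Q: "fin_dim scale Q" and y: "\<And>n. y n \<in> Q"
  obtains n where "y n \<in> span (y ` {..<n})"
proof (rule ccontr)
  assume "\<not> thesis"
  then have notin: "y n \<notin> span (y ` {..<n})" for n using that by blast
  have ind: "independent (y ` {..<n}) \<and> card (y ` {..<n}) = n" for n
  proof (induction n)
    case (Suc n)
    have "y n \<notin> y ` {..<n}" using notin[of n] span_base by metis
    moreover have "independent (insert (y n) (y ` {..<n}))"
      by (rule independent_insertI) (use notin Suc in auto)
    ultimately show ?case using Suc by (simp add: lessThan_Suc)
  qed (simp add: independent_empty)
  obtain B where B: "finite B" "Q \<subseteq> span B" using Q unfolding fin_dim_def by auto
  have "card (y ` {..<Suc (card B)}) \<le> card B"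
    using independent_span_bound[OF B(1), of "y ` {..<Suc (card B)}"] ind[of "Suc (card B)"] B y by blast
  then show False using ind[of "Suc (card B)"] by simp
qed

text \<open>The triangular condition contradicts the linear dependence that finite dimension forces.
  It serves twice: with products of shifts of an operator, to bound the number of eigenvalues, and
  with powers of a raising operator.\<close>

lemma no_infinite_separated_sequence:
  assumes Q: "fin_dim scale Q" and y: "\<And>n::nat. y n \<in> Q"
    and G: "\<And>n. endo (G n)" "\<And>n i. i < n \<Longrightarrow> G n (y i) = 0" "\<And>n. G n (y n) \<noteq> 0"
  shows False
proof -
  obtain n where n: "y n \<in> span (y ` {..<n})" using sequence_meets_earlier_span[OF Q y] .
  interpret G: module_hom scale scale "G n" by (rule G)
  have "G n (y n) = 0"
    by (rule G.eq_0_on_span[OF _ n]) (use G(2) in auto)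
  then show False using G(3) by blast
qed

section \<open>Polynomials in an endomorphism and existence of eigenvectors\<close>

lemma endo_funpow: "endo A \<Longrightarrow> endo (A ^^ n)"
proof (induction n)
  case 0
  then show ?case by (intro endoI) auto
next
  case (Suc n)
  then have "endo (A ^^ n)" by simp
  interpret A: module_hom scale scale A by fact
  interpret An: module_hom scale scale "A ^^ n" by fact
  show ?case by (intro endoI) (auto simp: A.add A.scale An.add An.scale)
qed

lemma endo_shift: "endo A \<Longrightarrow> endo (\<lambda>x. A x - scale c x)"
proof -
  assume "endo A"
  then interpret A: module_hom scale scale A .
  show ?thesis by (intro endoI) (auto simp: A.add A.scale algebra_simps)
qed

text \<open>Horner evaluation of the operator p(A) at the vector \<open>x\<close>.\<close>

definition poly_op :: "('a \<Rightarrow> 'a) \<Rightarrow> complex poly \<Rightarrow> 'a \<Rightarrow> 'a" where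
  "poly_op A p x = fold_coeffs (\<lambda>a r. scale a x + A r) p 0"

context
  fixes A assumes A: "endo A"
begin

interpretation A: module_hom scale scale A by (rule A)

lemma poly_op_0 [simp]: "poly_op A 0 x = 0"
  by (simp add: poly_op_def)

lemma poly_op_pCons [simp]: "poly_op A (pCons a p) x = scale a x + A (poly_op A p x)"
proof (cases "a = 0 \<and> p = 0")
  case True
  then show ?thesis by simp
next
  case False
  then show ?thesis by (auto simp: poly_op_def)
qed

lemma poly_op_add: "poly_op A (p + q) x = poly_op A p x + poly_op A q x"
  by (induction p q rule: poly_induct2) (auto simp: A.add algebra_simps)

lemma poly_op_smult: "poly_op A (smult c p) x = scale c (poly_op A p x)"
  by (induction p) (auto simp: A.scale algebra_simps)

lemma poly_op_minus: "poly_op A (p - q) x = poly_op A p x - poly_op A q x"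
  using poly_op_add[of p "smult (-1) q" x] poly_op_smult[of "-1" q x] by simp

lemma poly_op_in: "subspace Q \<Longrightarrow> A ` Q \<subseteq> Q \<Longrightarrow> x \<in> Q \<Longrightarrow> poly_op A p x \<in> Q"
  by (induction p) (auto simp: subspace_0 intro!: subspace_add subspace_scale)

lemma poly_op_monom: "poly_op A (monom c n) x = scale c ((A ^^ n) x)"
  by (induction n) (auto simp: monom_Suc monom_0 A.scale)

lemma annihilating_poly:
  assumes "fin_dim scale Q" "subspace Q" "A ` Q \<subseteq> Q" "x \<in> Q"
  shows "\<exists>p. p \<noteq> 0 \<and> poly_op A p x = 0"
proof -
  define y where "y n = (A ^^ n) x" for n
  have "y n \<in> Q" for n unfolding y_def using assms by (induction n) auto
  then obtain n where n: "y n \<in> span (y ` {..<n})"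
    using sequence_meets_earlier_span[OF assms(1)] by blast
  \<comment> \<open>The second disjunct covers the empty span, where no polynomial has degree below
    0.\<close>
  have span: "v \<in> span (y ` {..<n}) \<Longrightarrow> \<exists>p. degree p < n \<and> poly_op A p x = v \<or> v = 0 \<and> n = 0" for v n
  proof (induction rule: span_induct_alt)
    case base
    show ?case by (cases n) (auto intro: exI[of _ 0])
  next
    case (step c v w)
    then obtain i where i: "v = y i" "i < n" by auto
    with step obtain p where p: "degree p < n" "poly_op A p x = w" by auto
    have "degree (monom c i + p) < n"
      using i p by (meson degree_add_less degree_monom_le le_less_trans)
    moreover have "poly_op A (monom c i + p) x = scale c v + w"
      using i p by (simp add: poly_op_add poly_op_monom y_def)
    ultimately show ?case by blast
  qed
  from span[OF n] consider p where "degree p < n" "poly_op A p x = y n" | "y n = 0" "n = 0" by auto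
  then show ?thesis
  proof cases
    case 1
    then have "poly_op A (monom 1 n - p) x = 0" by (simp add: poly_op_minus poly_op_monom y_def)
    moreover have "monom 1 n - p \<noteq> 0" using 1 by (auto simp: degree_monom_eq)
    ultimately show ?thesis by blast
  next
    case 2
    then have "poly_op A 1 x = 0" by (simp add: y_def one_pCons)
    then show ?thesis using one_neq_zero by blast
  qed
qed

text \<open>Take a polynomial annihilating some nonzero \<open>x\<close> and split off a linear
  factor: the cofactor \<open>q\<close> either sends \<open>x\<close> to an eigenvector or
  annihilates \<open>x\<close> with smaller degree.\<close>

lemma eigenvector_exists:
  assumes "fin_dim scale Q" "subspace Q" "A ` Q \<subseteq> Q" "Q \<noteq> {0}"
  obtains \<mu> v where "v \<in> Q" "v \<noteq> 0" "A v = scale \<mu> v"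
proof -
  obtain x where x: "x \<in> Q" "x \<noteq> 0" using assms subspace_0 by blast
  obtain p where p: "p \<noteq> 0" "poly_op A p x = 0" using annihilating_poly[OF assms(1-3) x(1)] by auto
  have "\<exists>\<mu> v. v \<in> Q \<and> v \<noteq> 0 \<and> A v = scale \<mu> v" using p
  proof (induction "degree p" arbitrary: p rule: less_induct)
    case less
    have "\<not> constant (poly p)"
    proof
      assume "constant (poly p)"
      then have "degree p = 0" by (simp add: constant_degree)
      then obtain a where "p = [:a:]" by (rule degree_eq_zeroE)
      then show False using less.prems x by simp
    qed
    then obtain z where "poly p z = 0" using fundamental_theorem_of_algebra by blast
    then obtain q where q: "p = [:- z, 1:] * q" by (auto simp: poly_eq_0_iff_dvd)
    have "poly_op A p x = A (poly_op A q x) - scale z (poly_op A q x)"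
      using q by (simp add: poly_op_minus poly_op_smult)
    then have e: "A (poly_op A q x) = scale z (poly_op A q x)" using less.prems by simp
    show ?case
    proof (cases "poly_op A q x = 0")
      case True
      have "q \<noteq> 0" using q less.prems by auto
      moreover from this have "degree q < degree p" using q by (simp add: degree_mult_eq del: mult_pCons_left)
      ultimately show ?thesis using less.hyps True by blast
    next
      case False
      then show ?thesis using e poly_op_in[OF assms(2,3) x(1)] by blast
    qed
  qed
  then show ?thesis using that by blast
qed

end

section \<open>Traces on invariant subspaces\<close>

definition trace_on :: "'a set \<Rightarrow> ('a \<Rightarrow> 'a) \<Rightarrow> complex" where
  "trace_on B f = (\<Sum>b\<in>B. representation B (f b) b)"

text \<open>Expanding each basis in the other turns both traces into the same double sum. Hence
  \<open>trace_on B\<close> depends only on the invariant subspace \<open>span B\<close>, while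
  subspaces need no types of their own.\<close>

lemma trace_on_basis_change:
  assumes B: "finite B" "independent B" and C: "finite C" "independent C" and BC: "span B = span C"
    and f: "endo f" "f ` span B \<subseteq> span B"
  shows "trace_on B f = trace_on C f"
proof -
  interpret f: module_hom scale scale f by (rule f)
  have fB: "f b \<in> span B" if "b \<in> span B" for b using f(2) that by auto
  have repB: "(\<Sum>b\<in>B. scale (representation B v b) b) = v" if "v \<in> span B" for v
    using sum_representation_eq[OF B(2) that B(1)] by simp
  have repC: "(\<Sum>b\<in>C. scale (representation C v b) b) = v" if "v \<in> span B" for v
    using sum_representation_eq[OF C(2) _ C(1)] that BC by simp
  have 1: "representation B v b = (\<Sum>c\<in>C. representation C v c * representation B c b)"
    if v: "v \<in> span B" for v b
  proof -
    have "representation B v b = representation B (\<Sum>c\<in>C. scale (representation C v c) c) b"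
      using repC[OF v] by simp
    also have "\<dots> = (\<Sum>c\<in>C. representation B (scale (representation C v c) c) b)"
      using BC by (subst representation_sum[OF B(2)]) (auto intro: span_scale span_base)
    also have "\<dots> = (\<Sum>c\<in>C. representation C v c * representation B c b)"
      using BC by (intro sum.cong refl, subst representation_scale[OF B(2)]) (auto intro: span_base)
    finally show ?thesis .
  qed
  have 2: "(\<Sum>b\<in>B. representation B v b * representation C (f b) c) = representation C (f v) c"
    if v: "v \<in> span B" for v c
  proof -
    have "representation C (f v) c = representation C (\<Sum>b\<in>B. scale (representation B v b) (f b)) c"
      by (subst repB[OF v, symmetric]) (simp add: f.sum f.scale)
    also have "\<dots> = (\<Sum>b\<in>B. representation C (scale (representation B v b) (f b)) c)"
      using BC fB by (subst representation_sum[OF C(2)]) (auto intro!: span_scale intro: span_base)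
    also have "\<dots> = (\<Sum>b\<in>B. representation B v b * representation C (f b) c)"
      using BC fB by (intro sum.cong refl, subst representation_scale[OF C(2)]) (auto intro: span_base)
    finally show ?thesis by simp
  qed
  have "trace_on B f = (\<Sum>b\<in>B. \<Sum>c\<in>C. representation C (f b) c * representation B c b)"
    unfolding trace_on_def using 1 fB span_base by (intro sum.cong) auto
  also have "\<dots> = (\<Sum>c\<in>C. \<Sum>b\<in>B. representation B c b * representation C (f b) c)"
    by (subst sum.swap) (simp add: mult.commute)
  also have "\<dots> = trace_on C f"
    unfolding trace_on_def using 2 BC span_base by (intro sum.cong) auto
  finally show ?thesis .
qed

lemma trace_on_commute:
  assumes B: "finite B" "independent B"
    and f: "endo f" "f ` span B \<subseteq> span B" and g: "endo g" "g ` span B \<subseteq> span B"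
  shows "trace_on B (\<lambda>x. f (g x)) = trace_on B (\<lambda>x. g (f x))"
proof -
  have *: "trace_on B (\<lambda>x. f (g x)) = (\<Sum>b\<in>B. \<Sum>c\<in>B. representation B (g b) c * representation B (f c) b)"
    if f: "endo f" "f ` span B \<subseteq> span B" and g: "endo g" "g ` span B \<subseteq> span B" for f g
  proof -
    interpret f: module_hom scale scale f by (rule f)
    have "representation B (f (g b)) b = (\<Sum>c\<in>B. representation B (g b) c * representation B (f c) b)"
      if b: "b \<in> B" for b
    proof -
      have gb: "g b \<in> span B" using b g(2) span_base by auto
      have "representation B (f (g b)) b
          = representation B (\<Sum>c\<in>B. scale (representation B (g b) c) (f c)) b"
        by (subst sum_representation_eq[OF B(2) gb B(1) order_refl, symmetric]) (simp add: f.sum f.scale)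
      also have "\<dots> = (\<Sum>c\<in>B. representation B (scale (representation B (g b) c) (f c)) b)"
        using f(2) span_base by (subst representation_sum[OF B(2)]) (auto intro!: span_scale)
      also have "\<dots> = (\<Sum>c\<in>B. representation B (g b) c * representation B (f c) b)"
        using f(2) span_base by (intro sum.cong refl, subst representation_scale[OF B(2)]) auto
      finally show ?thesis .
    qed
    then show ?thesis unfolding trace_on_def by simp
  qed
  show ?thesis
    unfolding *[OF f g] *[OF g f] by (subst sum.swap) (simp add: mult.commute)
qed

lemma trace_on_add:
  assumes B: "independent B" "\<And>b. b \<in> B \<Longrightarrow> f b \<in> span B" "\<And>b. b \<in> B \<Longrightarrow> g b \<in> span B"
  shows "trace_on B (\<lambda>x. f x + g x) = trace_on B f + trace_on B g"
  unfolding trace_on_def by (simp add: representation_add B sum.distrib)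

lemma trace_on_diff:
  assumes B: "independent B" "\<And>b. b \<in> B \<Longrightarrow> f b \<in> span B" "\<And>b. b \<in> B \<Longrightarrow> g b \<in> span B"
  shows "trace_on B (\<lambda>x. f x - g x) = trace_on B f - trace_on B g"
  unfolding trace_on_def by (simp add: representation_diff B sum_subtractf)

lemma trace_on_scale:
  assumes B: "independent B" "\<And>b. b \<in> B \<Longrightarrow> f b \<in> span B"
  shows "trace_on B (\<lambda>x. scale c (f x)) = c * trace_on B f"
  unfolding trace_on_def by (simp add: representation_scale B sum_distrib_left)

lemma trace_on_sum:
  assumes B: "independent B" "\<And>i b. i \<in> I \<Longrightarrow> b \<in> B \<Longrightarrow> f i b \<in> span B"
  shows "trace_on B (\<lambda>x. \<Sum>i\<in>I. f i x) = (\<Sum>i\<in>I. trace_on B (f i))"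
  unfolding trace_on_def by (subst sum.swap) (simp add: representation_sum B)

lemma trace_on_scalar:
  assumes B: "independent B" "\<And>b. b \<in> B \<Longrightarrow> f b = scale c b"
  shows "trace_on B f = c * of_nat (card B)"
  unfolding trace_on_def by (simp add: B representation_scale span_base representation_basis)

text \<open>Triangularization without Jordan forms: for an eigenvalue \<mu> the image of A - \<mu>
  lies in an invariant hyperplane \<open>Q'\<close>, and \<open>A\<close> acts on the
  one-dimensional quotient by \<mu>. So the trace is \<mu>^2 plus the trace on \<open>Q'\<close>. A
  vanishing sum of integer squares makes every \<mu> of the flag zero, hence \<open>A\<close>
  nilpotent.\<close>

lemma trace_square_integral_spectrum:
  assumes A: "endo A" and Q: "fin_dim scale Q" "subspace Q" "A ` Q \<subseteq> Q"
    and ev: "\<And>v \<mu>. v \<in> Q \<Longrightarrow> v \<noteq> 0 \<Longrightarrow> A v = scale \<mu> v \<Longrightarrow> \<mu> \<in> \<int>"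
  shows "\<exists>S::nat. (\<forall>B. finite B \<longrightarrow> independent B \<longrightarrow> span B = Q \<longrightarrow> trace_on B (\<lambda>x. A (A x)) = of_nat S) \<and>
           (S = 0 \<longrightarrow> (\<forall>x\<in>Q. \<exists>n. (A ^^ n) x = 0))"
  using Q ev
proof (induction "dim Q" arbitrary: Q rule: less_induct)
  case less
  interpret A: module_hom scale scale A by (rule A)
  show ?case
  proof (cases "Q = {0}")
    case True
    have "trace_on B (\<lambda>x. A (A x)) = 0" if "finite B" "independent B" "span B = Q" for B
    proof -
      have "B = {}" using that True span_superset[of B] dependent_zero[of B] by auto
      then show ?thesis by (simp add: trace_on_def)
    qed
    moreover have "\<forall>x\<in>Q. \<exists>n. (A ^^ n) x = 0" using True by (auto intro: exI[of _ 0])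
    ultimately show ?thesis by (intro exI[of _ 0]) auto
  next
    case False
    obtain \<mu> u where u: "u \<in> Q" "u \<noteq> 0" "A u = scale \<mu> u"
      using eigenvector_exists[OF A less.prems(1-3) False] by metis
    define R where "R = (\<lambda>x. A x - scale \<mu> x) ` Q"
    have endo': "endo (\<lambda>x. A x - scale \<mu> x)" by (rule endo_shift[OF A])
    have R: "subspace R" unfolding R_def by (rule module_hom.subspace_image[OF endo' less.prems(2)])
    have RQ: "R \<subseteq> Q" unfolding R_def using less.prems by (auto intro!: subspace_diff subspace_scale)
    \<comment> \<open>An operator with nonzero kernel vector \<open>u\<close> is not onto: otherwise
      it would carry the basis \<open>C\<close> to a basis, and so be injective.\<close>
    have "R \<noteq> Q"
    proof
      assume "R = Q"
      obtain C where C: "finite C" "independent C" "span C = Q" using fin_dim_basis less.prems by metis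
      have "\<not> inj_on (\<lambda>x. A x - scale \<mu> x) (span C)"
      proof
        assume "inj_on (\<lambda>x. A x - scale \<mu> x) (span C)"
        then have "u = 0" by (rule inj_onD) (use u C(3) span_zero in auto)
        then show False using u by simp
      qed
      then have dep: "dependent ((\<lambda>x. A x - scale \<mu> x) ` C) \<or> \<not> inj_on (\<lambda>x. A x - scale \<mu> x) C"
        using module_hom.inj_on_span_iff_independent_image[OF endo', of C] by auto
      have sp: "span ((\<lambda>x. A x - scale \<mu> x) ` C) = Q"
        using module_hom.span_image[OF endo', of C] C(3) \<open>R = Q\<close> R_def by simp
      have "dim Q = card C" using C dim_span_eq_card_independent by metis
      have le: "card ((\<lambda>x. A x - scale \<mu> x) ` C) \<le> card C" using C card_image_le by blast
      have "card C \<le> card ((\<lambda>x. A x - scale \<mu> x) ` C)"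
        using dim_le_card[of Q "(\<lambda>x. A x - scale \<mu> x) ` C"] sp C \<open>dim Q = card C\<close> by simp
      with le have e: "card ((\<lambda>x. A x - scale \<mu> x) ` C) = card C" by simp
      then have "inj_on (\<lambda>x. A x - scale \<mu> x) C" using C eq_card_imp_inj_on by blast
      moreover have "independent ((\<lambda>x. A x - scale \<mu> x) ` C)"
      proof (rule ccontr)
        assume "\<not> independent ((\<lambda>x. A x - scale \<mu> x) ` C)"
        then obtain a where a: "a \<in> (\<lambda>x. A x - scale \<mu> x) ` C"
          "a \<in> span ((\<lambda>x. A x - scale \<mu> x) ` C - {a})" unfolding dependent_def by auto
        then have "span ((\<lambda>x. A x - scale \<mu> x) ` C - {a}) = Q"
          using sp span_redundant[OF a(2)] by (simp add: insert_absorb)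
        then have "card C \<le> card ((\<lambda>x. A x - scale \<mu> x) ` C - {a})"
          using dim_le_card[of Q "(\<lambda>x. A x - scale \<mu> x) ` C - {a}"] C \<open>dim Q = card C\<close> by simp
        then show False using e a(1) C(1) card_Diff1_less[of "(\<lambda>x. A x - scale \<mu> x) ` C" a] by simp
      qed
      ultimately show False using dep by blast
    qed
    obtain CR where CR: "CR \<subseteq> R" "independent CR" "R \<subseteq> span CR"
      using maximal_independent_subset by blast
    have CR': "span CR = R" using CR R span_minimal by blast
    obtain C where C: "CR \<subseteq> C" "C \<subseteq> Q" "independent C" "Q \<subseteq> span C"
      using maximal_independent_subset_extend[of CR Q] CR RQ by blast
    have CQ: "span C = Q" using C less.prems(2) span_minimal by blast
    have finC: "finite C" using C less.prems(1) independent_span_bound unfolding fin_dim_def by (meson order_trans)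
    have "C \<noteq> CR" using CR' CQ \<open>R \<noteq> Q\<close> by auto
    then obtain v where v: "v \<in> C" "v \<notin> CR" using C(1) by blast
    \<comment> \<open>\<open>C\<close> extends a basis of \<open>R\<close>, and \<open>v\<close> is
      one of the added vectors; deleting it leaves a basis of a hyperplane that still contains
      \<open>R\<close>.\<close>
    define C' where "C' = C - {v}"
    define Q' where "Q' = span C'"
    have indC': "independent C'" using C independent_mono unfolding C'_def by blast
    have CC: "C = insert v C'" "v \<notin> C'" "finite C'" using v finC unfolding C'_def by auto
    have vQ': "v \<notin> Q'" using C(3) v(1) unfolding Q'_def C'_def dependent_def by blast
    have RQ': "R \<subseteq> Q'" unfolding Q'_def CR'[symmetric] by (rule span_mono) (use C v C'_def in auto)
    have Q'Q: "Q' \<subseteq> Q" unfolding Q'_def CQ[symmetric] by (rule span_mono) (auto simp: C'_def)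
    have subQ': "subspace Q'" unfolding Q'_def by simp
    have vQ: "v \<in> Q" using v C by auto
    have shift: "A x - scale \<mu> x \<in> Q'" if "x \<in> Q" for x using that RQ' unfolding R_def by auto
    have stab: "A ` Q' \<subseteq> Q'"
    proof
      fix y assume "y \<in> A ` Q'"
      then obtain x where x: "x \<in> Q'" "y = A x" by auto
      have "(A x - scale \<mu> x) + scale \<mu> x \<in> Q'"
        by (rule subspace_add[OF subQ']) (use x Q'Q shift subQ' subspace_scale in auto)
      then show "y \<in> Q'" using x by simp
    qed
    have "Q' \<subset> Q" using Q'Q vQ vQ' by blast
    then have "dim Q' < dim Q" by (rule dim_strict_mono[OF less.prems(1,2) subQ'])
    moreover have "fin_dim scale Q'" using less.prems(1) Q'Q fin_dim_subset by blast
    ultimately obtain S' :: nat where S': "\<forall>B. finite B \<longrightarrow> independent B \<longrightarrow> span B = Q' \<longrightarrow> trace_on B (\<lambda>x. A (A x)) = of_nat S'"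
      "S' = 0 \<longrightarrow> (\<forall>x\<in>Q'. \<exists>n. (A ^^ n) x = 0)"
      using less.hyps[of Q'] subQ' stab less.prems(4) Q'Q by blast
    obtain m :: int where m: "\<mu> = of_int m" using less.prems(4)[OF u] by (auto elim: Ints_cases)
    define S where "S = nat (m^2) + S'"
    have endo2: "endo (\<lambda>x. A (A x))" by (intro endoI) (auto simp: A.add A.scale)
    have A2v: "A (A v) - scale (\<mu>^2) v \<in> Q'"
    proof -
      have "A (A v - scale \<mu> v) + scale \<mu> (A v - scale \<mu> v) \<in> Q'"
        using shift[OF vQ] stab subQ' by (auto intro!: subspace_add subspace_scale)
      then show ?thesis by (simp add: A.diff A.scale algebra_simps power2_eq_square)
    qed
    have tr: "trace_on C (\<lambda>x. A (A x)) = of_nat S"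
    proof -
      have rep': "representation C x b = representation C' x b" if "x \<in> Q'" for x b
        using representation_extend[OF C(3), of x C'] that unfolding Q'_def C'_def by auto
      have zero: "representation C x v = 0" if "x \<in> Q'" for x
        using rep'[OF that] representation_ne_zero[of C' x v] CC by auto
      have "representation C (A (A v)) v = representation C ((A (A v) - scale (\<mu>^2) v) + scale (\<mu>^2) v) v"
        by simp
      also have "\<dots> = representation C (A (A v) - scale (\<mu>^2) v) v + representation C (scale (\<mu>^2) v) v"
        using A2v Q'Q CQ v span_base by (subst representation_add[OF C(3)]) (auto intro: span_scale)
      also have "\<dots> = \<mu>^2"
        using zero[OF A2v] v span_base by (simp add: representation_scale C(3) representation_basis)
      finally have 1: "representation C (A (A v)) v = \<mu>^2" .
      have "trace_on C (\<lambda>x. A (A x)) = \<mu>^2 + (\<Sum>b\<in>C'. representation C (A (A b)) b)"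
        unfolding trace_on_def using v finC 1 C'_def by (subst sum.remove[of C v]) auto
      also have "(\<Sum>b\<in>C'. representation C (A (A b)) b) = trace_on C' (\<lambda>x. A (A x))"
        unfolding trace_on_def
      proof (intro sum.cong refl rep')
        fix b assume "b \<in> C'"
        then have "b \<in> Q'" unfolding Q'_def by (rule span_base)
        then show "A (A b) \<in> Q'" using stab by blast
      qed
      also have "\<dots> = of_nat S'" using S'(1) CC indC' Q'_def by simp
      finally show ?thesis unfolding S_def m by simp
    qed
    have "trace_on B (\<lambda>x. A (A x)) = of_nat S" if "finite B" "independent B" "span B = Q" for B
    proof -
      have "trace_on B (\<lambda>x. A (A x)) = trace_on C (\<lambda>x. A (A x))"
      proof (rule trace_on_basis_change)
        show "(\<lambda>x. A (A x)) ` span B \<subseteq> span B" using that(3) less.prems(3) by blast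
      qed (use that finC C CQ endo2 in auto)
      then show ?thesis using tr by simp
    qed
    moreover have "\<exists>n. (A ^^ n) x = 0" if "S = 0" "x \<in> Q" for x
    proof -
      have "m = 0" "S' = 0" using that(1) unfolding S_def by auto
      then have "A x \<in> Q'" using shift[OF that(2)] m by simp
      then obtain n where "(A ^^ n) (A x) = 0" using S'(2) \<open>S' = 0\<close> by blast
      then have "(A ^^ Suc n) x = 0" by (simp add: funpow_swap1)
      then show ?thesis by blast
    qed
    ultimately show ?thesis by blast
  qed
qed

section \<open>Fitting decompositions for one operator and for families\<close>

lemma fitting_single:
  assumes A: "endo A" and Q: "fin_dim scale Q" "subspace Q" "A ` Q \<subseteq> Q"
  shows "\<exists>R. subspace R \<and> R \<subseteq> Q \<and> A ` R = R \<and> (\<forall>x\<in>Q. \<exists>r\<in>R. \<exists>n. (A ^^ n) (x - r) = 0)"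
  using Q
proof (induction "dim Q" arbitrary: Q rule: less_induct)
  case less
  interpret A: module_hom scale scale A by (rule A)
  show ?case
  proof (cases "A ` Q = Q")
    case True
    have "\<exists>r\<in>Q. \<exists>n. (A ^^ n) (x - r) = 0" if "x \<in> Q" for x
      using that by (intro bexI[of _ x] exI[of _ 0]) auto
    with True less.prems show ?thesis by (intro exI[of _ Q]) auto
  next
    case False
    then have "A ` Q \<subset> Q" using less.prems by auto
    moreover have sub: "subspace (A ` Q)" using A.subspace_image less.prems by blast
    ultimately have "dim (A ` Q) < dim Q" using dim_strict_mono less.prems by blast
    moreover have "fin_dim scale (A ` Q)" using fin_dim_subset less.prems by blast
    moreover have "A ` A ` Q \<subseteq> A ` Q" using less.prems(3) by (rule image_mono)
    ultimately obtain R where R: "subspace R" "R \<subseteq> A ` Q" "A ` R = R"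
      "\<forall>x\<in>A ` Q. \<exists>r\<in>R. \<exists>n. (A ^^ n) (x - r) = 0"
      using less.hyps[of "A ` Q"] sub by auto
    have "\<exists>r\<in>R. \<exists>n. (A ^^ n) (x - r) = 0" if xQ: "x \<in> Q" for x
    proof -
      obtain r n where r: "r \<in> R" "(A ^^ n) (A x - r) = 0" using bspec[OF R(4) imageI[OF xQ]] by auto
      \<comment> \<open>\<open>A\<close> is onto on \<open>R\<close>, so the component found for
        \<open>A x\<close> in the image can be pulled back to one for \<open>x\<close>, at the cost
        of one more power of \<open>A\<close>.\<close>
      then obtain r' where r': "r' \<in> R" "r = A r'" using R(3) by (metis imageE)
      have "(A ^^ Suc n) (x - r') = 0" using r r' by (simp add: funpow_Suc_right A.diff del: funpow.simps)
      then show ?thesis using r' by blast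
    qed
    moreover have "R \<subseteq> Q" using R(2) less.prems(3) by (rule subset_trans)
    ultimately show ?thesis using R(1,3) by blast
  qed
qed

definition null_space :: "('a \<Rightarrow> 'a) \<Rightarrow> 'a set" where
  "null_space A = {x. \<exists>n. (A ^^ n) x = 0}"

text \<open>In finite dimension this is the Fitting one-component. Any set \<open>R\<close> mapped
  onto itself will do: its elements have preimages under all powers of \<open>A\<close>, and such
  sets are easily transported along intertwining maps.\<close>

definition divisible :: "('a \<Rightarrow> 'a) \<Rightarrow> 'a set" where
  "divisible A = {x. \<exists>R. x \<in> R \<and> A ` R = R}"

lemma null_spaceI: "(A ^^ n) x = 0 \<Longrightarrow> x \<in> null_space A"
  unfolding null_space_def by blast

lemma funpow_zero_mono:
  assumes "endo A" "(A ^^ n) x = 0" "n \<le> m" shows "(A ^^ m) x = 0"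
proof -
  interpret An: module_hom scale scale "A ^^ (m - n)" by (rule endo_funpow[OF assms(1)])
  have "(A ^^ m) x = (A ^^ (m - n)) ((A ^^ n) x)"
    using assms(3) by (metis comp_apply funpow_add le_add_diff_inverse2)
  then show ?thesis using assms by simp
qed

lemma subspace_null_space: "endo A \<Longrightarrow> subspace (null_space A)"
proof (intro subspaceI)
  assume A: "endo A"
  show "0 \<in> null_space A" by (rule null_spaceI[where n = 0]) simp
  fix x y assume "x \<in> null_space A" "y \<in> null_space A"
  then obtain n m where "(A ^^ n) x = 0" "(A ^^ m) y = 0" unfolding null_space_def by auto
  then have *: "(A ^^ max n m) x = 0" "(A ^^ max n m) y = 0"
    using funpow_zero_mono[OF A] by auto
  interpret An: module_hom scale scale "A ^^ max n m" by (rule endo_funpow[OF A])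
  from * have "(A ^^ max n m) (x + y) = 0" by (simp add: An.add)
  then show "x + y \<in> null_space A" by (rule null_spaceI)
next
  fix c x assume A: "endo A" and "x \<in> null_space A"
  then obtain n where *: "(A ^^ n) x = 0" unfolding null_space_def by auto
  interpret An: module_hom scale scale "A ^^ n" by (rule endo_funpow[OF A])
  from * have "(A ^^ n) (scale c x) = 0" by (simp add: An.scale)
  then show "scale c x \<in> null_space A" by (rule null_spaceI)
qed

text \<open>From A B x = B A x + [A, B] x, by induction on the length of the iterated commutator
  and, inside it, on the power of \<open>A\<close> that kills \<open>x\<close>.\<close>

lemma null_space_stable:
  assumes A: "endo A" and "endo B" "((\<lambda>X v. A (X v) - X (A v)) ^^ n) B = (\<lambda>_. 0)"
    and "x \<in> null_space A"
  shows "B x \<in> null_space A"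
  using assms(2-)
proof (induction n arbitrary: B x)
  case 0
  then show ?case using subspace_null_space[OF A] subspace_0 by simp
next
  case (Suc n)
  interpret A: module_hom scale scale A by (rule A)
  interpret B: module_hom scale scale B by (rule Suc.prems)
  define B' where "B' = (\<lambda>v. A (B v) - B (A v))"
  have B': "endo B'" unfolding B'_def
    by (intro endoI) (auto simp: A.add B.add A.scale B.scale algebra_simps)
  have B'n: "((\<lambda>X v. A (X v) - X (A v)) ^^ n) B' = (\<lambda>_. 0)"
    using Suc.prems(2) unfolding B'_def by (simp add: funpow_Suc_right del: funpow.simps)
  note IH = Suc.IH
  obtain k where "(A ^^ k) x = 0" using Suc.prems unfolding null_space_def by auto
  then show ?case
  proof (induction k arbitrary: x)
    case 0
    then show ?case using subspace_null_space[OF A] subspace_0 by simp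
  next
    case (Suc k)
    have "B (A x) \<in> null_space A" using Suc by (simp add: funpow_Suc_right del: funpow.simps)
    moreover have "B' x \<in> null_space A" by (rule IH[OF B' B'n null_spaceI[OF Suc.prems]])
    moreover have "A (B x) = B (A x) + B' x" unfolding B'_def by simp
    ultimately have "A (B x) \<in> null_space A"
      using subspace_null_space[OF A] subspace_add by metis
    then obtain n where "(A ^^ n) (A (B x)) = 0" unfolding null_space_def by auto
    then have "(A ^^ Suc n) (B x) = 0" by (simp add: funpow_Suc_right del: funpow.simps)
    then show ?case by (rule null_spaceI)
  qed
qed

text \<open>Split along a member \<open>A\<close> that is not nilpotent on \<open>Q\<close> and
  continue in the smaller space \<open>Q \<inter> null_space A\<close>. The other members preserve
  it by \<open>null_space_stable\<close>, which is what the nilpotency of commutators is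
  for.\<close>

lemma fitting_family:
  assumes S: "\<And>A. A \<in> S \<Longrightarrow> endo A"
      "\<And>A B. A \<in> S \<Longrightarrow> B \<in> S \<Longrightarrow> \<exists>n. ((\<lambda>X v. A (X v) - X (A v)) ^^ n) B = (\<lambda>_. 0)"
    and Q: "fin_dim scale Q" "subspace Q" "\<And>A. A \<in> S \<Longrightarrow> A ` Q \<subseteq> Q" and x: "x \<in> Q"
  shows "\<exists>y z. x = y + z \<and> y \<in> (\<Inter>A\<in>S. null_space A) \<and> z \<in> span (\<Union>A\<in>S. divisible A)"
  using Q x
proof (induction "dim Q" arbitrary: Q x rule: less_induct)
  case less
  show ?case
  proof (cases "\<forall>A\<in>S. Q \<subseteq> null_space A")
    case True
    then show ?thesis using less.prems span_zero by (intro exI[of _ x] exI[of _ 0]) auto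
  next
    case False
    then obtain A where A: "A \<in> S" "\<not> Q \<subseteq> null_space A" by auto
    define Q' where "Q' = Q \<inter> null_space A"
    have Q': "subspace Q'" unfolding Q'_def using subspace_null_space S A less.prems
      by (intro subspace_inter) auto
    have "Q' \<subset> Q" using A(2) unfolding Q'_def by auto
    then have "dim Q' < dim Q" using dim_strict_mono less.prems Q' by blast
    moreover have "fin_dim scale Q'" using fin_dim_subset less.prems unfolding Q'_def by blast
    moreover have "B ` Q' \<subseteq> Q'" if B: "B \<in> S" for B
    proof
      fix w assume "w \<in> B ` Q'"
      then obtain u where u: "u \<in> Q" "u \<in> null_space A" "w = B u" unfolding Q'_def by auto
      obtain n where "((\<lambda>X v. A (X v) - X (A v)) ^^ n) B = (\<lambda>_. 0)" using S(2) A B by blast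
      then have "B u \<in> null_space A" using null_space_stable S A B u by blast
      then show "w \<in> Q'" using u less.prems(3)[OF B] unfolding Q'_def by blast
    qed
    ultimately have IH: "\<exists>y z. v = y + z \<and> y \<in> (\<Inter>A\<in>S. null_space A) \<and> z \<in> span (\<Union>A\<in>S. divisible A)"
      if "v \<in> Q'" for v using less.hyps[of Q' v] Q' that by blast
    obtain R where R: "R \<subseteq> Q" "A ` R = R" "\<forall>x\<in>Q. \<exists>r\<in>R. \<exists>n. (A ^^ n) (x - r) = 0"
      using fitting_single[OF S(1)[OF A(1)] less.prems(1,2) less.prems(3)[OF A(1)]] by auto
    obtain r where r: "r \<in> R" "x - r \<in> null_space A" using R(3) less.prems(4) null_spaceI by metis
    have "x - r \<in> Q'" unfolding Q'_def using r R(1) less.prems subspace_diff by auto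
    then obtain y z where yz: "x - r = y + z" "y \<in> (\<Inter>A\<in>S. null_space A)" "z \<in> span (\<Union>A\<in>S. divisible A)"
      using IH by blast
    have "r \<in> span (\<Union>A\<in>S. divisible A)"
      by (rule span_base) (use r R(2) A(1) in \<open>auto simp: divisible_def\<close>)
    then have "z + r \<in> span (\<Union>A\<in>S. divisible A)" using yz span_add by blast
    moreover have "x = y + (z + r)" using yz(1) by (simp add: algebra_simps)
    ultimately show ?thesis using yz by blast
  qed
qed

section \<open>Integrality of eigenvalues from part of the sl2 relations\<close>

primrec shift_prod :: "('a \<Rightarrow> 'a) \<Rightarrow> (nat \<Rightarrow> complex) \<Rightarrow> nat \<Rightarrow> 'a \<Rightarrow> 'a" where
  "shift_prod T \<mu> 0 x = x"
| "shift_prod T \<mu> (Suc n) x = shift_prod T \<mu> n (T x - scale (\<mu> n) x)"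

lemma endo_shift_prod: "endo T \<Longrightarrow> endo (shift_prod T \<mu> n)"
proof (induction n)
  case 0
  then show ?case by (intro endoI) auto
next
  case (Suc n)
  interpret T: module_hom scale scale T by (rule Suc.prems)
  interpret P: module_hom scale scale "shift_prod T \<mu> n" by (rule Suc.IH[OF Suc.prems])
  show ?case by (intro endoI) (auto simp: T.add T.scale P.add P.scale P.diff algebra_simps)
qed

lemma shift_prod_eigenvector:
  assumes "endo T" "T x = scale \<nu> x"
  shows "shift_prod T \<mu> n x = scale (\<Prod>i<n. \<nu> - \<mu> i) x"
proof (induction n)
  case (Suc n)
  interpret P: module_hom scale scale "shift_prod T \<mu> n" by (rule endo_shift_prod) (rule assms)
  have "T x - scale (\<mu> n) x = scale (\<nu> - \<mu> n) x" using assms by (simp add: scale_left_diff_distrib)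
  then show ?case using Suc by (simp add: P.scale mult.commute)
qed simp

text \<open>The product of T - \<mu> i over i < n kills the earlier eigenvectors and, since \<mu> is
  injective, only rescales the n-th one by a nonzero factor.\<close>

lemma finitely_many_eigenvalues:
  fixes \<mu> :: "nat \<Rightarrow> complex"
  assumes "fin_dim scale Q" "endo T" "\<And>n. y n \<in> Q" "\<And>n. y n \<noteq> 0"
    "\<And>n. T (y n) = scale (\<mu> n) (y n)" "inj \<mu>"
  shows False
proof (rule no_infinite_separated_sequence[OF assms(1,3)])
  show "endo (shift_prod T \<mu> n)" for n by (rule endo_shift_prod) (rule assms)
  show "shift_prod T \<mu> n (y i) = 0" if "i < n" for n i
  proof -
    have "(\<Prod>k<n. \<mu> i - \<mu> k) = 0" using that by (intro prod_zero) auto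
    then show ?thesis using shift_prod_eigenvector assms by simp
  qed
  show "shift_prod T \<mu> n (y n) \<noteq> 0" for n
    using shift_prod_eigenvector[OF assms(2) assms(5)] assms(4,6) by (auto simp: inj_eq)
qed

context
  fixes T E F Q
  assumes T: "endo T" and E: "endo E" and F: "endo F"
    and TE: "\<And>x. T (E x) = E (T x) + scale 2 (E x)"
    and EF: "\<And>x. E (F x) = F (E x) + T x"
    and Q: "fin_dim scale Q" "subspace Q" "T ` Q \<subseteq> Q" "E ` Q \<subseteq> Q" "F ` Q \<subseteq> Q"
begin

interpretation T: module_hom scale scale T by (rule T)
interpretation E: module_hom scale scale E by (rule E)
interpretation F: module_hom scale scale F by (rule F)

lemma funpow_E_in: "x \<in> Q \<Longrightarrow> (E ^^ n) x \<in> Q"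
  using Q by (induction n) auto

text \<open>The sl2 commutation formula with \<open>T\<close> placed to the left of the power of
  \<open>E\<close>; in this form it follows from [T, E] = 2 E and [E, F] = T alone.\<close>

lemma funpow_E_F:
  "(E ^^ Suc k) (F y) = F ((E ^^ Suc k) y) + scale (of_nat (Suc k)) (T ((E ^^ k) y) - scale (of_nat k) ((E ^^ k) y))"
proof (induction k)
  case 0
  then show ?case using EF by simp
next
  case (Suc k)
  define a where "a = T ((E ^^ Suc k) y)"
  define b where "b = (E ^^ Suc k) y"
  have b: "E ((E ^^ k) y) = b" unfolding b_def by simp
  have "(E ^^ Suc (Suc k)) (F y) = E ((E ^^ Suc k) (F y))" by simp
  also have "\<dots> = E (F b + scale (of_nat (Suc k)) (T ((E ^^ k) y) - scale (of_nat k) ((E ^^ k) y)))"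
    unfolding Suc b_def ..
  also have "\<dots> = E (F b) + scale (of_nat (Suc k)) (E (T ((E ^^ k) y)) - scale (of_nat k) b)"
    by (simp only: E.add E.scale E.diff b)
  also have "E (T ((E ^^ k) y)) = a - scale 2 b"
    using TE[of "(E ^^ k) y"] unfolding b a_def b_def[symmetric] by simp
  also have "E (F b) = F (E b) + a"
    using EF[of b] unfolding a_def b_def[symmetric] .
  also have "F (E b) + a + scale (of_nat (Suc k)) (a - scale 2 b - scale (of_nat k) b)
      = F (E b) + scale (of_nat (Suc (Suc k))) (a - scale (of_nat (Suc k)) b)"
  proof -
    have "a + scale n (a - scale 2 b - scale j b) = scale (1 + n) a - scale (n * (2 + j)) b" for n j
      by (simp add: algebra_simps)
    from this[of "of_nat (Suc k)" "of_nat k"] show ?thesis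
      by (simp add: scale_right_diff_distrib add.commute mult.commute)
  qed
  finally show ?case unfolding a_def b_def by simp
qed

lemma funpow_E_eigenvector:
  "T v = scale \<mu> v \<Longrightarrow> T ((E ^^ k) v) = scale (\<mu> + 2 * of_nat k) ((E ^^ k) v)"
  by (induction k) (auto simp: TE E.scale E.add algebra_simps)

text \<open>Since F is not known to lower T-eigenvalues, the usual descending string is replaced by
  preimages. Raise \<open>v\<close> to a vector \<open>w\<close> with E w = 0 and eigenvalue \<nu> =
  \<mu> + 2 p. Were \<nu> not a natural number, the factors (k + 1)(\<nu> - k) would be invertible
  and \<open>F\<close>, suitably rescaled, would produce preimages of \<open>w\<close> under all
  powers of \<open>E\<close>; these are separated by the powers of \<open>E\<close>, against finite
  dimension.\<close>

lemma sl2_eigenvalue_integral: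
  assumes v: "v \<in> Q" "v \<noteq> 0" "T v = scale \<mu> v"
  shows "\<mu> \<in> \<int>"
proof -
  have "\<exists>m. (E ^^ m) v = 0"
  proof (rule ccontr)
    assume "\<nexists>m. (E ^^ m) v = 0"
    then show False
      using finitely_many_eigenvalues[OF Q(1) T, of "\<lambda>k. (E ^^ k) v" "\<lambda>k. \<mu> + 2 * of_nat k"]
        funpow_E_in v(1) funpow_E_eigenvector[OF v(3)] by (auto simp: inj_def)
  qed
  define m where "m = (LEAST m. (E ^^ m) v = 0)"
  have m: "(E ^^ m) v = 0" unfolding m_def by (rule LeastI_ex) fact
  have "m \<noteq> 0" using m v(2) by (cases m) auto
  then obtain p where p: "m = Suc p" using not0_implies_Suc by blast
  define w where "w = (E ^^ p) v"
  define \<nu> where "\<nu> = \<mu> + 2 * of_nat p"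
  have w: "w \<in> Q" "w \<noteq> 0" "E w = 0" "T w = scale \<nu> w"
    using m p not_less_Least[of p "\<lambda>m. (E ^^ m) v = 0"] funpow_E_in v funpow_E_eigenvector[OF v(3)]
    unfolding w_def \<nu>_def m_def[symmetric] by auto
  have "\<nu> \<in> \<nat>"
  proof (rule ccontr)
    assume nu: "\<nu> \<notin> \<nat>"
    have "\<exists>y\<in>Q. (E ^^ k) y = w" for k
    proof (induction k)
      case 0
      then show ?case using w by auto
    next
      case (Suc k)
      then obtain y where y: "y \<in> Q" "(E ^^ k) y = w" by auto
      \<comment> \<open>The first term of \<open>funpow_E_F\<close> drops out because the power
        \<open>Suc k\<close> of \<open>E\<close> sends \<open>y\<close> to E w = 0.\<close>
      have 1: "(E ^^ Suc k) (F y) = scale (of_nat (Suc k) * (\<nu> - of_nat k)) w"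
        using funpow_E_F[of k y] y w
        by (simp add: scale_left_diff_distrib right_diff_distrib scale_right_diff_distrib del: of_nat_Suc)
      have 2: "of_nat (Suc k) * (\<nu> - of_nat k) \<noteq> 0" using nu by (auto simp del: of_nat_Suc)
      interpret Ek: module_hom scale scale "E ^^ Suc k" by (rule endo_funpow[OF E])
      have "(E ^^ Suc k) (scale (1 / (of_nat (Suc k) * (\<nu> - of_nat k))) (F y)) = w"
        using 2 by (subst Ek.scale, subst 1) (simp del: of_nat_Suc)
      moreover have "scale (1 / (of_nat (Suc k) * (\<nu> - of_nat k))) (F y) \<in> Q"
        using y(1) Q(5) by (intro subspace_scale[OF Q(2)]) auto
      ultimately show ?case by (rule bexI)
    qed
    then obtain y where y: "\<And>k. y k \<in> Q" "\<And>k. (E ^^ k) (y k) = w" by metis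
    show False
    proof (rule no_infinite_separated_sequence[OF Q(1) y(1), of "\<lambda>n. E ^^ n"])
      show "endo (E ^^ n)" for n by (rule endo_funpow[OF E])
      show "(E ^^ n) (y n) \<noteq> 0" for n using y w by simp
      show "(E ^^ n) (y i) = 0" if "i < n" for n i
      proof (rule funpow_zero_mono[OF E, of "Suc i"])
        show "(E ^^ Suc i) (y i) = 0" using y w by simp
      qed (use that in simp)
    qed
  qed
  then have "\<nu> - 2 * of_nat p \<in> \<int>" using Nats_subset_Ints by auto
  then show ?thesis unfolding \<nu>_def by simp
qed

text \<open>For the last clause \<open>T\<close> is nilpotent on \<open>Q\<close>. By induction on
  the power of \<open>T\<close> killing \<open>x\<close> one has E T x = 0, so T E x = 2 E x, and a
  nilpotent operator has no eigenvalue 2.\<close>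

lemma sl2_trace_square:
  "\<exists>S::nat. (\<forall>B. finite B \<longrightarrow> independent B \<longrightarrow> span B = Q \<longrightarrow> trace_on B (\<lambda>x. T (T x)) = of_nat S) \<and>
     (S = 0 \<longrightarrow> (\<forall>x\<in>Q. E x = 0))"
proof -
  obtain S :: nat where
    S: "\<forall>B. finite B \<longrightarrow> independent B \<longrightarrow> span B = Q \<longrightarrow> trace_on B (\<lambda>x. T (T x)) = of_nat S"
      "S = 0 \<longrightarrow> (\<forall>x\<in>Q. \<exists>n. (T ^^ n) x = 0)"
    using trace_square_integral_spectrum[OF T Q(1,2,3)] sl2_eigenvalue_integral by blast
  have "E x = 0" if nil: "\<forall>x\<in>Q. \<exists>n. (T ^^ n) x = 0" and x: "x \<in> Q" for x
  proof -
    obtain n where "(T ^^ n) x = 0" using nil x by blast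
    then show ?thesis using x
    proof (induction n arbitrary: x)
      case (Suc n)
      have "E (T x) = 0" using Suc Q(3) by (auto simp: funpow_Suc_right simp del: funpow.simps)
      then have *: "T (E x) = scale 2 (E x)" using TE by simp
      have "(T ^^ m) (E x) = scale (2 ^ m) (E x)" for m
        by (induction m) (auto simp: T.scale * mult.commute)
      moreover obtain m where "(T ^^ m) (E x) = 0" using nil Q(4) Suc.prems by blast
      ultimately show ?case by simp
    qed simp
  qed
  then show ?thesis using S by blast
qed

end

end

section \<open>Invariant forms and Casimir operators\<close>

sublocale lie_algebra \<subseteq> complex_vector_space scale ..

context lie_algebra
begin

lemma endo_bracket: "endo (bracket x)"
  by (rule endoI) (auto simp: bracket_add_right bracket_scale_right)

lemma endo_bracket_left: "endo (\<lambda>x. bracket x y)"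
  by (rule endoI) (auto simp: bracket_add_left bracket_scale_left)

lemma bracket_zero [simp]: "bracket x 0 = 0" "bracket 0 x = 0"
  using module_hom.zero[OF endo_bracket] module_hom.zero[OF endo_bracket_left] by auto

lemma bracket_anti: "bracket y x = - bracket x y"
proof -
  have "bracket (x + y) (x + y) = (bracket x x + bracket y x) + (bracket x y + bracket y y)"
    by (simp only: bracket_add_left bracket_add_right)
  then have "bracket y x + bracket x y = 0" by (simp only: bracket_self) simp
  then show ?thesis by (simp add: eq_neg_iff_add_eq_0)
qed

lemma bracket_neg: "bracket (- x) y = - bracket x y" "bracket x (- y) = - bracket x y"
  using module_hom.neg[OF endo_bracket] module_hom.neg[OF endo_bracket_left] by auto

lemma bracket_diff: "bracket (x - z) y = bracket x y - bracket z y" "bracket x (y - z) = bracket x y - bracket x z"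
  using module_hom.diff[OF endo_bracket] module_hom.diff[OF endo_bracket_left] by auto

lemma jacobi_derivation: "bracket (bracket x y) z = bracket x (bracket y z) - bracket y (bracket x z)"
proof -
  have "bracket y (bracket z x) = - bracket y (bracket x z)"
    by (subst bracket_anti[of z x]) (simp add: bracket_neg)
  moreover have "bracket z (bracket x y) = - bracket (bracket x y) z" by (rule bracket_anti)
  ultimately show ?thesis using jacobi[of x y z] by (simp add: algebra_simps add_eq_0_iff)
qed

end

locale fd_lie_algebra = lie_algebra +
  assumes fin_dim_UNIV: "fin_dim scale UNIV"
begin

abbreviation "basis \<equiv> some_basis scale"

abbreviation "\<kappa> \<equiv> killing_form scale bracket"

lemma basis: "finite basis" "independent basis" "span basis = UNIV"
proof -
  obtain B where "finite B" "independent B" "span B = UNIV"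
    using fin_dim_basis[OF fin_dim_UNIV subspace_UNIV] by metis
  then have "finite basis \<and> \<not> dependent basis \<and> span basis = UNIV"
    unfolding some_basis_def by (intro someI_ex[of "\<lambda>B. finite B \<and> \<not> dependent B \<and> span B = UNIV"]) auto
  then show "finite basis" "independent basis" "span basis = UNIV" by auto
qed

lemma killing_form_trace: "\<kappa> x y = trace_on basis (\<lambda>z. bracket x (bracket y z))"
  unfolding killing_form_def endo_trace_def trace_on_def ..

lemma killing_add_left: "\<kappa> (x + x') y = \<kappa> x y + \<kappa> x' y"
  unfolding killing_form_trace bracket_add_left
  by (rule trace_on_add) (auto simp: basis)

lemma killing_scale_left: "\<kappa> (scale c x) y = c * \<kappa> x y"
  unfolding killing_form_trace bracket_scale_left
  by (rule trace_on_scale) (auto simp: basis)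

lemma killing_sym: "\<kappa> x y = \<kappa> y x"
  unfolding killing_form_trace
  by (rule trace_on_commute) (auto simp: basis endo_bracket)

lemma killing_invariant: "\<kappa> (bracket x y) z = \<kappa> x (bracket y z)"
proof -
  have endo2: "endo (\<lambda>v. bracket x (bracket z v))"
    by (intro endoI) (auto simp: bracket_add_right bracket_scale_right)
  have "\<kappa> (bracket x y) z = trace_on basis (\<lambda>v. bracket x (bracket y (bracket z v)))
      - trace_on basis (\<lambda>v. bracket y (bracket x (bracket z v)))"
    unfolding killing_form_trace jacobi_derivation
    by (rule trace_on_diff) (auto simp: basis)
  also have "trace_on basis (\<lambda>v. bracket y (bracket x (bracket z v)))
      = trace_on basis (\<lambda>v. bracket x (bracket z (bracket y v)))"
    using trace_on_commute[OF basis(1,2) endo_bracket[of y] _ endo2] by (simp add: basis)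
  also have "trace_on basis (\<lambda>v. bracket x (bracket y (bracket z v)))
      - trace_on basis (\<lambda>v. bracket x (bracket z (bracket y v))) = \<kappa> x (bracket y z)"
    unfolding killing_form_trace jacobi_derivation bracket_diff
    by (rule trace_on_diff[symmetric]) (auto simp: basis)
  finally show ?thesis .
qed

end

section \<open>Dual bases, the canonical tensor and uniqueness of invariant forms\<close>

locale quadratic_lie_algebra = fd_lie_algebra +
  fixes ip :: "'a \<Rightarrow> 'a \<Rightarrow> complex"
  assumes ip_add_left: "ip (x + y) z = ip x z + ip y z"
    and ip_scale_left: "ip (scale c x) z = c * ip x z"
    and ip_sym: "ip x y = ip y x"
    and ip_invariant: "ip (bracket x y) z = ip x (bracket y z)"
    and ip_nondegenerate: "(\<And>y. ip x y = 0) \<Longrightarrow> x = 0"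
begin

lemma ip_add_right: "ip x (y + z) = ip x y + ip x z"
  using ip_add_left ip_sym by metis

lemma ip_scale_right: "ip x (scale c z) = c * ip x z"
  using ip_scale_left ip_sym by metis

lemma ip_zero [simp]: "ip 0 x = 0" "ip x 0 = 0"
  using ip_scale_left[of 0 0 x] ip_scale_right[of x 0 0] by auto

lemma ip_neg: "ip (- x) y = - ip x y" "ip x (- y) = - ip x y"
  using ip_scale_left[of "-1" x y] ip_scale_right[of x "-1" y] by auto

lemma ip_diff: "ip (x - z) y = ip x y - ip z y" "ip y (x - z) = ip y x - ip y z"
  using ip_add_left[of x "- z" y] ip_add_right[of y x "- z"] by (auto simp: ip_neg)

lemma ip_sum: "ip (sum f A) y = (\<Sum>a\<in>A. ip (f a) y)" "ip y (sum f A) = (\<Sum>a\<in>A. ip y (f a))"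
  by (induction A rule: infinite_finite_induct; simp add: ip_add_left ip_add_right)+

lemma ip_eqI: "(\<And>y. ip x y = ip x' y) \<Longrightarrow> x = x'"
  using ip_nondegenerate[of "x - x'"] by (simp add: ip_diff)

lemma ip_eq_on_basis:
  assumes "\<And>b. b \<in> basis \<Longrightarrow> ip b x = ip b y" shows "x = y"
proof (rule ip_eqI)
  fix z
  have "z \<in> span basis" using basis by simp
  then have "ip z x = ip z y"
    by (induction rule: span_induct_alt) (auto simp: ip_add_left ip_scale_left assms)
  then show "ip x z = ip y z" by (simp add: ip_sym)
qed

text \<open>The pairings with the basis vectors are collected into an endomorphism \<Psi>, so that
  nondegeneracy, which is injectivity of \<Psi>, yields surjectivity. This makes the
  \<open>THE\<close> in \<open>dual_vector\<close> meaningful.\<close>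

lemma dual_exists:
  assumes "b \<in> basis" shows "\<exists>!y. \<forall>b'\<in>basis. ip b' y = (if b' = b then 1 else 0)"
proof -
  define \<Psi> where "\<Psi> y = (\<Sum>b\<in>basis. scale (ip b y) b)" for y
  interpret fdv: finite_dimensional_vector_space scale basis
    by unfold_locales (use basis in auto)
  have lin: "Vector_Spaces.linear scale scale \<Psi>"
    unfolding linear_iff_module_hom \<Psi>_def
    by (rule endoI) (simp_all add: ip_add_right ip_scale_right scale_left_distrib sum.distrib scale_sum_right)
  have rep: "representation basis (\<Psi> y) b = (if b \<in> basis then ip b y else 0)" for y b
  proof (rule fun_cong[OF representation_eqI[OF basis(2)]])
    let ?f = "\<lambda>b. if b \<in> basis then ip b y else 0"
    show "\<Psi> y \<in> span basis" by (simp add: basis)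
    show "finite {b. ?f b \<noteq> 0}" by (rule finite_subset[OF _ basis(1)]) (auto split: if_splits)
    show "(\<Sum>b | ?f b \<noteq> 0. scale (?f b) b) = \<Psi> y"
      unfolding \<Psi>_def by (rule sum.mono_neutral_cong_left) (auto simp: basis split: if_splits)
  qed (auto split: if_splits)
  have "inj \<Psi>"
  proof (rule injI)
    fix x y assume "\<Psi> x = \<Psi> y"
    then have "ip b x = ip b y" if "b \<in> basis" for b using rep[of x b] rep[of y b] that by simp
    then show "x = y" by (rule ip_eq_on_basis)
  qed
  then have "surj \<Psi>" using fdv.linear_inj_imp_surj[OF lin] by simp
  then obtain y where "\<Psi> y = b" by (metis surjD)
  then have "ip b' y = (if b' = b then 1 else 0)" if "b' \<in> basis" for b'
    using rep[of y b'] that representation_basis[OF basis(2) assms] by simp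
  then show ?thesis by (intro ex1I[of _ y]) (auto intro: ip_eq_on_basis)
qed

definition dual :: "'a \<Rightarrow> 'a" where "dual b = dual_vector ip basis b"

lemma ip_dual: "b \<in> basis \<Longrightarrow> b' \<in> basis \<Longrightarrow> ip b' (dual b) = (if b' = b then 1 else 0)"
  using theI'[OF dual_exists] unfolding dual_def dual_vector_def by blast

lemma expand_dual: "(\<Sum>b\<in>basis. scale (ip b x) (dual b)) = x"
proof (rule ip_eq_on_basis)
  fix c assume c: "c \<in> basis"
  have "ip c (\<Sum>b\<in>basis. scale (ip b x) (dual b)) = (\<Sum>b\<in>basis. if b = c then ip b x else 0)"
    unfolding ip_sum by (rule sum.cong) (auto simp: ip_scale_right ip_dual c)
  then show "ip c (\<Sum>b\<in>basis. scale (ip b x) (dual b)) = ip c x" using c basis by simp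
qed

lemma representation_ip: "b \<in> basis \<Longrightarrow> representation basis x b = ip (dual b) x"
proof -
  assume b: "b \<in> basis"
  have "x = (\<Sum>c\<in>basis. scale (representation basis x c) c)"
    using sum_representation_eq[OF basis(2) _ basis(1)] basis by simp
  then have "ip (dual b) x = (\<Sum>c\<in>basis. representation basis x c * ip (dual b) c)"
    by (metis (mono_tags, lifting) ip_scale_right ip_sum(2) sum.cong)
  also have "\<dots> = (\<Sum>c\<in>basis. if c = b then representation basis x c else 0)"
    by (rule sum.cong) (auto simp: ip_sym[of "dual b"] ip_dual b)
  finally show ?thesis using b basis by simp
qed

lemma expand_basis: "(\<Sum>b\<in>basis. scale (ip (dual b) x) b) = x"
proof -
  have "(\<Sum>b\<in>basis. scale (ip (dual b) x) b) = (\<Sum>b\<in>basis. scale (representation basis x b) b)"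
    by (rule sum.cong) (auto simp: representation_ip)
  then show ?thesis using sum_representation_eq[OF basis(2) _ basis(1)] basis by simp
qed

lemma riesz:
  assumes "\<And>x y. L (x + y) = L x + L y" "\<And>c x. L (scale c x) = c * L x"
  shows "\<exists>t. \<forall>y. ip t y = L y"
proof -
  have L0: "L 0 = 0" using assms(2)[of 0 0] by simp
  have Ls: "L (sum f A) = (\<Sum>a\<in>A. L (f a))" for f and A :: "'a set"
    by (induction A rule: infinite_finite_induct) (auto simp: assms L0)
  have "ip (\<Sum>b\<in>basis. scale (L b) (dual b)) y = L y" for y
  proof -
    have "L y = L (\<Sum>b\<in>basis. scale (ip (dual b) y) b)" by (simp add: expand_basis)
    then show ?thesis by (simp add: Ls assms ip_sum ip_scale_left mult.commute)
  qed
  then show ?thesis by blast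
qed

text \<open>Invariance of the sum of \<open>b\<close> tensor \<open>dual b\<close> under the adjoint
  action, tested against an arbitrary bilinear map \<Phi> in place of a tensor product. Expanding
  both brackets gives coefficients that cancel by invariance of \<open>ip\<close>.\<close>

lemma canonical_tensor_invariant:
  assumes \<Phi>: "\<And>x. module_hom scale sW (\<Phi> x)" "\<And>y. module_hom scale sW (\<lambda>x. \<Phi> x y)"
  shows "(\<Sum>b\<in>basis. \<Phi> (bracket a b) (dual b)) + (\<Sum>b\<in>basis. \<Phi> b (bracket a (dual b))) = 0"
proof -
  interpret W: module sW using \<Phi>(1)[of 0] by (simp add: module_hom_def)
  have 1: "\<Phi> (bracket a b) (dual b) = (\<Sum>c\<in>basis. sW (ip (dual c) (bracket a b)) (\<Phi> c (dual b)))" for b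
  proof -
    interpret h: module_hom scale sW "\<lambda>x. \<Phi> x (dual b)" by (rule \<Phi>)
    have "\<Phi> (\<Sum>c\<in>basis. scale (ip (dual c) (bracket a b)) c) (dual b)
       = (\<Sum>c\<in>basis. sW (ip (dual c) (bracket a b)) (\<Phi> c (dual b)))"
      by (simp only: h.sum h.scale)
    then show ?thesis by (simp add: expand_basis)
  qed
  have 2: "\<Phi> b (bracket a (dual b)) = (\<Sum>c\<in>basis. sW (ip c (bracket a (dual b))) (\<Phi> b (dual c)))" for b
  proof -
    interpret h: module_hom scale sW "\<Phi> b" by (rule \<Phi>)
    have "\<Phi> b (\<Sum>c\<in>basis. scale (ip c (bracket a (dual b))) (dual c))
       = (\<Sum>c\<in>basis. sW (ip c (bracket a (dual b))) (\<Phi> b (dual c)))"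
      by (simp only: h.sum h.scale)
    then show ?thesis by (simp add: expand_dual)
  qed
  have 3: "ip (dual c) (bracket a b) = - ip b (bracket a (dual c))" for b c
  proof -
    have "ip (dual c) (bracket a b) = ip (bracket a b) (dual c)" by (rule ip_sym)
    also have "\<dots> = - ip (bracket b a) (dual c)" by (subst bracket_anti) (simp add: ip_neg)
    finally show ?thesis by (simp add: ip_invariant)
  qed
  have "(\<Sum>b\<in>basis. \<Phi> b (bracket a (dual b)))
      = (\<Sum>b\<in>basis. \<Sum>c\<in>basis. sW (ip b (bracket a (dual c))) (\<Phi> c (dual b)))"
    unfolding 2 by (rule sum.swap)
  then show ?thesis
    unfolding 1 3 by (simp add: sum_negf)
qed

text \<open>Pairing with \<open>y\<close> turns the Casimir sum into the trace of ad y ad x, read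
  off in dual coordinates. So the eigenvalue is the ratio of the Killing form to
  \<open>ip\<close>.\<close>

lemma casimir_adjoint:
  assumes "\<And>x y. \<kappa> x y = \<gamma> * ip x y"
  shows "(\<Sum>b\<in>basis. bracket (dual b) (bracket b x)) = scale \<gamma> x"
proof (rule ip_eqI)
  fix y
  have "ip (\<Sum>b\<in>basis. bracket (dual b) (bracket b x)) y = (\<Sum>b\<in>basis. representation basis (bracket y (bracket x b)) b)"
    unfolding ip_sum
  proof (rule sum.cong)
    fix b assume b: "b \<in> basis"
    have "bracket (bracket b x) y = bracket y (bracket x b)"
      by (metis bracket_anti bracket_neg(2) minus_minus)
    then show "ip (bracket (dual b) (bracket b x)) y = representation basis (bracket y (bracket x b)) b"
      using b by (simp add: ip_invariant representation_ip)
  qed simp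
  also have "\<dots> = \<kappa> y x" unfolding killing_form_trace trace_on_def ..
  also have "\<dots> = ip (scale \<gamma> x) y" using ip_sym[of y x] by (simp add: assms ip_scale_left)
  finally show "ip (\<Sum>b\<in>basis. bracket (dual b) (bracket b x)) y = ip (scale \<gamma> x) y" .
qed

text \<open>Schur's lemma: write \<beta> x y as \<open>ip (\<Phi> x) y\<close>. The endomorphism
  \<Phi> has an eigenvalue \<open>j\<close>, and its eigenspace \<open>I\<close> is a nonzero
  ideal.\<close>

lemma invariant_form_unique:
  assumes simple: "\<And>I. lie_ideal scale bracket I \<Longrightarrow> I = {0} \<or> I = UNIV" and nz: "\<exists>x::'a. x \<noteq> 0"
    and \<beta>: "\<And>x x' y. \<beta> (x + x') y = \<beta> x y + \<beta> x' y" "\<And>c x y. \<beta> (scale c x) y = c * \<beta> x y"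
      "\<And>x y y'. \<beta> x (y + y') = \<beta> x y + \<beta> x y'" "\<And>c x y. \<beta> x (scale c y) = c * \<beta> x y"
      "\<And>x y z. \<beta> (bracket x y) z = \<beta> x (bracket y z)"
  shows "\<exists>j. \<forall>x y. \<beta> x y = j * ip x y"
proof -
  have "\<exists>t. \<forall>y. ip t y = \<beta> x y" for x by (rule riesz) (simp_all add: \<beta>)
  then obtain \<Phi> where \<Phi>: "\<And>x y. ip (\<Phi> x) y = \<beta> x y" by metis
  have endo: "endo \<Phi>"
    by (rule endoI; rule ip_eqI) (simp_all add: \<Phi> ip_add_left ip_scale_left \<beta>)
  obtain j v where v: "v \<noteq> 0" "\<Phi> v = scale j v"
    using eigenvector_exists[OF endo fin_dim_UNIV subspace_UNIV subset_UNIV] nz by (metis UNIV_I singletonD)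
  define I where "I = {x. \<forall>y. \<beta> x y = j * ip x y}"
  have "bracket a x \<in> I" if "x \<in> I" for a x
  proof -
    have "\<beta> (bracket a x) y = j * ip (bracket a x) y" for y
    proof -
      have neg: "\<beta> (- u) y = - \<beta> u y" for u using \<beta>(2)[of "-1" u y] by simp
      have "\<beta> (bracket a x) y = - \<beta> (bracket x a) y" by (subst bracket_anti) (rule neg)
      also have "\<dots> = - j * ip x (bracket a y)" using that unfolding I_def by (simp add: \<beta>)
      also have "\<dots> = j * ip (bracket a x) y"
        unfolding ip_invariant[symmetric] by (subst bracket_anti[of a x]) (simp add: ip_neg)
      finally show ?thesis .
    qed
    then show ?thesis unfolding I_def by blast
  qed
  moreover have "subspace I"
    unfolding I_def by (rule subspaceI) (use \<beta>(2)[of 0 0] in \<open>auto simp: \<beta> ip_add_left ip_scale_left algebra_simps\<close>)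
  ultimately have "lie_ideal scale bracket I" unfolding lie_ideal_def by blast
  moreover have "v \<in> I" unfolding I_def using v(2) by (simp add: \<Phi>[symmetric] ip_scale_left)
  ultimately have "I = UNIV" using simple v(1) by blast
  then show ?thesis unfolding I_def by blast
qed

end

section \<open>Cartan subalgebras\<close>

context lie_algebra
begin

text \<open>For a root vector \<open>e\<close> of root \<open>\<alpha>\<close>, \<open>ad e\<close> intertwines the twisted action with the adjoint one and
  therefore respects the Fitting components.\<close>

definition twisted :: "('g \<Rightarrow> complex) \<Rightarrow> 'g \<Rightarrow> 'g \<Rightarrow> 'g" where
  "twisted \<alpha> h v = bracket h v + scale (\<alpha> h) v"

lemma endo_twisted: "endo (twisted \<alpha> h)"
  unfolding twisted_def
  by (rule endoI) (simp_all add: bracket_add_right bracket_scale_right scale_right_distrib scale_left_commute)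

text \<open>The scalar parts cancel in the first commutator, which is why the formula starts at
  \<open>Suc n\<close>; afterwards each commutator is one more application of ad x.\<close>

lemma twisted_commutator:
  "((\<lambda>X v. twisted \<alpha> x (X v) - X (twisted \<alpha> x v)) ^^ Suc n) (twisted \<alpha> y) = bracket ((bracket x ^^ Suc n) y)"
proof (induction n)
  case 0
  show ?case
    unfolding twisted_def
    by (rule ext) (simp add: bracket_add_right bracket_scale_right scale_right_distrib scale_left_commute jacobi_derivation)
next
  case (Suc n)
  show ?case
    unfolding funpow.simps(2)[of "Suc n"] comp_apply Suc
    by (rule ext)
      (simp add: twisted_def bracket_add_right bracket_scale_right jacobi_derivation del: funpow.simps)
qed

lemma twisted_0: "twisted (\<lambda>_. 0) h = bracket h"
  by (simp add: twisted_def fun_eq_iff)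

context
  fixes H assumes H: "cartan_subalgebra scale bracket H"
begin

abbreviation (input) "LCS \<equiv> lower_central_series scale bracket H"

lemma cartan_subspace: "subspace H"
  and cartan_closed: "x \<in> H \<Longrightarrow> y \<in> H \<Longrightarrow> bracket x y \<in> H"
  and cartan_nilpotent: "\<exists>n. LCS n = {0}"
  and cartan_normalizer: "(\<And>y. y \<in> H \<Longrightarrow> bracket x y \<in> H) \<Longrightarrow> x \<in> H"
  using H unfolding cartan_subalgebra_def lie_subalgebra_def by auto

lemma LCS_subspace: "subspace (LCS n)"
  by (cases n) (auto simp: cartan_subspace)

lemma LCS_bracket: "x \<in> H \<Longrightarrow> y \<in> LCS n \<Longrightarrow> bracket x y \<in> LCS (Suc n)"
  by (auto intro: span_base)

lemma LCS_subset_H: "LCS n \<subseteq> H"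
proof (induction n)
  case (Suc n)
  then have "{bracket x y |x y. x \<in> H \<and> y \<in> LCS n} \<subseteq> H" using cartan_closed by auto
  then show ?case using span_minimal[OF _ cartan_subspace] by simp
qed simp

lemma LCS_decreasing: "LCS (Suc n) \<subseteq> LCS n"
proof (induction n)
  case 0
  show ?case using LCS_subset_H[of 1] by simp
next
  case (Suc n)
  have "{bracket x y |x y. x \<in> H \<and> y \<in> LCS (Suc n)} \<subseteq> {bracket x y |x y. x \<in> H \<and> y \<in> LCS n}"
    using Suc by blast
  then show ?case unfolding lower_central_series.simps(2)[of _ _ _ "Suc n"] lower_central_series.simps(2)[of _ _ _ n]
    by (rule span_mono)
qed

lemma funpow_bracket_LCS: "x \<in> H \<Longrightarrow> y \<in> H \<Longrightarrow> (bracket x ^^ n) y \<in> LCS n"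
proof (induction n)
  case (Suc n)
  then show ?case using LCS_bracket[of x "(bracket x ^^ n) y" n] by simp
qed simp

lemma cartan_ad_nilpotent: "\<exists>n. \<forall>x\<in>H. \<forall>y\<in>H. (bracket x ^^ n) y = 0"
proof -
  obtain n where "LCS n = {0}" using cartan_nilpotent by blast
  then have "(bracket x ^^ n) y = 0" if "x \<in> H" "y \<in> H" for x y
    using funpow_bracket_LCS[OF that, of n] by simp
  then show ?thesis by (intro exI[of _ n]) simp
qed

text \<open>Nilpotency of \<open>H\<close> makes the twisted operators a family with nilpotent
  commutators. For a root \<alpha> the null component is the generalized root space of the negative
  root; for \<alpha> = 0 it is the null component of the adjoint action.\<close>

lemma cartan_fitting:
  assumes "fin_dim scale UNIV"
  shows "\<exists>y z. x = y + z \<and> (\<forall>h\<in>H. y \<in> null_space (twisted \<alpha> h)) \<and>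
     z \<in> span (\<Union>h\<in>H. divisible (twisted \<alpha> h))"
proof -
  obtain n where n: "\<forall>x\<in>H. \<forall>y\<in>H. (bracket x ^^ n) y = 0" using cartan_ad_nilpotent by blast
  have comm: "\<exists>n. ((\<lambda>X v. A (X v) - X (A v)) ^^ n) B = (\<lambda>_. 0)"
    if AB: "A \<in> twisted \<alpha> ` H" "B \<in> twisted \<alpha> ` H" for A B
  proof -
    obtain x y where xy: "x \<in> H" "y \<in> H" "A = twisted \<alpha> x" "B = twisted \<alpha> y" using AB by auto
    have "(bracket x ^^ Suc n) y = 0" using n xy(1,2) by simp
    then have "((\<lambda>X v. A (X v) - X (A v)) ^^ Suc n) B = (\<lambda>_. 0)"
      unfolding xy twisted_commutator by (simp add: fun_eq_iff)
    then show ?thesis by (rule exI)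
  qed
  have "\<exists>y z. x = y + z \<and> y \<in> (\<Inter>A\<in>twisted \<alpha> ` H. null_space A) \<and> z \<in> span (\<Union>A\<in>twisted \<alpha> ` H. divisible A)"
    by (rule fitting_family[where Q = UNIV]) (auto simp: endo_twisted assms comm simp del: funpow.simps)
  then show ?thesis by simp
qed

lemma null_space_bracket_stable:
  assumes "h \<in> H" "h' \<in> H" "v \<in> null_space (bracket h)"
  shows "bracket h' v \<in> null_space (bracket h)"
proof -
  obtain n where n: "\<forall>x\<in>H. \<forall>y\<in>H. (bracket x ^^ n) y = 0" using cartan_ad_nilpotent by blast
  have "(bracket h ^^ Suc n) h' = 0" using n assms(1,2) by simp
  then have "((\<lambda>X v. bracket h (X v) - X (bracket h v)) ^^ Suc n) (bracket h') = (\<lambda>_. 0)"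
    using twisted_commutator[where \<alpha> = "\<lambda>_. 0" and x = h and n = n and y = h'] unfolding twisted_0 by (simp add: fun_eq_iff del: funpow.simps)
  then show ?thesis by (rule null_space_stable[OF endo_bracket endo_bracket _ assms(3)])
qed

text \<open>Engel's argument on the quotient by \<open>H\<close>, descending along the lower central series.\<close>

lemma null_component_eq_cartan:
  assumes fd: "fin_dim scale UNIV" and z: "\<And>h. h \<in> H \<Longrightarrow> z \<in> null_space (bracket h)"
  shows "z \<in> H"
proof (rule ccontr)
  assume "z \<notin> H"
  define N where "N = {q. \<forall>h\<in>H. q \<in> null_space (bracket h)}"
  obtain n where n: "LCS n = {0}" using cartan_nilpotent by blast
  \<comment> \<open>The induction runs downwards: at j = n the series is zero and \<open>z\<close>
    itself serves; at j = 0 the series is \<open>H\<close> and \<open>q\<close> normalizes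
    \<open>H\<close>, which is absurd for a Cartan subalgebra.\<close>
  have "\<exists>q. q \<in> N \<and> q \<notin> H \<and> (\<forall>x\<in>LCS j. bracket x q \<in> H)" if "j \<le> n" for j
    using that
  proof (induction j rule: inc_induct)
    case base
    have "z \<in> N" using z unfolding N_def by blast
    moreover have "\<forall>x\<in>LCS n. bracket x z \<in> H" unfolding n using cartan_subspace subspace_0 by simp
    ultimately show ?case using \<open>z \<notin> H\<close> by blast
  next
    case (step j)
    have extend: "\<exists>q. q \<in> N \<and> q \<notin> H \<and> (\<forall>x\<in>LCS (Suc j) \<union> B. bracket x q \<in> H)"
      if "finite B" "B \<subseteq> LCS j" for B
      using that
    proof (induction B rule: finite_induct)
      case empty
      then show ?case using step.IH by simp
    next
      case (insert b B)
      then obtain q where q: "q \<in> N" "q \<notin> H" "\<forall>x\<in>LCS (Suc j) \<union> B. bracket x q \<in> H" by blast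
      \<comment> \<open>\<open>I\<close> is stable under ad b: for \<open>x\<close> in
        \<open>LCS j\<close> the bracket [x, b] drops into \<open>LCS (Suc j)\<close>, whose
        elements already send \<open>I\<close> into \<open>H\<close>.\<close>
      define I where "I = {q \<in> N. \<forall>x\<in>LCS (Suc j) \<union> B. bracket x q \<in> H}"
      have b: "b \<in> LCS j" "b \<in> H" using insert.prems LCS_subset_H by auto
      have stab: "bracket b v \<in> I" if v: "v \<in> I" for v
      proof -
        have "bracket b v \<in> N" using v null_space_bracket_stable b(2) unfolding I_def N_def by simp
        moreover have "bracket x (bracket b v) \<in> H" if x: "x \<in> LCS (Suc j) \<union> B" for x
        proof -
          have xj: "x \<in> LCS j" using x insert.prems LCS_decreasing[of j] by blast
          then have "x \<in> H" using LCS_subset_H by blast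
          then have "bracket x b \<in> LCS (Suc j)" using LCS_bracket b(1) by blast
          then have "bracket (bracket x b) v \<in> H" using v unfolding I_def by blast
          moreover have "bracket b (bracket x v) \<in> H"
            using v x cartan_closed[OF b(2)] unfolding I_def by blast
          moreover have "bracket x (bracket b v) = bracket (bracket x b) v + bracket b (bracket x v)"
            by (simp add: jacobi_derivation)
          ultimately show ?thesis using cartan_subspace subspace_add by metis
        qed
        ultimately show ?thesis unfolding I_def by blast
      qed
      have pow: "(bracket b ^^ k) q \<in> I" for k
        by (induction k) (use q stab in \<open>auto simp: I_def\<close>)
      obtain k where "(bracket b ^^ k) q = 0" using q(1) b(2) unfolding N_def null_space_def by blast
      then have ex: "\<exists>k. (bracket b ^^ k) q \<in> H" using cartan_subspace subspace_0 by metis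
      \<comment> \<open>ad b is nilpotent on \<open>q\<close>, so some power enters
        \<open>H\<close>; the last power outside \<open>H\<close> is the vector for
        \<open>insert b B\<close>.\<close>
      define m where "m = (LEAST k. (bracket b ^^ k) q \<in> H)"
      have m: "(bracket b ^^ m) q \<in> H" unfolding m_def by (rule LeastI_ex[OF ex])
      obtain p where p: "m = Suc p" using m q(2) by (cases m) auto
      have "(bracket b ^^ p) q \<notin> H" using not_less_Least[of p "\<lambda>k. (bracket b ^^ k) q \<in> H"] p
        unfolding m_def[symmetric] by simp
      moreover have "bracket b ((bracket b ^^ p) q) \<in> H" using m p by simp
      ultimately show ?case using pow[of p] unfolding I_def by (intro exI[of _ "(bracket b ^^ p) q"]) auto
    qed
    obtain B where B: "finite B" "independent B" "span B = LCS j"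
      using fin_dim_basis[OF fin_dim_subset[OF fd subset_UNIV] LCS_subspace[of j]] by metis
    then obtain q where q: "q \<in> N" "q \<notin> H" "\<forall>x\<in>LCS (Suc j) \<union> B. bracket x q \<in> H"
      using extend[of B] span_superset[of B] by auto
    have "bracket x q \<in> H" if "x \<in> LCS j" for x
    proof -
      have "x \<in> span B" using that B by simp
      then show ?thesis
      proof (induction rule: span_induct_alt)
        case base
        then show ?case using cartan_subspace subspace_0 by simp
      next
        case (step c x y)
        then show ?case using q(3) cartan_subspace
          by (simp add: bracket_add_left bracket_scale_left subspace_add subspace_scale)
      qed
    qed
    then show ?case using q by blast
  qed
  from this[of 0] obtain q where q: "q \<notin> H" "\<forall>x\<in>H. bracket x q \<in> H" by auto
  have "bracket q x \<in> H" if "x \<in> H" for x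
    using q(2) that subspace_neg[OF cartan_subspace] bracket_anti[of q x] by metis
  then show False using cartan_normalizer q(1) by blast
qed

end

end

section \<open>Nondegeneracy on the Cartan subalgebra and coroots\<close>

context quadratic_lie_algebra
begin

lemma ip_funpow: "ip ((bracket h ^^ n) x) y = (-1) ^ n * ip x ((bracket h ^^ n) y)"
proof (induction n arbitrary: y)
  case (Suc n)
  have "ip (bracket h ((bracket h ^^ n) x)) y = - ip ((bracket h ^^ n) x) (bracket h y)"
    by (subst bracket_anti) (simp add: ip_neg ip_invariant)
  then show ?case using Suc[of "bracket h y"] by (simp add: funpow_swap1)
qed simp

text \<open>Write \<open>x\<close> as a high power of ad h applied to some \<open>u\<close> and move
  that power onto \<open>y\<close>, which it kills.\<close>

lemma null_divisible_orthogonal: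
  assumes "x \<in> divisible (bracket h)" "y \<in> null_space (bracket h)"
  shows "ip x y = 0"
proof -
  obtain R where R: "x \<in> R" "bracket h ` R = R" using assms unfolding divisible_def by auto
  obtain n where n: "(bracket h ^^ n) y = 0" using assms unfolding null_space_def by auto
  have "\<exists>u\<in>R. (bracket h ^^ n) u = x" for n
  proof (induction n)
    case 0
    then show ?case using R by auto
  next
    case (Suc n)
    then obtain u where u: "u \<in> R" "(bracket h ^^ n) u = x" by auto
    then obtain w where "w \<in> R" "u = bracket h w" using R(2) by (metis imageE)
    then show ?case using u by (intro bexI[of _ w]) (auto simp: funpow_swap1)
  qed
  then obtain u where "(bracket h ^^ n) u = x" by blast
  then show ?thesis using ip_funpow[of n h u y] n by simp
qed

context
  fixes H assumes H: "cartan_subalgebra scale bracket H"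
begin

abbreviation (input) "H_perp \<equiv> span (\<Union>h\<in>H. divisible (bracket h))"

lemma cartan_decomposition: "\<exists>y z. x = y + z \<and> y \<in> H \<and> z \<in> H_perp"
  using cartan_fitting[OF H fin_dim_UNIV, of x "\<lambda>_. 0"] null_component_eq_cartan[OF H fin_dim_UNIV]
  unfolding twisted_0 by metis

lemma cartan_null: "y \<in> H \<Longrightarrow> h \<in> H \<Longrightarrow> y \<in> null_space (bracket h)"
  using cartan_ad_nilpotent[OF H] unfolding null_space_def by blast

lemma cartan_orthogonal:
  assumes "y \<in> H" "z \<in> H_perp" shows "ip z y = 0"
  using assms(2)
  by (induction rule: span_induct_alt)
    (auto simp: ip_add_left ip_scale_left intro: null_divisible_orthogonal cartan_null[OF assms(1)])

lemma cartan_nondegenerate: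
  assumes "h \<in> H" "\<And>h'. h' \<in> H \<Longrightarrow> ip h h' = 0" shows "h = 0"
proof (rule ip_nondegenerate)
  fix x
  obtain y z where "x = y + z" "y \<in> H" "z \<in> H_perp" using cartan_decomposition by blast
  then show "ip h x = 0"
    using assms(2)[of y] cartan_orthogonal[OF assms(1), of z] ip_sym[of h z] by (simp add: ip_add_right)
qed

text \<open>Extend \<alpha> linearly from \<open>H\<close> to the whole algebra, represent the
  extension by a vector and keep its component in \<open>H\<close>; the other component is
  orthogonal to \<open>H\<close>. This gives the \<open>THE\<close> in \<open>square_length\<close>
  its value.\<close>

lemma cartan_riesz:
  assumes "\<alpha> \<in> dual_space scale H"
  shows "\<exists>!t. t \<in> H \<and> (\<forall>h\<in>H. ip t h = \<alpha> h)"
proof -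
  have \<alpha>: "\<alpha> (x + y) = \<alpha> x + \<alpha> y" "\<alpha> (scale c x) = c * \<alpha> x" if "x \<in> H" "y \<in> H" for x y c
    using assms that unfolding dual_space_def by auto
  obtain B where B: "finite B" "independent B" "span B = H"
    using fin_dim_basis[OF fin_dim_subset[OF fin_dim_UNIV subset_UNIV] cartan_subspace[OF H]] by metis
  interpret C: vector_space "(*) :: complex \<Rightarrow> complex \<Rightarrow> complex"
    by unfold_locales (auto simp: algebra_simps)
  interpret pair: vector_space_pair scale "(*) :: complex \<Rightarrow> complex \<Rightarrow> complex" ..
  obtain L where L: "Vector_Spaces.linear scale (*) L" "\<forall>x\<in>B. L x = \<alpha> x"
    using pair.linear_independent_extend[OF B(2)] by blast
  interpret L: module_hom scale "(*) :: complex \<Rightarrow> complex \<Rightarrow> complex" L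
    using L(1) by (simp add: module_hom_iff_linear)
  have LH: "h \<in> H \<and> L h = \<alpha> h" if "h \<in> span B" for h
    using that
  proof (induction rule: span_induct_alt)
    case base
    have "0 \<in> H" using cartan_subspace[OF H] subspace_0 by blast
    then show ?case using \<alpha>(2)[of 0 0 0] by simp
  next
    case (step c x y)
    have "x \<in> H" using step B span_base by blast
    then show ?case using step \<alpha> L(2) subspace_scale[OF cartan_subspace[OF H]] subspace_add[OF cartan_subspace[OF H]]
      by (simp add: L.add L.scale)
  qed
  obtain t where t: "\<And>y. ip t y = L y"
    using riesz[of L] L.add L.scale by metis
  obtain u z where u: "t = u + z" "u \<in> H" "z \<in> H_perp" using cartan_decomposition by blast
  have u': "ip u h = \<alpha> h" if "h \<in> H" for h
    using t[of h] LH[of h] that B(3) cartan_orthogonal[OF that u(3)] u(1) by (simp add: ip_add_left)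
  show ?thesis
  proof (rule ex1I[of _ u])
    show "u \<in> H \<and> (\<forall>h\<in>H. ip u h = \<alpha> h)" using u(2) u' by blast
    fix t' assume t': "t' \<in> H \<and> (\<forall>h\<in>H. ip t' h = \<alpha> h)"
    have "t' - u = 0"
    proof (rule cartan_nondegenerate)
      show "t' - u \<in> H" using t' u(2) subspace_diff[OF cartan_subspace[OF H]] by blast
      show "ip (t' - u) h = 0" if "h \<in> H" for h using t' u'[OF that] that by (simp add: ip_diff)
    qed
    then show "t' = u" by simp
  qed
qed

text \<open>Scale a vector paired with \<open>e\<close> to pairing 1 and take its component
  \<open>y\<close> in the null space of the twisted action. Then [e, y] lies in \<open>H\<close>
  while the other component is sent into the orthogonal complement, so [e, y] pairs with each
  \<open>h\<close> in \<open>H\<close> to \<open>\<alpha> h\<close>, exactly as \<open>t\<close>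
  does.\<close>

lemma root_vector_coroot:
  assumes \<alpha>: "e \<in> root_space scale bracket H \<alpha>" "e \<noteq> 0"
    and t: "t \<in> H" "\<And>h. h \<in> H \<Longrightarrow> ip t h = \<alpha> h"
  shows "\<exists>f. bracket e f = t"
proof -
  have e: "bracket h e = scale (\<alpha> h) e" if "h \<in> H" for h
    using \<alpha>(1) that unfolding root_space_def by blast
  obtain f' where f': "ip e f' \<noteq> 0" using ip_nondegenerate[of e] \<alpha>(2) by blast
  define f where "f = scale (1 / ip e f') f'"
  have ef: "ip e f = 1" using f' by (simp add: f_def ip_scale_right)
  obtain y z where yz: "f = y + z" "\<forall>h\<in>H. y \<in> null_space (twisted \<alpha> h)"
      "z \<in> span (\<Union>h\<in>H. divisible (twisted \<alpha> h))"
    using cartan_fitting[OF H fin_dim_UNIV] by metis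
  have equi: "bracket h (bracket e v) = bracket e (twisted \<alpha> h v)" if "h \<in> H" for h v
    using jacobi_derivation[of h e v] e[OF that]
    by (simp add: twisted_def bracket_add_right bracket_scale_left bracket_scale_right)
  have equi': "(bracket h ^^ n) (bracket e v) = bracket e ((twisted \<alpha> h ^^ n) v)" if "h \<in> H" for h v n
    by (induction n) (auto simp: equi[OF that])
  have "bracket e y \<in> H"
  proof (rule null_component_eq_cartan[OF H fin_dim_UNIV])
    fix h assume h: "h \<in> H"
    then obtain n where "(twisted \<alpha> h ^^ n) y = 0" using yz(2) unfolding null_space_def by blast
    then have "(bracket h ^^ n) (bracket e y) = 0" using equi'[OF h] by simp
    then show "bracket e y \<in> null_space (bracket h)" by (rule null_spaceI)
  qed
  moreover have "bracket e z \<in> H_perp" using yz(3)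
  proof (induction rule: span_induct_alt)
    case base
    then show ?case by (simp add: span_zero)
  next
    case (step c x v)
    then obtain h where h: "h \<in> H" "x \<in> divisible (twisted \<alpha> h)" by blast
    then obtain R where R: "x \<in> R" "twisted \<alpha> h ` R = R" unfolding divisible_def by blast
    have "bracket h ` (bracket e ` R) = bracket e ` (twisted \<alpha> h ` R)"
      unfolding image_image equi[OF h(1)] ..
    then have "bracket h ` (bracket e ` R) = bracket e ` R" unfolding R(2) .
    with imageI[OF R(1)] have "bracket e x \<in> divisible (bracket h)"
      unfolding divisible_def by (intro CollectI exI[of _ "bracket e ` R"] conjI)
    then have "bracket e x \<in> H_perp" by (intro span_base UN_I[OF h(1)])
    then show ?case using step by (simp add: bracket_add_right bracket_scale_right span_add span_scale)
  qed
  ultimately have eH: "bracket e y \<in> H" "bracket e z \<in> H_perp" by auto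
  have "ip (bracket e y - t) h = 0" if "h \<in> H" for h
  proof -
    \<comment> \<open>The right side is \<open>\<alpha> h * ip e f\<close>, that is
      \<open>\<alpha> h\<close>, and on the left the \<open>z\<close> term is orthogonal to
      \<open>h\<close>.\<close>
    have "ip (bracket e y + bracket e z) h = ip (bracket h e) f"
      unfolding bracket_add_right[symmetric] yz(1)[symmetric] by (metis ip_invariant ip_sym)
    then show ?thesis
      using e[OF that] ef t(2)[OF that] cartan_orthogonal[OF that eH(2)]
      by (simp add: ip_add_left ip_scale_left ip_diff)
  qed
  then have "bracket e y - t = 0"
    by (rule cartan_nondegenerate[OF subspace_diff[OF cartan_subspace[OF H] eH(1) t(1)]])
  then show ?thesis by auto
qed

end

end

section \<open>Long roots and the normalization of the form\<close>

lemma finite_roots: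
  assumes "positive_system sg br H P" "highest_root sg br H P \<theta>"
  shows "finite (roots sg br H)"
proof -
  have P: "P \<subseteq> roots sg br H" "\<And>\<alpha>. \<alpha> \<in> roots sg br H \<Longrightarrow> \<alpha> \<in> P \<longleftrightarrow> (\<lambda>x. - \<alpha> x) \<notin> P"
    using assms(1) unfolding positive_system_def by blast+
  have \<theta>: "\<theta> \<in> roots sg br H"
    "\<And>\<beta>. \<beta> \<in> roots sg br H \<Longrightarrow> \<exists>c :: ('a \<Rightarrow> complex) \<Rightarrow> nat.
        \<forall>h\<in>H. \<theta> h - \<beta> h = (\<Sum>\<alpha>\<in>P. of_nat (c \<alpha>) * \<alpha> h)"
    using assms(2) unfolding highest_root_def by blast+
  have "finite P"
  proof (rule ccontr)
    assume inf: "infinite P"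
    \<comment> \<open>A sum over an infinite index set is 0 by convention, so for infinite
      \<open>P\<close> the highest root condition says that all roots coincide with
      \<theta>.\<close>
    have "\<beta> = \<theta>" if \<beta>: "\<beta> \<in> roots sg br H" for \<beta>
    proof
      fix h
      show "\<beta> h = \<theta> h"
      proof (cases "h \<in> H")
        case True
        then show ?thesis using \<theta>(2)[OF \<beta>] inf by auto
      next
        case False
        then show ?thesis using \<beta> \<theta>(1) unfolding roots_def dual_space_def by simp
      qed
    qed
    then have "roots sg br H \<subseteq> {\<theta>}" by blast
    then have "finite P" using P(1) by (meson finite.emptyI finite_insert finite_subset)
    then show False using inf by contradiction
  qed
  have "\<alpha> \<in> P \<union> (\<lambda>\<alpha> x. - \<alpha> x) ` P" if "\<alpha> \<in> roots sg br H" for \<alpha>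
  proof (cases "\<alpha> \<in> P")
    case False
    then have "(\<lambda>x. - \<alpha> x) \<in> P" using P(2) that by blast
    then have "(\<lambda>x. - (- \<alpha> x)) \<in> (\<lambda>\<alpha> x. - \<alpha> x) ` P" by (rule imageI)
    then show ?thesis by simp
  qed simp
  then have "roots sg br H \<subseteq> P \<union> (\<lambda>\<alpha> x. - \<alpha> x) ` P" by (rule subsetI)
  with \<open>finite P\<close> show ?thesis by (meson finite_UnI finite_imageI finite_subset)
qed

lemma long_root_exists:
  assumes "finite (roots sg br H)" "\<theta> \<in> roots sg br H"
  shows "\<exists>\<alpha>. long_root sg br H \<alpha>"
proof -
  let ?f = "\<lambda>\<beta>. Re (square_length (killing_form sg br) H \<beta>)"
  have "Max (?f ` roots sg br H) \<in> ?f ` roots sg br H" using assms by (intro Max_in) auto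
  then obtain \<alpha> where "\<alpha> \<in> roots sg br H" "?f \<alpha> = Max (?f ` roots sg br H)" by auto
  then show ?thesis using assms(1) unfolding long_root_def by (intro exI[of _ \<alpha>]) auto
qed

text \<open>The number \<open>S\<close> is the Killing square length of the coroot \<open>t\<close>, so that \<open>S / 2\<close> is twice the
  dual Coxeter number.\<close>

lemma normalized_form_structure:
  fixes sg :: "complex \<Rightarrow> 'g::ab_group_add \<Rightarrow> 'g"
  assumes g: "simple_lie_algebra sg br" "fin_dim sg UNIV"
    and H: "cartan_subalgebra sg br H" and P: "positive_system sg br H P" "highest_root sg br H P \<theta>"
    and ip: "normalized_killing_form sg br H ip"
  obtains S :: nat and t e f where "quadratic_lie_algebra sg br ip" "S > 0"
    "\<And>x y. killing_form sg br x y = of_nat S / 2 * ip x y"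
    "br t e = sg 2 e" "br e f = t" "ip t t = 2" "e \<noteq> 0"
proof -
  interpret lie_algebra sg br using g(1) unfolding simple_lie_algebra_def by blast
  interpret fd_lie_algebra sg br by unfold_locales (rule g(2))
  obtain c where c: "\<And>x y. ip x y = c * \<kappa> x y"
    using ip unfolding normalized_killing_form_def by blast
  obtain \<alpha> where long: "long_root sg br H \<alpha>"
    using long_root_exists[OF finite_roots[OF P]] P(2) unfolding highest_root_def by blast
  have sq: "square_length ip H \<alpha> = 2" using ip long unfolding normalized_killing_form_def by blast
  have \<alpha>: "\<alpha> \<in> roots sg br H" using long unfolding long_root_def by blast
  have ip_lin: "ip (x + y) z = ip x z + ip y z" "ip (sg a x) z = a * ip x z" "ip x y = ip y x"
    "ip (br x y) z = ip x (br y z)" for x y z a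
    using killing_sym[of x y] by (simp_all add: c killing_add_left killing_scale_left killing_invariant algebra_simps)
  \<comment> \<open>The square length is \<open>ip\<close> evaluated at some vector, whatever
    \<open>THE\<close> returns, so the value 2 already shows that the form is nonzero.\<close>
  have "\<exists>x y. ip x y \<noteq> 0" using sq unfolding square_length_def Let_def
    by (metis zero_neq_numeral)
  define I where "I = {x. \<forall>y. ip x y = 0}"
  have "lie_ideal sg br I"
    unfolding lie_ideal_def
  proof (intro conjI allI ballI)
    show "subspace I" unfolding I_def by (rule subspaceI) (use ip_lin(2)[of 0 0] in \<open>auto simp: ip_lin(1,2)\<close>)
    fix x y assume "y \<in> I"
    then have "ip (br y x) z = 0" for z unfolding I_def ip_lin(4) by blast
    then show "br x y \<in> I" unfolding I_def
      using ip_lin(2)[of "-1" "br y x"] bracket_anti[of x y] by auto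
  qed
  moreover have "I \<noteq> UNIV" using \<open>\<exists>x y. ip x y \<noteq> 0\<close> unfolding I_def by blast
  ultimately have "I = {0}" using g(1) unfolding simple_lie_algebra_def by blast
  then have nd: "x = 0" if "\<And>y. ip x y = 0" for x using that unfolding I_def by blast
  interpret quadratic_lie_algebra sg br ip
    by unfold_locales (use ip_lin nd in auto)
  have \<alpha>': "\<alpha> \<in> dual_space sg H" "root_space sg br H \<alpha> \<noteq> {0}" using \<alpha> unfolding roots_def by auto
  define t where "t = (THE t. t \<in> H \<and> (\<forall>h\<in>H. ip t h = \<alpha> h))"
  have "t \<in> H \<and> (\<forall>h\<in>H. ip t h = \<alpha> h)"
    unfolding t_def by (rule theI'[OF cartan_riesz[OF H \<alpha>'(1)]])
  then have t: "t \<in> H" "\<And>h. h \<in> H \<Longrightarrow> ip t h = \<alpha> h" by auto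
  have tt: "ip t t = 2" using sq unfolding square_length_def t_def by (simp add: Let_def)
  have "0 \<in> root_space sg br H \<alpha>" unfolding root_space_def by simp
  then obtain e where e: "e \<in> root_space sg br H \<alpha>" "e \<noteq> 0" using \<alpha>'(2) by blast
  obtain f where f: "br e f = t" using root_vector_coroot[OF H e t] by blast
  \<comment> \<open>The Riesz vector \<open>t\<close> of a root of square length 2 is its coroot:
    \<open>\<alpha> t = ip t t = 2\<close>.\<close>
  have te: "br t e = sg 2 e" using e(1) t tt unfolding root_space_def by auto
  have "\<exists>S::nat. (\<forall>B. finite B \<longrightarrow> independent B \<longrightarrow> span B = UNIV \<longrightarrow>
      trace_on B (\<lambda>x. br t (br t x)) = of_nat S) \<and> (S = 0 \<longrightarrow> (\<forall>x\<in>UNIV. br e x = 0))"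
  proof (rule sl2_trace_square[OF endo_bracket endo_bracket endo_bracket[of f] _ _ fin_dim_UNIV subspace_UNIV])
    show "br t (br e x) = br e (br t x) + sg 2 (br e x)" for x
      using jacobi_derivation[of t e x] te by (simp add: bracket_scale_left algebra_simps)
    show "br e (br f x) = br f (br e x) + br t x" for x
      using jacobi_derivation[of e f x] f by (simp add: algebra_simps)
  qed simp_all
  then obtain S :: nat where S: "trace_on basis (\<lambda>x. br t (br t x)) = of_nat S"
    using basis by meson
  \<comment> \<open>\<open>S\<close> is the trace of the square of ad t, that is, the Killing form
    at (t, t), and \<open>ip t t = 2\<close>.\<close>
  have cS: "c * of_nat S = 2" using tt S unfolding c killing_form_trace by simp
  have "S > 0" using cS by (cases S) simp_all
  have "\<kappa> x y = of_nat S / 2 * ip x y" for x y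
  proof -
    have "of_nat S / 2 * ip x y = (c * of_nat S) / 2 * \<kappa> x y" by (simp add: c)
    then show ?thesis using cS by simp
  qed
  then show ?thesis by (rule that[OF quadratic_lie_algebra_axioms \<open>S > 0\<close> _ te f tt e(2)])
qed

section \<open>Zero-mode derivations\<close>

lemma Sum_any_eq_sum:
  fixes f :: "nat \<Rightarrow> 'a::comm_monoid_add"
  assumes "\<And>i. i \<ge> N \<Longrightarrow> f i = 0"
  shows "Sum_any f = sum f {..<N}"
  by (rule Sum_any.expand_superset) (use assms in \<open>auto simp: not_le[symmetric]\<close>)

text \<open>The case m = 0 of the Jacobi identity: the left sum collapses to its first term because
  0 gchoose i vanishes for i > 0. The bound \<open>N\<close> makes the right sum finite.\<close>

lemma jacobi_identity_iterate:
  fixes sW :: "complex \<Rightarrow> 'w::ab_group_add \<Rightarrow> 'w"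
  assumes "module sW" "jacobi_identity sW Y YW" and YW0: "\<And>u n. YW u n 0 = 0"
    and "\<And>i. i \<ge> N \<Longrightarrow> YW v (n + int i) w = 0" "\<And>i. i \<ge> N \<Longrightarrow> YW u (int i) w = 0"
  shows "YW (Y u k v) n w = (\<Sum>i<N. sW ((-1) ^ i * (of_int k gchoose i))
     (YW u (k - int i) (YW v (n + int i) w) - sW ((-1) powi k) (YW v (n + k - int i) (YW u (int i) w))))"
proof -
  interpret module sW by fact
  have "Sum_any (\<lambda>i::nat. sW (of_int 0 gchoose i) (YW (Y u (k + int i) v) (0 + n - int i) w)) =
      Sum_any (\<lambda>i::nat. sW ((-1) ^ i * (of_int k gchoose i))
          (YW u (0 + k - int i) (YW v (n + int i) w)
             - sW ((-1) powi k) (YW v (n + k - int i) (YW u (0 + int i) w))))"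
    using assms(2) unfolding jacobi_identity_def by blast
  moreover have "Sum_any (\<lambda>i::nat. sW (of_int 0 gchoose i) (YW (Y u (k + int i) v) (0 + n - int i) w))
      = YW (Y u k v) n w"
  proof (subst Sum_any_eq_sum[of 1])
    show "sW (of_int 0 gchoose i) (YW (Y u (k + int i) v) (0 + n - int i) w) = 0" if "i \<ge> 1" for i
      using that by (cases i) (auto simp: gbinomial_0)
  qed simp
  moreover have "Sum_any (\<lambda>i::nat. sW ((-1) ^ i * (of_int k gchoose i))
          (YW u (0 + k - int i) (YW v (n + int i) w)
             - sW ((-1) powi k) (YW v (n + k - int i) (YW u (0 + int i) w)))) =
     (\<Sum>i<N. sW ((-1) ^ i * (of_int k gchoose i))
     (YW u (k - int i) (YW v (n + int i) w) - sW ((-1) powi k) (YW v (n + k - int i) (YW u (int i) w))))"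
    by (subst Sum_any_eq_sum[of N]) (auto simp: assms)
  ultimately show ?thesis by simp
qed

context voa_module
begin

abbreviation sign :: "int \<Rightarrow> complex" where "sign n \<equiv> (-1) powi n"

lemma endo_YW: "module_hom wscale wscale (YW u n)"
  by unfold_locales (simp_all add: YW_add_right YW_scale_right)

lemmas YW_zero [simp] = module_hom.zero[OF endo_YW]
  and YW_sum = module_hom.sum[OF endo_YW]
  and YW_neg = module_hom.neg[OF endo_YW]

lemmas YW_iterate = jacobi_identity_iterate[OF W.module_axioms YW_jacobi YW_zero]

lemma YW_bound: obtains N where "\<And>i. i \<ge> N \<Longrightarrow> YW u (n + int i) w = 0"
proof -
  obtain M where M: "\<forall>m\<ge>M. YW u m w = 0" using YW_truncation by blast
  have "YW u (n + int i) w = 0" if "i \<ge> nat (M - n)" for i using M that by auto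
  then show ?thesis by (rule that)
qed

lemma YW_bound0: obtains N where "\<And>i. i \<ge> N \<Longrightarrow> YW u (int i) w = 0"
  using YW_bound[of u 0 w] by auto

lemma YW_commutator_0: "YW (Y u 0 v) n w = YW u 0 (YW v n w) - YW v n (YW u 0 w)"
proof -
  obtain N1 where N1: "\<And>i. i \<ge> N1 \<Longrightarrow> YW v (n + int i) w = 0" using YW_bound by blast
  obtain N2 where N2: "\<And>i. i \<ge> N2 \<Longrightarrow> YW u (int i) w = 0" using YW_bound0 by blast
  let ?g = "\<lambda>i. wscale ((-1) ^ i * (of_int 0 gchoose i))
     (YW u (0 - int i) (YW v (n + int i) w) - wscale (sign 0) (YW v (n + 0 - int i) (YW u (int i) w)))"
  have "YW (Y u 0 v) n w = (\<Sum>i<Suc (max N1 N2). ?g i)"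
    by (rule YW_iterate) (auto intro: N1 N2)
  also have "\<dots> = ?g 0 + (\<Sum>i<max N1 N2. ?g (Suc i))" by (rule sum.lessThan_Suc_shift)
  also have "(\<Sum>i<max N1 N2. ?g (Suc i)) = 0" by (simp add: gbinomial_0)
  finally show ?thesis by simp
qed

section \<open>Divided powers of L(-1) and the skew-symmetric vertex operator\<close>

abbreviation DW :: "'w \<Rightarrow> 'w" where "DW \<equiv> YW om 0"

lemma DW_virasoro: "virasoro_mode YW om (-1) = DW"
  by (simp add: virasoro_mode_def)

lemma YW_DW: "YW u n (DW w) = DW (YW u n w) + wscale (of_int n) (YW u (n - 1) w)"
  using YW_commutator_0[of om u n w] YW_derivative[of u n w]
  by (simp add: virasoro_mode_def algebra_simps)

definition DD :: "nat \<Rightarrow> 'w \<Rightarrow> 'w" where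
  "DD i x = wscale (1 / fact i) ((DW ^^ i) x)"

lemma DD_0 [simp]: "DD 0 x = x"
  by (simp add: DD_def)

lemma endo_DD: "module_hom wscale wscale (DD i)"
proof -
  have "(DW ^^ i) (x + y) = (DW ^^ i) x + (DW ^^ i) y \<and> (DW ^^ i) (wscale c x) = wscale c ((DW ^^ i) x)" for x y c
    by (induction i) (auto simp: YW_add_right YW_scale_right)
  then show ?thesis
    by unfold_locales (simp_all add: DD_def W.scale_right_distrib mult.commute)
qed

lemmas DD_zero [simp] = module_hom.zero[OF endo_DD]
  and DD_add = module_hom.add[OF endo_DD]
  and DD_scale = module_hom.scale[OF endo_DD]
  and DD_diff = module_hom.diff[OF endo_DD]
  and DD_sum = module_hom.sum[OF endo_DD]

lemma DW_DD: "DW (DD i x) = wscale (of_nat (Suc i)) (DD (Suc i) x)"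
  by (simp add: DD_def YW_scale_right field_simps del: of_nat_Suc)

lemma DD_DW: "DD i (DW x) = wscale (of_nat (Suc i)) (DD (Suc i) x)"
  by (simp add: DD_def funpow_swap1 del: of_nat_Suc)

text \<open>Up to sign, the mode \<open>x\<^bsub>n\<^esub> v\<close> of the skew-symmetric vertex operator.\<close>

definition skew :: "'v \<Rightarrow> int \<Rightarrow> 'w \<Rightarrow> 'w" where
  "skew v n x = Sum_any (\<lambda>p::nat. wscale ((-1) ^ p) (DD p (YW v (n + int p) x)))"

lemma skew_eq:
  assumes "\<And>p. p \<ge> K \<Longrightarrow> YW v (n + int p) x = 0"
  shows "skew v n x = (\<Sum>p<K. wscale ((-1) ^ p) (DD p (YW v (n + int p) x)))"
  unfolding skew_def by (rule Sum_any_eq_sum) (simp add: assms)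

lemma sign_nat: "sign (n + int p) = sign n * (-1) ^ p"
  by (subst power_int_add) auto

lemma sign_minus: "sign (- n) = sign n"
  by (simp add: power_int_minus power_int_inverse[symmetric])

lemma opposite_mode_skew: "opposite_mode wscale YW om x n v = wscale (- sign n) (skew v n x)"
proof -
  obtain K where K: "\<And>p. p \<ge> K \<Longrightarrow> YW v (n + int p) x = 0" using YW_bound by blast
  have sgn: "(-1::complex) powi (- (n + int p) - 1) = - (sign n * (-1) ^ p)" for p
  proof -
    have "- (n + int p) - 1 = - (n + int p + 1)" by simp
    then have "(-1::complex) powi (- (n + int p) - 1) = sign (n + int p + int 1)"
      by (simp only: sign_minus) simp
    then show ?thesis by (simp only: sign_nat) simp
  qed
  have fp0: "(DW ^^ i) 0 = 0" for i by (induction i) auto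
  have "opposite_mode wscale YW om x n v
      = (\<Sum>i<K. wscale ((-1) powi (- (n + int i) - 1) / fact i) ((DW ^^ i) (YW v (n + int i) x)))"
    unfolding opposite_mode_def DW_virasoro
    by (rule Sum_any_eq_sum) (simp add: K fp0)
  also have "\<dots> = (\<Sum>i<K. wscale (- sign n) (wscale ((-1) ^ i) (DD i (YW v (n + int i) x))))"
    unfolding sgn by (simp add: DD_def)
  also have "\<dots> = wscale (- sign n) (skew v n x)"
    by (subst skew_eq[of K]) (simp_all add: K W.scale_sum_right)
  finally show ?thesis .
qed

lemma endo_skew: "module_hom wscale wscale (skew v n)"
proof unfold_locales
  fix x y
  obtain K1 where K1: "\<And>p. p \<ge> K1 \<Longrightarrow> YW v (n + int p) x = 0" using YW_bound by blast
  obtain K2 where K2: "\<And>p. p \<ge> K2 \<Longrightarrow> YW v (n + int p) y = 0" using YW_bound by blast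
  let ?K = "max K1 K2"
  show "skew v n (x + y) = skew v n x + skew v n y"
    by (subst (1 2 3) skew_eq[of ?K])
      (auto simp: K1 K2 YW_add_right DD_add W.scale_right_distrib sum.distrib)
next
  fix c x
  obtain K where K: "\<And>p. p \<ge> K \<Longrightarrow> YW v (n + int p) x = 0" using YW_bound by blast
  show "skew v n (wscale c x) = wscale c (skew v n x)"
    by (subst (1 2) skew_eq[of K]) (auto simp: K YW_scale_right DD_scale W.scale_sum_right mult.commute)
qed

lemmas skew_scale = module_hom.scale[OF endo_skew]
  and skew_sum = module_hom.sum[OF endo_skew]

lemma skew_add_left: "skew (u + v) n x = skew u n x + skew v n x"
proof -
  obtain K1 where K1: "\<And>p. p \<ge> K1 \<Longrightarrow> YW u (n + int p) x = 0" using YW_bound by blast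
  obtain K2 where K2: "\<And>p. p \<ge> K2 \<Longrightarrow> YW v (n + int p) x = 0" using YW_bound by blast
  let ?K = "max K1 K2"
  show ?thesis
    by (subst (1 2 3) skew_eq[of ?K])
      (auto simp: K1 K2 YW_add_left DD_add W.scale_right_distrib sum.distrib)
qed

lemma skew_scale_left: "skew (scale c v) n x = wscale c (skew v n x)"
proof -
  obtain K where K: "\<And>p. p \<ge> K \<Longrightarrow> YW v (n + int p) x = 0" using YW_bound by blast
  show ?thesis
    by (subst (1 2) skew_eq[of K]) (auto simp: K YW_scale_left DD_scale W.scale_sum_right mult.commute)
qed

text \<open>Moving L(-1) out of v_(n+p) leaves a term with coefficient n + p. The part with
  \<open>n\<close> is the claim; the part with \<open>p\<close> cancels against the extra power of
  L(-1) at index p - 1, so it telescopes along \<open>g\<close>.\<close>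

lemma skew_DW: "skew v n (DW x) = wscale (of_int n) (skew v (n - 1) x)"
proof -
  obtain K0 where K0: "\<And>p. p \<ge> K0 \<Longrightarrow> YW v (n - 1 + int p) x = 0" using YW_bound by blast
  define y where "y p = YW v (n - 1 + int p) x" for p
  have y: "y p = 0" if "p \<ge> K0" for p using K0 that unfolding y_def by blast
  have yS: "YW v (n + int p) x = y (Suc p)" for p by (simp add: y_def)
  have yn: "YW v (n + int p - 1) x = y p" for p by (simp add: y_def algebra_simps)
  define g where "g p = wscale ((-1) ^ p * of_nat p) (DD p (y p))" for p
  have vD: "YW v (n + int p) (DW x) = DW (y (Suc p)) + wscale (of_int n + of_nat p) (y p)" for p
    using YW_DW[of v "n + int p" x] unfolding yS yn by simp
  have "skew v n (DW x) = (\<Sum>p<Suc K0. wscale ((-1) ^ p) (DD p (YW v (n + int p) (DW x))))"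
    by (rule skew_eq) (simp add: vD y)
  also have "\<dots> = (\<Sum>p<Suc K0. wscale (of_int n) (wscale ((-1) ^ p) (DD p (y p))) + (g p - g (Suc p)))"
  proof (rule sum.cong)
    fix p
    show "wscale ((-1) ^ p) (DD p (YW v (n + int p) (DW x)))
        = wscale (of_int n) (wscale ((-1) ^ p) (DD p (y p))) + (g p - g (Suc p))"
      unfolding vD DD_add DD_scale DD_DW g_def
      by (simp add: W.scale_right_distrib W.scale_left_distrib algebra_simps del: of_nat_Suc)
  qed simp
  also have "\<dots> = (\<Sum>p<Suc K0. wscale (of_int n) (wscale ((-1) ^ p) (DD p (y p))))
      + (\<Sum>p<Suc K0. g p - g (Suc p))"
    by (rule sum.distrib)
  also have "(\<Sum>p<Suc K0. g p - g (Suc p)) = g 0 - g (Suc K0)" by (rule sum_lessThan_telescope')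
  also have "\<dots> = 0" by (simp add: g_def y)
  also have "(\<Sum>p<Suc K0. wscale (of_int n) (wscale ((-1) ^ p) (DD p (y p)))) = wscale (of_int n) (skew v (n - 1) x)"
    by (subst skew_eq[of "Suc K0"]) (auto simp: K0 y_def W.scale_sum_right)
  finally show ?thesis by simp
qed

lemma skew_DD: "skew v n (DD i x) = wscale (of_int n gchoose i) (skew v (n - int i) x)"
proof (induction i arbitrary: x n)
  case (Suc i)
  have "wscale (of_nat (Suc i)) (skew v n (DD (Suc i) x)) = skew v n (DW (DD i x))"
    by (simp only: DW_DD skew_scale)
  also have "\<dots> = wscale (of_int n * (of_int (n - 1) gchoose i)) (skew v (n - int (Suc i)) x)"
    using Suc[of "n - 1" x] by (simp add: skew_DW algebra_simps)
  also have "of_int n * (of_int (n - 1) gchoose i) = of_nat (Suc i) * (of_int n gchoose Suc i :: complex)"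
    by (simp only: gbinomial_absorption of_int_diff of_int_1)
  finally have "wscale (of_nat (Suc i)) (skew v n (DD (Suc i) x))
      = wscale (of_nat (Suc i)) (wscale (of_int n gchoose Suc i) (skew v (n - int (Suc i)) x))"
    by (simp only: W.scale_scale)
  then show ?case by (simp only: W.scale_cancel_left) (simp del: of_nat_Suc)
qed simp

text \<open>Coefficient form of Y(u, x) e^(yL(-1)) = e^(yL(-1)) Y(u, x - y).\<close>

lemma YW_DD:
  "YW u n (DD i x) = (\<Sum>k\<le>i. wscale (of_int n gchoose k) (DD (i - k) (YW u (n - int k) x)))"
proof (induction i arbitrary: x)
  case (Suc i)
  let ?c = "\<lambda>k. (of_int n gchoose k :: complex)"
  define y where "y k = YW u (n - int k) x" for k
  have uD: "YW u (n - int k) (DW x) = DW (y k) + wscale (of_int n - of_nat k) (y (Suc k))" for k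
    using YW_DW[of u "n - int k" x] unfolding y_def by (simp add: algebra_simps)
  have c: "(of_int n - of_nat k) * ?c k = of_nat (Suc k) * ?c (Suc k)" for k
    using gbinomial_mult_1[of "of_int n :: complex" k] by (simp add: algebra_simps)
  have "wscale (of_nat (Suc i)) (YW u n (DD (Suc i) x)) = YW u n (DD i (DW x))"
    by (simp only: DD_DW YW_scale_right)
  also have "\<dots> = (\<Sum>k\<le>i. wscale (?c k) (DD (i - k) (YW u (n - int k) (DW x))))" by (rule Suc)
  also have "\<dots> = (\<Sum>k\<le>i. wscale (?c k * of_nat (Suc i - k)) (DD (Suc i - k) (y k))
        + wscale (of_nat (Suc k) * ?c (Suc k)) (DD (Suc i - Suc k) (y (Suc k))))"
  proof (rule sum.cong)
    fix k assume "k \<in> {..i}"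
    then have "Suc i - k = Suc (i - k)" by auto
    then show "wscale (?c k) (DD (i - k) (YW u (n - int k) (DW x))) =
        wscale (?c k * of_nat (Suc i - k)) (DD (Suc i - k) (y k))
        + wscale (of_nat (Suc k) * ?c (Suc k)) (DD (Suc i - Suc k) (y (Suc k)))"
      unfolding uD DD_add DD_DW DD_scale c[symmetric]
      by (simp only: diff_Suc_Suc W.scale_right_distrib W.scale_scale mult.commute)
  qed simp
  also have "\<dots> = (\<Sum>k\<le>i. wscale (?c k * of_nat (Suc i - k)) (DD (Suc i - k) (y k)))
      + (\<Sum>k\<le>i. wscale (of_nat (Suc k) * ?c (Suc k)) (DD (Suc i - Suc k) (y (Suc k))))"
    by (rule sum.distrib)
  also have "(\<Sum>k\<le>i. wscale (?c k * of_nat (Suc i - k)) (DD (Suc i - k) (y k)))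
      = (\<Sum>k\<le>Suc i. wscale (?c k * of_nat (Suc i - k)) (DD (Suc i - k) (y k)))"
    by simp
  also have "(\<Sum>k\<le>i. wscale (of_nat (Suc k) * ?c (Suc k)) (DD (Suc i - Suc k) (y (Suc k))))
      = (\<Sum>k\<le>Suc i. wscale (of_nat k * ?c k) (DD (Suc i - k) (y k)))"
    by (subst sum.atMost_Suc_shift) simp
  also have "(\<Sum>k\<le>Suc i. wscale (?c k * of_nat (Suc i - k)) (DD (Suc i - k) (y k)))
      + (\<Sum>k\<le>Suc i. wscale (of_nat k * ?c k) (DD (Suc i - k) (y k)))
      = (\<Sum>k\<le>Suc i. wscale (of_nat (Suc i)) (wscale (?c k) (DD (Suc i - k) (y k))))"
    unfolding sum.distrib[symmetric]
  proof (rule sum.cong)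
    fix k assume "k \<in> {..Suc i}"
    then have "?c k * of_nat (Suc i - k) + of_nat k * ?c k = of_nat (Suc i) * ?c k"
      by (simp add: of_nat_diff algebra_simps)
    then show "wscale (?c k * of_nat (Suc i - k)) (DD (Suc i - k) (y k)) + wscale (of_nat k * ?c k) (DD (Suc i - k) (y k))
       = wscale (of_nat (Suc i)) (wscale (?c k) (DD (Suc i - k) (y k)))"
      by (simp only: W.scale_left_distrib[symmetric] W.scale_scale)
  qed simp
  finally have "wscale (of_nat (Suc i)) (YW u n (DD (Suc i) x))
      = wscale (of_nat (Suc i)) (\<Sum>k\<le>Suc i. wscale (?c k) (DD (Suc i - k) (y k)))"
    by (simp only: W.scale_sum_right)
  then show ?case unfolding y_def by (simp only: W.scale_cancel_left) (simp del: of_nat_Suc sum.atMost_Suc)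
qed simp

text \<open>The iterate formula for the modes of u_n v splits the zero mode into the double sums
  \<open>A\<close> and \<open>B\<close>. Collecting \<open>A\<close> by total order j + p,
  \<open>YW_DD\<close> resums it to u_n applied to w_0 v; for fixed j, \<open>skew_DD\<close> resums
  \<open>B\<close> to (w_0 u)_n v.\<close>

theorem zero_mode_leibniz:
  "opposite_mode wscale YW om w 0 (Y u n v)
    = YW u n (opposite_mode wscale YW om w 0 v)
      + opposite_mode wscale YW om (opposite_mode wscale YW om w 0 u) n v"
proof -
  obtain N1 where N1: "\<And>i. i \<ge> N1 \<Longrightarrow> YW u (int i) w = 0" using YW_bound0 by blast
  obtain N2 where N2: "\<And>i. i \<ge> N2 \<Longrightarrow> YW v (int i) w = 0" using YW_bound0 by blast
  define N where "N = max N1 N2"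
  have Nu: "YW u (int i) w = 0" if "i \<ge> N" for i using N1 that unfolding N_def by simp
  have Nv: "YW v (int i) w = 0" if "i \<ge> N" for i using N2 that unfolding N_def by simp
  obtain K1 where K1: "\<And>p. p \<ge> K1 \<Longrightarrow> YW (Y u n v) (int p) w = 0" using YW_bound0 by blast
  have "\<exists>K. \<forall>p\<ge>K. YW v (n - int j + int p) (YW u (int j) w) = 0" for j
    using YW_bound[of v "n - int j" "YW u (int j) w"] by blast
  then obtain K2 where K2: "\<And>j p. p \<ge> K2 j \<Longrightarrow> YW v (n - int j + int p) (YW u (int j) w) = 0" by metis
  \<comment> \<open>One bound for every truncation: the bounds \<open>K2 j\<close> depend on the
    intermediate vector, but only finitely many j occur.\<close>
  define K where "K = Max (insert K1 (insert N (K2 ` {..<N})))"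
  have "x \<le> K" if "x \<in> insert K1 (insert N (K2 ` {..<N}))" for x
    unfolding K_def by (rule Max_ge[OF _ that]) simp
  then have K: "K1 \<le> K" "N \<le> K" "\<And>j. j < N \<Longrightarrow> K2 j \<le> K" by auto
  define A where "A j p = wscale ((-1) ^ (p + j) * (of_int n gchoose j)) (DD p (YW u (n - int j) (YW v (int p + int j) w)))" for j p
  define B where "B j p = wscale ((-1) ^ (p + j) * (of_int n gchoose j) * sign n) (DD p (YW v (n - int j + int p) (YW u (int j) w)))" for j p
  have A0: "A j p = 0" if "j + p \<ge> N" for j p
    using Nv[of "j + p"] that unfolding A_def by (simp add: add.commute)
  have coeff: "wscale ((-1) ^ p) (DD p (YW (Y u n v) (int p) w)) = (\<Sum>j<N. A j p - B j p)" for p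
  proof -
    have "YW (Y u n v) (int p) w = (\<Sum>i<N. wscale ((-1) ^ i * (of_int n gchoose i))
     (YW u (n - int i) (YW v (int p + int i) w) - wscale (sign n) (YW v (int p + n - int i) (YW u (int i) w))))"
    proof (rule YW_iterate)
      show "YW v (int p + int i) w = 0" if "i \<ge> N" for i using Nv[of "p + i"] that by simp
    qed (rule Nu)
    moreover have "int p + n - int i = n - int i + int p" for i by simp
    ultimately show ?thesis
      unfolding A_def B_def
      by (simp add: DD_sum DD_scale DD_diff W.scale_sum_right W.scale_right_diff_distrib power_add mult_ac)
  qed
  have "opposite_mode wscale YW om w 0 (Y u n v) = - (\<Sum>p<K. \<Sum>j<N. A j p - B j p)"
    unfolding opposite_mode_skew using K1 K(1) by (subst skew_eq[of K]) (auto simp: coeff)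
  also have "(\<Sum>p<K. \<Sum>j<N. A j p - B j p) = (\<Sum>j<N. \<Sum>p<K. A j p) - (\<Sum>j<N. \<Sum>p<K. B j p)"
    by (subst sum.swap) (simp add: sum_subtractf)
  finally have 1: "opposite_mode wscale YW om w 0 (Y u n v) = (\<Sum>j<N. \<Sum>p<K. B j p) - (\<Sum>j<N. \<Sum>p<K. A j p)"
    by simp
  \<comment> \<open>As \<open>A j p\<close> vanishes for j + p at least N and K is at least N, the
    rectangle may be cut down to a triangle and summed along its diagonals.\<close>
  have "(\<Sum>j<N. \<Sum>p<K. A j p) = (\<Sum>(j, p)\<in>{..<N} \<times> {..<K}. A j p)" by (simp add: sum.cartesian_product)
  also have "\<dots> = (\<Sum>(j, p)\<in>{(j, p). j + p < N}. A j p)"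
    by (rule sum.mono_neutral_right) (use K(2) in \<open>auto intro!: A0\<close>)
  also have "\<dots> = (\<Sum>i<N. \<Sum>k\<le>i. A k (i - k))" by (rule sum.triangle_reindex)
  also have "\<dots> = (\<Sum>i<N. wscale ((-1) ^ i) (YW u n (DD i (YW v (int i) w))))"
  proof (rule sum.cong)
    fix i
    have "A k (i - k) = wscale ((-1) ^ i) (wscale (of_int n gchoose k) (DD (i - k) (YW u (n - int k) (YW v (int i) w))))"
      if "k \<le> i" for k using that unfolding A_def by (simp add: of_nat_diff)
    then show "(\<Sum>k\<le>i. A k (i - k)) = wscale ((-1) ^ i) (YW u n (DD i (YW v (int i) w)))"
      unfolding YW_DD W.scale_sum_right by (intro sum.cong) auto
  qed simp
  also have "\<dots> = YW u n (skew v 0 w)"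
    using Nv by (subst skew_eq[of N]) (auto simp: YW_sum YW_scale_right)
  finally have 2: "(\<Sum>j<N. \<Sum>p<K. A j p) = - YW u n (opposite_mode wscale YW om w 0 v)"
    by (simp add: opposite_mode_skew YW_neg)
  have "opposite_mode wscale YW om (opposite_mode wscale YW om w 0 u) n v = wscale (sign n) (skew v n (skew u 0 w))"
    by (simp add: opposite_mode_skew skew_scale[of v n "-1", simplified])
  also have "skew u 0 w = (\<Sum>j<N. wscale ((-1) ^ j) (DD j (YW u (int j) w)))"
    using Nu by (subst skew_eq[of N]) auto
  also have "skew v n \<dots> = (\<Sum>j<N. wscale ((-1) ^ j * (of_int n gchoose j)) (skew v (n - int j) (YW u (int j) w)))"
    by (simp add: skew_sum skew_scale skew_DD)
  also have "wscale (sign n) \<dots> = (\<Sum>j<N. \<Sum>p<K. B j p)"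
    unfolding W.scale_sum_right
  proof (rule sum.cong)
    fix j assume "j \<in> {..<N}"
    then have "YW v (n - int j + int p) (YW u (int j) w) = 0" if "p \<ge> K" for p
      using K(3)[of j] K2[of j p] that by simp
    then have "skew v (n - int j) (YW u (int j) w)
       = (\<Sum>p<K. wscale ((-1) ^ p) (DD p (YW v (n - int j + int p) (YW u (int j) w))))"
      by (rule skew_eq)
    then show "wscale (sign n) (wscale ((-1) ^ j * (of_int n gchoose j)) (skew v (n - int j) (YW u (int j) w))) = (\<Sum>p<K. B j p)"
      unfolding B_def by (simp add: W.scale_sum_right power_add mult_ac)
  qed simp
  finally show ?thesis using 1 2 by simp
qed

lemma d_DW: "d (DW x) = DW (d x) + DW x"
proof -
  have "virasoro_mode Y om 0 om = scale 2 om" using conformal_weight unfolding weight_space_def by simp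
  then have "YW (virasoro_mode Y om 0 om) 0 x = wscale 2 (DW x)" by (simp add: YW_scale_left)
  then show ?thesis using d_bracket[of om 0 x] by (simp add: algebra_simps W.scale_left_distrib[of 1 1, simplified])
qed

lemma endo_d: "module_hom wscale wscale d"
  using d_linear by (simp add: module_hom_iff_linear)

lemmas d_scale = module_hom.scale[OF endo_d] and d_sum = module_hom.sum[OF endo_d]

lemma d_DD: "d (DD i x) = DD i (d x) + wscale (of_nat i) (DD i x)"
proof -
  have "d ((DW ^^ i) x) = (DW ^^ i) (d x) + wscale (of_nat i) ((DW ^^ i) x)"
    by (induction i) (auto simp: d_DW YW_add_right YW_scale_right algebra_simps)
  then show ?thesis by (simp add: DD_def d_scale W.scale_right_distrib mult.commute)
qed

theorem zero_mode_derivation: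
  assumes w: "w \<in> weight_space wscale d 1"
  shows "derivation scale Y om wscale YW d (opposite_mode wscale YW om w 0)"
proof -
  have lin: "Vector_Spaces.linear scale wscale (opposite_mode wscale YW om w 0)"
    unfolding linear_iff_module_hom
    by unfold_locales (auto simp: opposite_mode_skew skew_add_left skew_scale_left W.scale_right_distrib mult.commute)
  have dw: "d w = w" using w unfolding weight_space_def by simp
  have step: "d (DD p (YW v (int p) w)) = DD p (YW (virasoro_mode Y om 0 v) (int p) w)" for v p
  proof -
    have "d (YW v (int p) w) = YW (virasoro_mode Y om 0 v) (int p) w - wscale (of_nat p) (YW v (int p) w)"
      using d_bracket[of v "int p" w] by (simp add: dw algebra_simps)
    then show ?thesis by (simp add: d_DD DD_diff DD_scale)
  qed
  have "skew (virasoro_mode Y om 0 v) 0 w = d (skew v 0 w)" for v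
  proof -
    obtain K1 where K1: "\<And>p. p \<ge> K1 \<Longrightarrow> YW v (int p) w = 0" using YW_bound0 by blast
    obtain K2 where K2: "\<And>p. p \<ge> K2 \<Longrightarrow> YW (virasoro_mode Y om 0 v) (int p) w = 0" using YW_bound0 by blast
    let ?K = "max K1 K2"
    show ?thesis
      by (subst (1 2) skew_eq[of ?K]) (auto simp: K1 K2 d_sum d_scale step)
  qed
  then have "opposite_mode wscale YW om w 0 \<circ> virasoro_mode Y om 0 = d \<circ> opposite_mode wscale YW om w 0"
    by (auto simp: fun_eq_iff opposite_mode_skew d_scale[of "-1", simplified])
  then show ?thesis unfolding derivation_def using lin zero_mode_leibniz by blast
qed

end

section \<open>Representations of affine Lie algebras\<close>

text \<open>\<open>R a n\<close> is the action of a tensor t^n at level \<open>l\<close>, and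
  \<open>T\<close> is the top space. The same axioms hold for an induced module and its quotients,
  and cover both V, where \<open>T\<close> is spanned by the vacuum, and W, where \<open>T\<close>
  is the image of the inducing module.\<close>

locale affine_rep = quadratic_lie_algebra sg br ip + W: complex_vector_space sW
  for sg :: "complex \<Rightarrow> 'g::ab_group_add \<Rightarrow> 'g" and br and ip
    and sW :: "complex \<Rightarrow> 'w::ab_group_add \<Rightarrow> 'w" +
  fixes l :: complex and R :: "'g \<Rightarrow> int \<Rightarrow> 'w \<Rightarrow> 'w" and T :: "'w set"
  assumes R_add_left: "R (a + b) n w = R a n w + R b n w"
    and R_scale_left: "R (sg c a) n w = sW c (R a n w)"
    and R_add_right: "R a n (w + w') = R a n w + R a n w'"
    and R_scale_right: "R a n (sW c w) = sW c (R a n w)"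
    and R_comm: "R a m (R b n w) = R b n (R a m w) + R (br a b) (m + n) w +
        (if m + n = 0 then sW (of_int m * ip a b * l) w else 0)"
    and T_subspace: "W.subspace T"
    and T_zero: "\<tau> \<in> T \<Longrightarrow> R a 0 \<tau> \<in> T"
    and T_pos: "\<tau> \<in> T \<Longrightarrow> n > 0 \<Longrightarrow> R a n \<tau> = 0"
    and T_generates: "W.subspace S \<Longrightarrow> T \<subseteq> S \<Longrightarrow> (\<And>a n w. w \<in> S \<Longrightarrow> R a n w \<in> S) \<Longrightarrow> S = UNIV"

lemma affine_rep_image:
  fixes sW :: "complex \<Rightarrow> 'w::ab_group_add \<Rightarrow> 'w" and sQ :: "complex \<Rightarrow> 'q::ab_group_add \<Rightarrow> 'q"
  assumes "affine_rep sg br ip sW l R T"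
    and p: "Vector_Spaces.linear sW sQ p" "surj p" "\<And>a n w. R' a n (p w) = p (R a n w)"
  shows "affine_rep sg br ip sQ l R' (p ` T)"
proof -
  interpret affine_rep sg br ip sW l R T by fact
  interpret p: Vector_Spaces.linear sW sQ p by fact
  interpret Q: complex_vector_space sQ ..
  have ex: "\<exists>x. w = p x" for w using p(2) by (meson surjD)
  show ?thesis
  proof unfold_locales
    show "R' (a + b) n w = R' a n w + R' b n w" for a b n w
      using ex[of w] by (auto simp: p(3) R_add_left p.add)
    show "R' (sg c a) n w = sQ c (R' a n w)" for c a n w
      using ex[of w] by (auto simp: p(3) R_scale_left p.scale)
    show "R' a n (w + w') = R' a n w + R' a n w'" for a n w w'
    proof -
      obtain x x' where "w = p x" "w' = p x'" using ex by metis
      then show ?thesis using p(3)[of a n "x + x'"] by (simp add: p(3) R_add_right p.add)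
    qed
    show "R' a n (sQ c w) = sQ c (R' a n w)" for a n c w
    proof -
      obtain x where "w = p x" using ex by metis
      then show ?thesis using p(3)[of a n "sW c x"] by (simp add: p(3) R_scale_right p.scale)
    qed
    show "R' a m (R' b n w) = R' b n (R' a m w) + R' (br a b) (m + n) w +
        (if m + n = 0 then sQ (of_int m * ip a b * l) w else 0)" for a b m n w
    proof -
      obtain x where "w = p x" using ex by metis
      then show ?thesis
        using arg_cong[OF R_comm[of a m b n x], of p] by (auto simp: p(3) p.add p.scale split: if_splits)
    qed
    show "p.vs2.subspace (p ` T)" by (rule p.subspace_image[OF T_subspace])
    show "R' a 0 \<tau> \<in> p ` T" if "\<tau> \<in> p ` T" for a \<tau> using that T_zero p(3) by auto
    show "R' a n \<tau> = 0" if "\<tau> \<in> p ` T" "n > 0" for a n \<tau> using that T_pos p(3) p.zero by auto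
    show "S = UNIV" if S: "p.vs2.subspace S" "p ` T \<subseteq> S" "\<And>a n w. w \<in> S \<Longrightarrow> R' a n w \<in> S" for S
    proof -
      have "p -` S = UNIV"
      proof (rule T_generates)
        show "W.subspace (p -` S)" by (rule p.subspace_vimage[OF S(1)])
        show "T \<subseteq> p -` S" using S(2) by blast
        show "R a n w \<in> p -` S" if "w \<in> p -` S" for a n w
          using S(3)[of "p w" a n] that by (simp add: p(3))
      qed
      then show ?thesis using p(2) by (metis image_vimage_eq Int_UNIV_right)
    qed
  qed
qed

lemma free_scale_single: "free_scale c (Poly_Mapping.single k d) = Poly_Mapping.single k (c * d)"
  unfolding free_scale_def by (rule map_single) simp

lemma poly_mapping_expand:
  "(f :: 'a \<Rightarrow>\<^sub>0 'b::comm_monoid_add) = (\<Sum>k\<in>Poly_Mapping.keys f. Poly_Mapping.single k (Poly_Mapping.lookup f k))"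
proof (rule poly_mapping_eqI)
  fix x
  have "(\<Sum>k\<in>Poly_Mapping.keys f. Poly_Mapping.lookup f k when k = x) = Poly_Mapping.lookup f x"
    by (cases "x \<in> Poly_Mapping.keys f") (auto simp: when_def in_keys_iff)
  then show "Poly_Mapping.lookup f x = Poly_Mapping.lookup
      (\<Sum>k\<in>Poly_Mapping.keys f. Poly_Mapping.single k (Poly_Mapping.lookup f k)) x"
    by (simp add: lookup_sum lookup_single)
qed

lemma affine_bracket_loop:
  assumes "\<And>x. br 0 x = (0 :: 'g::ab_group_add)" "\<And>x. br x 0 = 0" "\<And>x. ip 0 x = 0" "\<And>x. ip x 0 = 0"
  shows "affine_bracket br ip (loop a m) (loop b n)
    = loop (br a b) (m + n) + (0, if m + n = 0 then of_int m * ip a b else 0)"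
  using assms by (cases "a = 0 \<or> b = 0") (auto simp: affine_bracket_def loop_def)

lemma affine_bracket_central: "affine_bracket br ip (0, z) u = 0"
  by (simp add: affine_bracket_def zero_prod_def)

lemma affine_induced_rep:
  fixes sX :: "complex \<Rightarrow> 'x::ab_group_add \<Rightarrow> 'x" and sM :: "complex \<Rightarrow> 'm::ab_group_add \<Rightarrow> 'm"
  assumes "quadratic_lie_algebra sg br ip" and M: "lie_module sg br sM rM"
    and X: "affine_induced_module sg br ip l sM rM sX rX \<pi>"
  defines "\<phi> \<equiv> \<lambda>m. \<pi> (Poly_Mapping.single ([], m) 1)"
  shows "affine_rep sg br ip sX l (\<lambda>a n. rX (loop a n)) (range \<phi>)"
    and "Vector_Spaces.linear sM sX \<phi>" and "rX (loop a 0) (\<phi> m) = \<phi> (rM a m)"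
proof -
  interpret quadratic_lie_algebra sg br ip by fact
  interpret M: lie_module sg br sM rM by fact
  have ind: "induced_module (affine_scale sg) (affine_bracket br ip) affine_nonneg sM (top_action l sM rM) sX rX \<pi>"
    using X unfolding affine_induced_module_def .
  interpret X: lie_module "affine_scale sg" "affine_bracket br ip" sX rX
    using ind unfolding induced_module_def by blast
  interpret \<pi>: Vector_Spaces.linear free_scale sX \<pi> using ind unfolding induced_module_def by blast
  have surj: "surj \<pi>" using ind unfolding induced_module_def by blast
  have ker: "\<pi> u = 0" if "u \<in> induced_relators (affine_scale sg) (affine_bracket br ip) affine_nonneg sM (top_action l sM rM)" for u
  proof -
    have "{f. \<pi> f = 0} = module.span free_scale
       (induced_relators (affine_scale sg) (affine_bracket br ip) affine_nonneg sM (top_action l sM rM))"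
      using ind unfolding induced_module_def by blast
    moreover have "u \<in> module.span free_scale
       (induced_relators (affine_scale sg) (affine_bracket br ip) affine_nonneg sM (top_action l sM rM))"
      by (rule \<pi>.vs1.span_base[OF that])
    ultimately show ?thesis by blast
  qed
  have act: "rX x (\<pi> (Poly_Mapping.single (xs, m) 1)) = \<pi> (Poly_Mapping.single (x # xs, m) 1)" for x xs m
    using ind unfolding induced_module_def by blast
  have rX0: "rX 0 v = 0" for v using X.act_add_left[of 0 0 v] by simp
  have rM0: "rM 0 m = 0" for m using M.act_scale_left[of 0 0 m] by simp
  have \<phi>_add: "\<phi> (m + m') = \<phi> m + \<phi> m'" for m m'
  proof -
    have "\<pi> (Poly_Mapping.single ([], m + m') 1 - Poly_Mapping.single ([], m) 1 - Poly_Mapping.single ([], m') 1) = 0"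
      by (rule ker) (unfold induced_relators_def, blast)
    then show ?thesis by (simp add: \<phi>_def \<pi>.diff \<pi>.add algebra_simps)
  qed
  have \<phi>_scale: "\<phi> (sM c m) = sX c (\<phi> m)" for c m
  proof -
    have "\<pi> (Poly_Mapping.single ([], sM c m) 1 - Poly_Mapping.single ([], m) c) = 0"
      by (rule ker) (unfold induced_relators_def, blast)
    then show ?thesis
      using \<pi>.scale[of c "Poly_Mapping.single ([], m) 1"] by (simp add: \<phi>_def \<pi>.diff free_scale_single)
  qed
  have \<phi>_act: "rX b (\<phi> m) = \<phi> (top_action l sM rM b m)" if "b \<in> affine_nonneg" for b m
  proof -
    have "\<pi> (Poly_Mapping.single ([] @ [b], m) 1 - Poly_Mapping.single ([], top_action l sM rM b m) 1) = 0"
      by (rule ker) (use that in \<open>unfold induced_relators_def, blast\<close>)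
    then show ?thesis by (simp add: \<phi>_def \<pi>.diff act)
  qed
  show \<phi>_lin: "Vector_Spaces.linear sM sX \<phi>"
    by unfold_locales (simp_all add: \<phi>_add \<phi>_scale)
  interpret \<phi>: Vector_Spaces.linear sM sX \<phi> by (rule \<phi>_lin)
  have loop_nonneg: "loop a n \<in> affine_nonneg" if "n \<ge> 0" for a n
    using that by (auto simp: affine_nonneg_def loop_def lookup_single when_def)
  show \<phi>_zero: "rX (loop a 0) (\<phi> m) = \<phi> (rM a m)" for a m
    by (subst \<phi>_act[OF loop_nonneg]) (simp_all add: top_action_def loop_def)
  have \<phi>_pos: "rX (loop a n) (\<phi> m) = 0" if "n > 0" for a n m
    using that by (subst \<phi>_act[OF loop_nonneg])
      (simp_all add: top_action_def loop_def lookup_single when_def rM0 \<phi>.zero)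
  have gen: "S = UNIV" if S: "X.mod.subspace S" "range \<phi> \<subseteq> S" "\<And>x v. v \<in> S \<Longrightarrow> rX x v \<in> S" for S
  proof -
    have word: "\<pi> (Poly_Mapping.single (xs, m) 1) \<in> S" for xs m
    proof (induction xs)
      case Nil
      then show ?case using S(2) unfolding \<phi>_def by blast
    next
      case (Cons x xs)
      then show ?case using S(3) act by metis
    qed
    have "v \<in> S" for v
    proof -
      obtain u where u: "v = \<pi> u" using surj by (meson surjD)
      have single: "\<pi> (Poly_Mapping.single k c) \<in> S" for k c
      proof -
        have "\<pi> (Poly_Mapping.single k c) = sX c (\<pi> (Poly_Mapping.single k 1))"
          using \<pi>.scale[of c "Poly_Mapping.single k 1"] by (simp add: free_scale_single)
        then show ?thesis using word[of "fst k" "snd k"] X.mod.subspace_scale[OF S(1)] by simp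
      qed
      have "\<pi> u = (\<Sum>k\<in>Poly_Mapping.keys u. \<pi> (Poly_Mapping.single k (Poly_Mapping.lookup u k)))"
        by (subst poly_mapping_expand[of u]) (rule \<pi>.sum)
      then show ?thesis unfolding u by (simp add: X.mod.subspace_sum[OF S(1)] single)
    qed
    then show ?thesis by blast
  qed
  \<comment> \<open>The central element is a scalar on the generating space and commutes with the
    action, so the vectors on which it is that scalar form a submodule.\<close>
  have level: "rX (0, z) v = sX (l * z) v" for z v
  proof -
    let ?S = "{v. rX (0, z) v = sX (l * z) v}"
    have "?S = UNIV"
    proof (rule gen)
      show "X.mod.subspace ?S"
      proof (rule X.mod.subspaceI)
        show "0 \<in> ?S" using X.act_scale_right[of "(0, z)" 0 0] by simp
        show "x + y \<in> ?S" if "x \<in> ?S" "y \<in> ?S" for x y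
          using that by (simp add: X.act_add_right X.mod.scale_right_distrib)
        show "sX c x \<in> ?S" if "x \<in> ?S" for c x
          using that by (simp add: X.act_scale_right mult.commute)
      qed
      have "(0, z) \<in> affine_nonneg" by (simp add: affine_nonneg_def)
      then have "rX (0, z) (\<phi> m) = sX (l * z) (\<phi> m)" for m
        by (subst \<phi>_act) (simp_all add: top_action_def rM0 \<phi>_scale)
      then show "range \<phi> \<subseteq> ?S" by blast
      show "rX x v \<in> ?S" if "v \<in> ?S" for x v
        using X.act_bracket[of "(0, z)" x v] that
        by (simp add: affine_bracket_central rX0 X.act_scale_right)
    qed
    then show ?thesis by blast
  qed
  have loop_add: "loop (a + b) n = loop a n + loop b n" for a b n
    by (simp add: loop_def single_add)
  have loop_scale: "loop (sg c a) n = affine_scale sg c (loop a n)" for c a n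
    by (simp add: loop_def affine_scale_def map_single)
  \<comment> \<open>An affine element is a finite sum of loops plus a central part acting by a
    scalar, so stability under loops is stability under everything.\<close>
  have loops: "rX x v \<in> S" if S: "X.mod.subspace S" and v: "v \<in> S" "\<And>a n. rX (loop a n) v \<in> S" for S x v
  proof -
    have "rX (f, 0) v = (\<Sum>k\<in>Poly_Mapping.keys f. rX (loop (Poly_Mapping.lookup f k) k) v)" for f
    proof -
      have add: "rX (\<Sum>k\<in>K. loop (g k) k) v = (\<Sum>k\<in>K. rX (loop (g k) k) v)" if "finite K" for K g
        using that by (induction K rule: finite_induct) (auto simp: rX0 X.act_add_left)
      have "(\<Sum>k\<in>K. loop (g k) k) = (\<Sum>k\<in>K. Poly_Mapping.single k (g k), 0)" if "finite K" for K and g :: "int \<Rightarrow> _"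
        using that by (induction K rule: finite_induct) (auto simp: loop_def zero_prod_def)
      from this[of "Poly_Mapping.keys f" "Poly_Mapping.lookup f"] have "(\<Sum>k\<in>Poly_Mapping.keys f. loop (Poly_Mapping.lookup f k) k) = (f, 0)"
        by (simp flip: poly_mapping_expand)
      then show ?thesis using add[of "Poly_Mapping.keys f" "Poly_Mapping.lookup f"] by simp
    qed
    then have "rX (fst x, 0) v \<in> S" by (simp add: v X.mod.subspace_sum[OF S])
    moreover have "rX (0, snd x) v \<in> S" using v X.mod.subspace_scale[OF S] by (simp add: level)
    moreover have "x = (fst x, 0) + (0, snd x)" by simp
    ultimately show ?thesis using X.act_add_left[of "(fst x, 0)" "(0, snd x)" v] X.mod.subspace_add[OF S] by simp
  qed
  interpret XC: complex_vector_space sX ..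
  show "affine_rep sg br ip sX l (\<lambda>a n. rX (loop a n)) (range \<phi>)"
  proof unfold_locales
    show "rX (loop (a + b) n) w = rX (loop a n) w + rX (loop b n) w" for a b n w
      by (simp add: loop_add X.act_add_left)
    show "rX (loop (sg c a) n) w = sX c (rX (loop a n) w)" for c a n w
      by (simp add: loop_scale X.act_scale_left)
    show "rX (loop a m) (rX (loop b n) w) = rX (loop b n) (rX (loop a m) w) + rX (loop (br a b) (m + n)) w +
        (if m + n = 0 then sX (of_int m * ip a b * l) w else 0)" for a b m n w
    proof -
      have "rX (loop a m) (rX (loop b n) w) = rX (loop b n) (rX (loop a m) w)
          + rX (affine_bracket br ip (loop a m) (loop b n)) w"
        by (simp add: X.act_bracket)
      also have "rX (affine_bracket br ip (loop a m) (loop b n)) w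
          = rX (loop (br a b) (m + n)) w + sX (l * (if m + n = 0 then of_int m * ip a b else 0)) w"
        by (subst affine_bracket_loop) (simp_all add: X.act_add_left level)
      finally show ?thesis by (simp add: mult_ac add.assoc)
    qed
    show "X.mod.subspace (range \<phi>)" using \<phi>.subspace_image[OF M.mod.subspace_UNIV] .
    show "rX (loop a 0) \<tau> \<in> range \<phi>" if "\<tau> \<in> range \<phi>" for a \<tau> using that \<phi>_zero by auto
    show "rX (loop a n) \<tau> = 0" if "\<tau> \<in> range \<phi>" "n > 0" for a n \<tau> using that \<phi>_pos by auto
    show "S = UNIV" if S: "X.mod.subspace S" "range \<phi> \<subseteq> S" "\<And>a n w. w \<in> S \<Longrightarrow> rX (loop a n) w \<in> S" for S
      by (rule gen[OF S(1,2)]) (rule loops[OF S(1)], auto intro: S(3))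
  qed (simp_all add: X.act_add_right X.act_scale_right)
qed

context complex_vector_space
begin

lemma eigenvector_sum_zero:
  assumes "endo A" "finite F" "inj_on \<nu> F"
    "\<And>i. i \<in> F \<Longrightarrow> A (f i) = scale (\<nu> i) (f i)" "(\<Sum>i\<in>F. f i) = 0" "i \<in> F"
  shows "f i = 0"
  using assms(2-)
proof (induction F arbitrary: f i rule: finite_induct)
  case (insert x F)
  interpret A: module_hom scale scale A by (rule assms(1))
  have sum: "f x + (\<Sum>i\<in>F. f i) = 0" using insert by simp
  have "scale (\<nu> x) (f x) + (\<Sum>i\<in>F. scale (\<nu> i) (f i)) = A (f x + (\<Sum>i\<in>F. f i))"
    unfolding A.add A.sum using insert.prems(2) by simp
  also have "\<dots> = scale (\<nu> x) (f x + (\<Sum>i\<in>F. f i))" unfolding sum by simp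
  finally have "(\<Sum>i\<in>F. scale (\<nu> i - \<nu> x) (f i)) = 0"
    by (simp add: scale_right_distrib scale_left_diff_distrib sum_subtractf scale_sum_right)
  moreover have "A (scale (\<nu> i - \<nu> x) (f i)) = scale (\<nu> i) (scale (\<nu> i - \<nu> x) (f i))" if "i \<in> F" for i
    using insert.prems(2)[of i] that by (simp add: A.scale mult.commute)
  ultimately have *: "scale (\<nu> i - \<nu> x) (f i) = 0" if "i \<in> F" for i
    using insert.IH[of "\<lambda>i. scale (\<nu> i - \<nu> x) (f i)" i] insert.prems(1) that by simp
  have "f i = 0" if "i \<in> F" for i
  proof -
    have "\<nu> i \<noteq> \<nu> x" using insert.prems(1) insert.hyps(2) that by (metis inj_onD insertCI)
    then show ?thesis using *[OF that] by simp
  qed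
  then show ?case using sum insert.prems(4) by auto
qed simp

lemma span_Union_decompose:
  assumes "w \<in> span (\<Union>n. G n)" "\<And>n. subspace (G n)"
  shows "\<exists>F f. finite F \<and> (\<forall>n. f n \<in> G n) \<and> w = (\<Sum>n\<in>F. f n)"
  using assms(1)
proof (induction rule: span_induct_alt)
  case base
  have "\<forall>n. (\<lambda>_. 0) n \<in> G n" using assms(2) subspace_0 by simp
  then show ?case by (intro exI[of _ "{}"] exI[of _ "\<lambda>_. 0"]) simp
next
  case (step c x y)
  then obtain F f where Ff: "finite F" "\<forall>n. f n \<in> G n" "y = (\<Sum>n\<in>F. f n)" by blast
  obtain m where m: "x \<in> G m" using step by blast
  define g where "g = (\<lambda>n. (if n \<in> F then f n else 0) + (if n = m then scale c x else 0))"
  have "\<forall>n. g n \<in> G n"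
    unfolding g_def using Ff(2) m assms(2) by (auto intro!: subspace_add subspace_scale subspace_0)
  moreover have "(\<Sum>n\<in>insert m F. g n) = scale c x + y"
  proof -
    have "(\<Sum>n\<in>insert m F. g n) = (\<Sum>n\<in>insert m F. if n \<in> F then f n else 0)
        + (\<Sum>n\<in>insert m F. if n = m then scale c x else 0)"
      unfolding g_def by (rule sum.distrib)
    also have "(\<Sum>n\<in>insert m F. if n \<in> F then f n else 0) = y"
      unfolding Ff(3) by (rule sum.mono_neutral_cong_right) (use Ff(1) in auto)
    also have "(\<Sum>n\<in>insert m F. if n = m then scale c x else 0) = scale c x"
      using Ff(1) by simp
    finally show ?thesis by (simp add: add.commute)
  qed
  ultimately show ?case using Ff(1) by (intro exI[of _ "insert m F"] exI[of _ g]) simp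
qed

end

section \<open>Layers below the top space and their conformal weights\<close>

context affine_rep
begin

lemma endo_R: "W.endo (R a n)"
  by (rule W.endoI) (simp_all add: R_add_right R_scale_right)

lemma hom_R_left: "module_hom sg sW (\<lambda>a. R a n w)"
  by unfold_locales (simp_all add: R_add_left R_scale_left)

lemmas R_zero [simp] = module_hom.zero[OF endo_R]
  and R_sum = module_hom.sum[OF endo_R]
  and R_diff = module_hom.diff[OF endo_R]
  and R_neg = module_hom.neg[OF endo_R]

lemmas R_zero_left [simp] = module_hom.zero[OF hom_R_left]
  and R_sum_left = module_hom.sum[OF hom_R_left]
  and R_neg_left = module_hom.neg[OF hom_R_left]

text \<open>The layer at depth \<open>n\<close>, built by creation operators alone. It is defined
  without L(0), since the conformal weight of the top space is found only later.\<close>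

inductive graded :: "int \<Rightarrow> 'w \<Rightarrow> bool" where
  zero: "graded n 0"
| add: "graded n w \<Longrightarrow> graded n w' \<Longrightarrow> graded n (w + w')"
| scale: "graded n w \<Longrightarrow> graded n (sW c w)"
| top: "\<tau> \<in> T \<Longrightarrow> graded 0 \<tau>"
| step: "graded n w \<Longrightarrow> k > 0 \<Longrightarrow> graded (n + k) (R a (- k) w)"

lemma graded_subspace: "W.subspace {w. graded n w}"
  by (rule W.subspaceI) (auto intro: graded.zero graded.add graded.scale)

text \<open>Commute the new mode past the outermost creation operator; the bracket and the central
  term have the right depth by induction.\<close>

lemma graded_R: "graded n w \<Longrightarrow> graded (n - m) (R a m w)"
proof (induction arbitrary: a m rule: graded.induct)
  case (zero n)
  then show ?case by (simp add: graded.zero)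
next
  case (add n w w')
  then show ?case by (simp add: R_add_right graded.add)
next
  case (scale n w c)
  then show ?case by (simp add: R_scale_right graded.scale)
next
  case (top \<tau>)
  consider "m > 0" | "m = 0" | "m < 0" by linarith
  then show ?case
  proof cases
    case 1
    then show ?thesis using top by (simp add: T_pos graded.zero)
  next
    case 2
    then show ?thesis using graded.top[OF T_zero[OF top]] by simp
  next
    case 3
    then show ?thesis using graded.step[OF graded.top[OF top], of "- m" a] by simp
  qed
next
  case (step n w k b)
  have "graded (n + k - m) (R b (- k) (R a m w))"
    using graded.step[OF step.IH[of m a] step.hyps(2), of b] by (simp add: algebra_simps)
  moreover have "graded (n + k - m) (R (br a b) (m + - k) w)"
    using step.IH[of "m + - k" "br a b"] by (simp add: algebra_simps)
  moreover have "graded (n + k - m) (if m + - k = 0 then sW (of_int m * ip a b * l) w else 0)"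
    using graded.scale[OF step.hyps(1)] by (auto simp: graded.zero)
  ultimately show ?case by (subst R_comm) (intro graded.add)
qed

lemma graded_neg: "graded n w \<Longrightarrow> n < 0 \<Longrightarrow> w = 0"
  by (induction rule: graded.induct) auto

lemma graded_0: "graded n w \<Longrightarrow> n = 0 \<Longrightarrow> w \<in> T"
proof (induction rule: graded.induct)
  case (step n w k a)
  then have "w = 0" using graded_neg[of n w] by simp
  then show ?case using W.subspace_0[OF T_subspace] by simp
qed (auto intro: W.subspace_0 W.subspace_add W.subspace_scale T_subspace)

lemma graded_1: "graded n w \<Longrightarrow> n = 1 \<Longrightarrow> w \<in> W.span {R a (- 1) \<tau> |a \<tau>. \<tau> \<in> T}"
proof (induction rule: graded.induct)
  case (step n w k a)
  show ?case
  proof (cases "n = 0")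
    case True
    then have "w \<in> T" "k = 1" using graded_0 step by auto
    then show ?thesis by (auto intro: W.span_base)
  next
    case False
    then have "w = 0" using graded_neg[of n w] step by simp
    then show ?thesis by (simp add: W.span_zero)
  qed
qed (auto intro: W.span_zero W.span_add W.span_scale)

lemma graded_span: "W.span (\<Union>n. {w. graded n w}) = UNIV"
proof (rule T_generates)
  show "T \<subseteq> W.span (\<Union>n. {w. graded n w})" by (auto intro!: W.span_base exI[of _ "0::int"] graded.top)
  show "R a m w \<in> W.span (\<Union>n. {w. graded n w})" if "w \<in> W.span (\<Union>n. {w. graded n w})" for a m w
    using that
  proof (induction rule: W.span_induct_alt)
    case (step c x y)
    then obtain n where "graded n x" by blast
    then have "graded (n - m) (R a m x)" by (rule graded_R)
    then have "R a m x \<in> (\<Union>n. {w. graded n w})" by blast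
    then show ?case using step by (simp add: R_add_right R_scale_right W.span_base W.span_add W.span_scale)
  qed (simp add: W.span_zero)
qed simp

context
  fixes d :: "'w \<Rightarrow> 'w"
  assumes d: "W.endo d" and d_R: "\<And>a n w. d (R a n w) = R a n (d w) - sW (of_int n) (R a n w)"
begin

lemma graded_eigenvalue:
  assumes d_T: "\<And>\<tau>. \<tau> \<in> T \<Longrightarrow> d \<tau> = sW h \<tau>"
  shows "graded n w \<Longrightarrow> d w = sW (h + of_int n) w"
proof (induction rule: graded.induct)
  case (step n w k a)
  then show ?case by (simp add: d_R R_scale_right R_add_right algebra_simps)
qed (simp_all add: module_hom.zero[OF d] module_hom.add[OF d] module_hom.scale[OF d] d_T W.scale_right_distrib mult.commute)

text \<open>Distinct layers have distinct eigenvalues h + n, so only one layer contributes to an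
  eigenvector; layers of negative depth are zero, which makes n a natural number.\<close>

lemma weight_vector_graded:
  assumes d_T: "\<And>\<tau>. \<tau> \<in> T \<Longrightarrow> d \<tau> = sW h \<tau>" and w: "d w = sW \<mu> w" "w \<noteq> 0"
  shows "\<exists>n::nat. \<mu> = h + of_nat n \<and> graded (int n) w"
proof -
  interpret d: module_hom sW sW d by (rule d)
  have "w \<in> W.span (\<Union>n. {w. graded n w})" by (simp add: graded_span)
  then obtain F f where Ff: "finite F" "\<forall>n. f n \<in> {w. graded n w}" "w = (\<Sum>n\<in>F. f n)"
    using W.span_Union_decompose[of w "\<lambda>n. {w. graded n w}"] graded_subspace by blast
  then have gr: "graded n (f n)" for n by simp
  let ?\<nu> = "\<lambda>n::int. h + of_int n"
  have ev: "d (f n) = sW (?\<nu> n) (f n)" for n by (rule graded_eigenvalue[OF d_T gr])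
  have "(\<Sum>n\<in>F. sW (?\<nu> n - \<mu>) (f n)) = d w - sW \<mu> w"
    unfolding Ff(3) by (simp only: d.sum ev W.scale_left_diff_distrib sum_subtractf W.scale_sum_right)
  then have sum0: "(\<Sum>n\<in>F. sW (?\<nu> n - \<mu>) (f n)) = 0" using w by simp
  have zero: "sW (?\<nu> n - \<mu>) (f n) = 0" if "n \<in> F" for n
    by (rule W.eigenvector_sum_zero[OF d Ff(1), of ?\<nu> "\<lambda>n. sW (?\<nu> n - \<mu>) (f n)"])
      (use that sum0 in \<open>auto simp: inj_on_def d.scale ev mult.commute\<close>)
  obtain n where n: "n \<in> F" "f n \<noteq> 0" using w(2) Ff(3) by (metis sum.neutral)
  then have \<mu>: "?\<nu> n = \<mu>" using zero by force
  have "w = (\<Sum>m\<in>{n}. f m)"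
    unfolding Ff(3)
  proof (rule sum.mono_neutral_right)
    show "\<forall>i\<in>F - {n}. f i = 0"
    proof
      fix i assume i: "i \<in> F - {n}"
      then have "?\<nu> i - \<mu> \<noteq> 0" using \<mu> by auto
      then show "f i = 0" using zero[of i] i by simp
    qed
  qed (use Ff(1) n(1) in auto)
  then have "graded n w" using gr by simp
  moreover have "n \<ge> 0" using graded_neg[OF gr, of n] n(2) by force
  ultimately show ?thesis using \<mu> by (intro exI[of _ "nat n"]) simp
qed

text \<open>Schur's lemma on a top space not yet known to be finite-dimensional. A nonzero top
  vector involves finitely many weight vectors; their span cut with \<open>T\<close> is
  finite-dimensional and stable under \<open>d\<close>, so \<open>d\<close> has an eigenvector in
  \<open>T\<close>. Its eigenspace is stable under the zero modes, with which \<open>d\<close>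
  commutes.\<close>

lemma top_eigenvalue:
  assumes span: "W.span (\<Union>m. weight_space sW d m) = UNIV"
    and dT: "\<And>\<tau>. \<tau> \<in> T \<Longrightarrow> d \<tau> \<in> T" and T0: "T \<noteq> {0}"
    and irr: "\<And>S. W.subspace S \<Longrightarrow> S \<subseteq> T \<Longrightarrow> (\<And>a w. w \<in> S \<Longrightarrow> R a 0 w \<in> S) \<Longrightarrow> S = {0} \<or> S = T"
  shows "\<exists>h. \<forall>\<tau>\<in>T. d \<tau> = sW h \<tau>"
proof -
  interpret d: module_hom sW sW d by (rule d)
  obtain \<tau> where \<tau>: "\<tau> \<in> T" "\<tau> \<noteq> 0" using T0 W.subspace_0[OF T_subspace] by blast
  have ws: "W.subspace (weight_space sW d m)" for m
    unfolding weight_space_def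
    by (rule W.subspaceI) (auto simp: d.add d.scale W.scale_right_distrib mult.commute)
  have \<tau>span: "\<tau> \<in> W.span (\<Union>m. weight_space sW d m)" using span by simp
  obtain F f where Ff: "finite F" "\<forall>m. f m \<in> weight_space sW d m" "\<tau> = (\<Sum>m\<in>F. f m)"
    using W.span_Union_decompose[OF \<tau>span ws] by auto
  define Q where "Q = T \<inter> W.span (f ` F)"
  have "d ` W.span (f ` F) \<subseteq> W.span (f ` F)"
  proof
    fix y assume "y \<in> d ` W.span (f ` F)"
    then obtain x where x: "x \<in> W.span (f ` F)" "y = d x" by blast
    show "y \<in> W.span (f ` F)"
      unfolding x(2) using x(1)
    proof (induction rule: W.span_induct_alt)
      case (step c u v)
      then obtain m where "u = f m" by blast
      then have "d u = sW m u" using Ff(2) unfolding weight_space_def by blast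
      then show ?case using step by (simp add: d.add d.scale W.span_add W.span_scale W.span_base)
    qed (simp add: W.span_zero)
  qed
  then have stab: "d ` Q \<subseteq> Q" unfolding Q_def using dT by blast
  have sub: "W.subspace Q" unfolding Q_def by (intro W.subspace_inter T_subspace W.subspace_span)
  have fin: "fin_dim sW Q" unfolding fin_dim_def Q_def using Ff(1) by (intro exI[of _ "f ` F"]) auto
  have "\<tau> \<in> W.span (f ` F)" unfolding Ff(3) by (rule W.span_sum) (simp add: W.span_base)
  then have "\<tau> \<in> Q" unfolding Q_def using \<tau>(1) by blast
  then have "Q \<noteq> {0}" using \<tau>(2) by blast
  then obtain h v where v: "v \<in> Q" "v \<noteq> 0" "d v = sW h v"
    using W.eigenvector_exists[OF d fin sub stab] by metis
  define S where "S = {x \<in> T. d x = sW h x}"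
  have "S = {0} \<or> S = T"
  proof (rule irr)
    show "W.subspace S"
      unfolding S_def
      by (rule W.subspaceI)
        (auto simp: d.add d.scale W.scale_right_distrib mult.commute
          intro: W.subspace_0 W.subspace_add W.subspace_scale T_subspace)
    show "S \<subseteq> T" unfolding S_def by blast
    show "R a 0 w \<in> S" if "w \<in> S" for a w
      using that T_zero d_R[of a 0 w] unfolding S_def by (simp add: R_scale_right)
  qed
  moreover have "v \<in> S" using v unfolding S_def Q_def by blast
  ultimately have "S = T" using v(2) by blast
  then show ?thesis unfolding S_def by blast
qed

end

section \<open>The Casimir operator on the top space and on currents\<close>

definition casimir :: "'w \<Rightarrow> 'w" where
  "casimir w = (\<Sum>b\<in>basis. R (dual b) 0 (R b 0 w))"

lemma endo_casimir: "W.endo casimir"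
  unfolding casimir_def
  by (rule W.endoI) (simp_all add: R_add_right R_scale_right sum.distrib W.scale_sum_right)

lemma R_expand_basis: "(\<Sum>b\<in>basis. sW (ip (dual b) a) (R b n w)) = R a n w"
proof -
  have "R (\<Sum>b\<in>basis. sg (ip (dual b) a) b) n w = (\<Sum>b\<in>basis. sW (ip (dual b) a) (R b n w))"
    by (simp only: R_sum_left R_scale_left)
  then show ?thesis by (simp add: expand_basis)
qed

lemma R_expand_dual: "(\<Sum>b\<in>basis. sW (ip b a) (R (dual b) n w)) = R a n w"
proof -
  have "R (\<Sum>b\<in>basis. sg (ip b a) (dual b)) n w = (\<Sum>b\<in>basis. sW (ip b a) (R (dual b) n w))"
    by (simp only: R_sum_left R_scale_left)
  then show ?thesis by (simp add: expand_dual)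
qed

lemma R_canonical_tensor:
  "(\<Sum>b\<in>basis. R (br a b) m (R (dual b) n w)) + (\<Sum>b\<in>basis. R b m (R (br a (dual b)) n w)) = 0"
proof (rule canonical_tensor_invariant)
  show "module_hom sg sW (\<lambda>y. R x m (R y n w))" for x
    by unfold_locales (simp_all add: R_add_left R_scale_left R_add_right R_scale_right)
qed (rule hom_R_left)

context
  fixes v assumes v: "v \<in> T" "\<And>a. R a 0 v = 0"
begin

lemma R_zero_current: "R b 0 (R a (- 1) v) = R (br b a) (- 1) v"
  using R_comm[of b 0 a "- 1" v] v by simp

lemma R_one_current: "R b 1 (R a (- 1) v) = sW (ip b a * l) v"
  using R_comm[of b 1 a "- 1" v] v T_pos by simp

lemma R_big_current: "n \<ge> 2 \<Longrightarrow> R b n (R a (- 1) v) = 0"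
  using R_comm[of b n a "- 1" v] v T_pos by simp

lemma R_two_current: "R b 2 (R a (- 2) v) = sW (2 * ip b a * l) v"
  using R_comm[of b 2 a "- 2" v] v T_pos by simp

text \<open>For \<open>v\<close> killed by all zero modes the vectors a(-1) v form an image of the
  adjoint module, so the Casimir operator acts as in \<open>casimir_adjoint\<close>.\<close>

lemma casimir_current:
  assumes \<gamma>: "\<And>x y. \<kappa> x y = \<gamma> * ip x y"
  shows "casimir (R a (- 1) v) = sW \<gamma> (R a (- 1) v)"
proof -
  have "casimir (R a (- 1) v) = R (\<Sum>b\<in>basis. br (dual b) (br b a)) (- 1) v"
    unfolding casimir_def R_zero_current R_sum_left ..
  then show ?thesis by (simp add: casimir_adjoint[OF \<gamma>] R_scale_left)
qed

end

text \<open>The trace form \<beta> of the top space is invariant, hence j times \<open>ip\<close>,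
  and its value at \<open>t\<close> gives 2 j = S with S a sum of integer squares. Taking the trace
  of the Casimir operator yields c dim T = j dim g. If this vanishes, S = 0, so \<open>e\<close>
  kills the top space, and the annihilator of the top space is a nonzero ideal.\<close>

lemma casimir_top_nonneg:
  assumes simple: "simple_lie_algebra sg br"
    and T: "fin_dim sW T" "T \<noteq> {0}"
    and triple: "br t e = sg 2 e" "br e f = t" "ip t t = 2" "e \<noteq> 0"
    and c: "\<And>\<tau>. \<tau> \<in> T \<Longrightarrow> casimir \<tau> = sW c \<tau>"
  shows "\<exists>r::real. r \<ge> 0 \<and> c = of_real r \<and> (r = 0 \<longrightarrow> (\<forall>a. \<forall>\<tau>\<in>T. R a 0 \<tau> = 0))"
proof -
  have ideals: "I = {0} \<or> I = UNIV" if "lie_ideal sg br I" for I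
    using simple that unfolding simple_lie_algebra_def by blast
  have R0: "R (br a b) 0 w = R a 0 (R b 0 w) - R b 0 (R a 0 w)" for a b w
    using R_comm[of a 0 b 0 w] by simp
  have stab: "R a 0 ` T \<subseteq> T" for a using T_zero by blast
  obtain B where B: "finite B" "W.independent B" "W.span B = T"
    using W.fin_dim_basis[OF T(1) T_subspace] by metis
  have BT: "b \<in> T" if "b \<in> B" for b using that B W.span_base by blast
  define \<beta> where "\<beta> x y = W.trace_on B (\<lambda>w. R x 0 (R y 0 w))" for x y
  have in_span: "R x 0 (R y 0 b) \<in> W.span B" if "b \<in> B" for x y b
    using BT[OF that] T_zero B(3) by blast
  have \<beta>_inv: "\<beta> (br x y) z = \<beta> x (br y z)" for x y z
  proof -
    have e2: "W.endo (\<lambda>w. R x 0 (R z 0 w))" for x z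
      by (rule W.endoI) (simp_all add: R_add_right R_scale_right)
    have in3: "R x 0 (R y 0 (R z 0 b)) \<in> W.span B" if "b \<in> B" for x y z b
      using BT[OF that] T_zero B(3) by blast
    have "\<beta> (br x y) z = W.trace_on B (\<lambda>w. R x 0 (R y 0 (R z 0 w))) - W.trace_on B (\<lambda>w. R y 0 (R x 0 (R z 0 w)))"
      unfolding \<beta>_def R0 by (rule W.trace_on_diff[OF B(2)]) (auto intro: in3)
    also have "W.trace_on B (\<lambda>w. R y 0 (R x 0 (R z 0 w))) = W.trace_on B (\<lambda>w. R x 0 (R z 0 (R y 0 w)))"
      by (rule W.trace_on_commute[OF B(1,2) endo_R[of y 0] _ e2]) (use B(3) T_zero in blast)+
    also have "W.trace_on B (\<lambda>w. R x 0 (R y 0 (R z 0 w))) - W.trace_on B (\<lambda>w. R x 0 (R z 0 (R y 0 w))) = \<beta> x (br y z)"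
      unfolding \<beta>_def R0 R_diff by (rule W.trace_on_diff[OF B(2), symmetric]) (auto intro: in3)
    finally show ?thesis .
  qed
  have "\<exists>j. \<forall>x y. \<beta> x y = j * ip x y"
  proof (rule invariant_form_unique[OF ideals _ _ _ _ _ \<beta>_inv])
    show "\<exists>x::'g. x \<noteq> 0" using triple(4) by blast
    show "\<beta> (x + x') y = \<beta> x y + \<beta> x' y" for x x' y
      unfolding \<beta>_def R_add_left by (rule W.trace_on_add[OF B(2)]) (auto intro: in_span)
    show "\<beta> (sg k x) y = k * \<beta> x y" for k x y
      unfolding \<beta>_def R_scale_left by (rule W.trace_on_scale[OF B(2)]) (auto intro: in_span)
    show "\<beta> x (y + y') = \<beta> x y + \<beta> x y'" for x y y'
      unfolding \<beta>_def R_add_left R_add_right by (rule W.trace_on_add[OF B(2)]) (auto intro: in_span)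
    show "\<beta> x (sg k y) = k * \<beta> x y" for k x y
      unfolding \<beta>_def R_scale_left R_scale_right by (rule W.trace_on_scale[OF B(2)]) (auto intro: in_span)
  qed
  then obtain j where j: "\<And>x y. \<beta> x y = j * ip x y" by blast
  obtain S :: nat where S: "\<forall>B. finite B \<longrightarrow> W.independent B \<longrightarrow> W.span B = T \<longrightarrow> W.trace_on B (\<lambda>w. R t 0 (R t 0 w)) = of_nat S"
      "S = 0 \<longrightarrow> (\<forall>x\<in>T. R e 0 x = 0)"
  proof -
    have "\<exists>S::nat. (\<forall>B. finite B \<longrightarrow> W.independent B \<longrightarrow> W.span B = T \<longrightarrow> W.trace_on B (\<lambda>w. R t 0 (R t 0 w)) = of_nat S) \<and>
      (S = 0 \<longrightarrow> (\<forall>x\<in>T. R e 0 x = 0))"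
    proof (rule W.sl2_trace_square[OF endo_R endo_R endo_R[of f 0] _ _ T(1) T_subspace stab stab stab])
      show "R t 0 (R e 0 x) = R e 0 (R t 0 x) + sW 2 (R e 0 x)" for x
        using R0[of t e x] by (simp add: triple R_scale_left algebra_simps)
      show "R e 0 (R f 0 x) = R f 0 (R e 0 x) + R t 0 x" for x
        using R0[of e f x] by (simp add: triple algebra_simps)
    qed
    then show ?thesis using that by blast
  qed
  have "W.trace_on B (\<lambda>w. R t 0 (R t 0 w)) = of_nat S" using S(1) B by blast
  then have jS: "j * 2 = of_nat S" using j[of t t] triple(3) unfolding \<beta>_def by simp
  have "W.trace_on B casimir = (\<Sum>b\<in>basis. \<beta> (dual b) b)"
    unfolding casimir_def \<beta>_def by (rule W.trace_on_sum[OF B(2)]) (rule in_span)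
  also have "\<dots> = (\<Sum>b\<in>basis. j)"
    by (rule sum.cong) (simp_all add: j ip_sym[of "dual _"] ip_dual)
  also have "\<dots> = of_nat (card basis) * j" by simp
  finally have 1: "W.trace_on B casimir = of_nat (card basis) * j" .
  have "W.trace_on B casimir = c * of_nat (card B)"
    by (rule W.trace_on_scalar[OF B(2)]) (rule c[OF BT])
  with 1 have eq: "c * of_nat (card B) = of_nat (card basis) * j" by simp
  have "B \<noteq> {}" using B(3) T(2) by auto
  then have cB: "card B > 0" using B(1) by (simp add: card_gt_0_iff)
  have "basis \<noteq> {}" using basis(3) triple(4) by (metis UNIV_I singletonD span_empty)
  then have cb: "card basis > 0" using basis(1) by (simp add: card_gt_0_iff)
  define r where "r = real (card basis) * real S / (2 * real (card B))"
  have "c = of_nat (card basis) * of_nat S / (2 * of_nat (card B))"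
    using eq cB unfolding jS[symmetric] by (simp add: field_simps)
  then have "c = of_real r" unfolding r_def by simp
  moreover have "r \<ge> 0" unfolding r_def by simp
  moreover have "\<forall>a. \<forall>\<tau>\<in>T. R a 0 \<tau> = 0" if "r = 0"
  proof -
    have "S = 0" using that cb cB unfolding r_def by simp
    then have e0: "\<forall>\<tau>\<in>T. R e 0 \<tau> = 0" using S(2) by blast
    define I where "I = {a. \<forall>\<tau>\<in>T. R a 0 \<tau> = 0}"
    have "lie_ideal sg br I"
      unfolding lie_ideal_def
    proof (intro conjI allI ballI)
      show "subspace I" unfolding I_def by (rule subspaceI) (auto simp: R_add_left R_scale_left)
      show "br x y \<in> I" if "y \<in> I" for x y
        using that T_zero unfolding I_def by (simp add: R0)
    qed
    moreover have "e \<in> I" using e0 unfolding I_def by blast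
    ultimately have "I = UNIV" using ideals triple(4) by blast
    then show ?thesis unfolding I_def by blast
  qed
  ultimately show ?thesis by blast
qed

end

text \<open>The Sugawara operators: \<open>Om n\<close> is the mode of index n of the conformal
  vector, so \<open>Om 1\<close> is L(0) and \<open>Om 0\<close> is L(-1). Any common truncation
  bound \<open>N\<close> may be used, and each computation picks the smallest convenient
  one.\<close>

locale affine_sugawara = affine_rep +
  fixes Om :: "int \<Rightarrow> 'b \<Rightarrow> 'b" and s :: complex
  assumes Om_mode: "(\<And>b i. i \<ge> N \<Longrightarrow> R b (n + int i) w = 0) \<Longrightarrow> (\<And>b i. i \<ge> N \<Longrightarrow> R b (int i) w = 0) \<Longrightarrow>
     Om n w = sW s (\<Sum>b\<in>basis. \<Sum>i<N. R b (- 1 - int i) (R (dual b) (n + int i) w)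
        + R (dual b) (n - 1 - int i) (R b (int i) w))"
begin

lemma Om_1_top: "\<tau> \<in> T \<Longrightarrow> Om 1 \<tau> = sW s (casimir \<tau>)"
  by (subst Om_mode[of 1]) (simp_all add: T_pos casimir_def)

lemma Om_0_trivial:
  assumes v: "v \<in> T" "\<And>a. R a 0 v = 0" shows "Om 0 v = 0"
proof -
  have "R b (int i) v = 0" if "i \<ge> 0" for b i using v T_pos[of v "int i" b] by (cases i) auto
  then show ?thesis by (subst Om_mode[of 0]) simp_all
qed

text \<open>With two terms per sum, the modes of index 1 contribute \<open>l\<close> twice and the
  zero modes contribute the Casimir scalar \<gamma>. The same factor for L(0) and L(-1) is what
  later fixes \<open>s\<close>.\<close>

lemma Om_current:
  assumes \<gamma>: "\<And>x y. \<kappa> x y = \<gamma> * ip x y" and v: "v \<in> T" "\<And>a. R a 0 v = 0"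
  shows "Om 1 (R a (- 1) v) = sW (s * (2 * l + \<gamma>)) (R a (- 1) v)"
    and "Om 0 (R a (- 1) v) = sW (s * (2 * l + \<gamma>)) (R a (- 2) v)"
proof -
  note cur = R_zero_current[OF v] R_one_current[OF v] R_big_current[OF v]
  have b1: "(\<Sum>b\<in>basis. R b n (R (dual b) 1 (R a (- 1) v))) = sW l (R a n v)" for n
  proof -
    have "(\<Sum>b\<in>basis. R b n (R (dual b) 1 (R a (- 1) v))) = sW l (\<Sum>b\<in>basis. sW (ip (dual b) a) (R b n v))"
      by (simp add: cur R_scale_right W.scale_sum_right mult.commute)
    then show ?thesis by (simp only: R_expand_basis)
  qed
  have b2: "(\<Sum>b\<in>basis. R (dual b) n (R b 1 (R a (- 1) v))) = sW l (R a n v)" for n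
  proof -
    have "(\<Sum>b\<in>basis. R (dual b) n (R b 1 (R a (- 1) v))) = sW l (\<Sum>b\<in>basis. sW (ip b a) (R (dual b) n v))"
      by (simp add: cur R_scale_right W.scale_sum_right mult.commute)
    then show ?thesis by (simp only: R_expand_dual)
  qed
  have "Om 1 (R a (- 1) v) = sW s (\<Sum>b\<in>basis. \<Sum>i<2. R b (- 1 - int i) (R (dual b) (1 + int i) (R a (- 1) v))
        + R (dual b) (1 - 1 - int i) (R b (int i) (R a (- 1) v)))"
    by (rule Om_mode) (auto intro!: cur(3))
  also have "\<dots> = sW s ((\<Sum>b\<in>basis. R b (- 1) (R (dual b) 1 (R a (- 1) v))) + casimir (R a (- 1) v)
      + (\<Sum>b\<in>basis. R (dual b) (- 1) (R b 1 (R a (- 1) v))))"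
    by (simp add: eval_nat_numeral cur(3) casimir_def sum.distrib add.assoc)
  also have "\<dots> = sW (s * (2 * l + \<gamma>)) (R a (- 1) v)"
    by (simp add: b1 b2 casimir_current[OF v \<gamma>] algebra_simps flip: W.scale_left_distrib)
  finally show "Om 1 (R a (- 1) v) = sW (s * (2 * l + \<gamma>)) (R a (- 1) v)" .
  \<comment> \<open>By invariance of the canonical tensor the two sums of quadratic terms cancel;
    what remains is the commutator from reordering the second sum, a Casimir sum in the adjoint
    module at mode -2.\<close>
  have cross: "(\<Sum>b\<in>basis. R b (- 1) (R (dual b) 0 (R a (- 1) v)))
      + (\<Sum>b\<in>basis. R (dual b) (- 1) (R b 0 (R a (- 1) v))) = sW \<gamma> (R a (- 2) v)"
  proof -
    have "(\<Sum>b\<in>basis. R b (- 1) (R (dual b) 0 (R a (- 1) v))) = - (\<Sum>b\<in>basis. R b (- 1) (R (br a (dual b)) (- 1) v))"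
      unfolding cur by (subst bracket_anti) (simp add: R_neg_left R_neg sum_negf)
    also have "\<dots> = (\<Sum>b\<in>basis. R (br a b) (- 1) (R (dual b) (- 1) v))"
      using R_canonical_tensor[of a "- 1" "- 1" v] unfolding add_eq_0_iff2 by (rule sym)
    also have "\<dots> = - (\<Sum>b\<in>basis. R (br b a) (- 1) (R (dual b) (- 1) v))"
      by (subst bracket_anti) (simp add: R_neg_left sum_negf)
    finally have 1: "(\<Sum>b\<in>basis. R b (- 1) (R (dual b) 0 (R a (- 1) v)))
        = - (\<Sum>b\<in>basis. R (br b a) (- 1) (R (dual b) (- 1) v))" .
    have "(\<Sum>b\<in>basis. R (dual b) (- 1) (R b 0 (R a (- 1) v)))
        = (\<Sum>b\<in>basis. R (br b a) (- 1) (R (dual b) (- 1) v) + R (br (dual b) (br b a)) (- 2) v)"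
      unfolding cur by (subst R_comm) simp
    then show ?thesis
      unfolding 1 by (simp add: sum.distrib R_sum_left[symmetric] casimir_adjoint[OF \<gamma>] R_scale_left)
  qed
  have "Om 0 (R a (- 1) v) = sW s (\<Sum>b\<in>basis. \<Sum>i<2. R b (- 1 - int i) (R (dual b) (0 + int i) (R a (- 1) v))
        + R (dual b) (0 - 1 - int i) (R b (int i) (R a (- 1) v)))"
    by (rule Om_mode) (auto intro!: cur(3))
  also have "\<dots> = sW s (((\<Sum>b\<in>basis. R b (- 1) (R (dual b) 0 (R a (- 1) v)))
      + (\<Sum>b\<in>basis. R (dual b) (- 1) (R b 0 (R a (- 1) v))))
      + ((\<Sum>b\<in>basis. R b (- 2) (R (dual b) 1 (R a (- 1) v))) + (\<Sum>b\<in>basis. R (dual b) (- 2) (R b 1 (R a (- 1) v)))))"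
    by (simp add: eval_nat_numeral sum.distrib algebra_simps)
  also have "\<dots> = sW (s * (2 * l + \<gamma>)) (R a (- 2) v)"
    unfolding cross b1 b2 by (simp add: algebra_simps flip: W.scale_left_distrib)
  finally show "Om 0 (R a (- 1) v) = sW (s * (2 * l + \<gamma>)) (R a (- 2) v)" .
qed

end

context affine_rep
begin

text \<open>Whitehead's argument: acting by \<open>a\<close> on the sum of \<open>dual b\<close>
  applied to f(b), the cocycle identity produces the Casimir operator at f(a), and the remaining
  terms cancel by invariance of the canonical tensor.\<close>

lemma cocycle_coboundary:
  assumes f: "module_hom sg sW f"
    and cocycle: "\<And>a b. f (br a b) = R a 0 (f b) - R b 0 (f a)"
    and g: "\<And>a. casimir (f a) = sW g (f a)" "g \<noteq> 0"
  shows "f a = R a 0 (sW (1 / g) (\<Sum>b\<in>basis. R (dual b) 0 (f b)))"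
proof -
  interpret f: module_hom sg sW f by (rule f)
  have "(\<Sum>b\<in>basis. R (dual b) 0 (f (br a b))) + (\<Sum>b\<in>basis. R (br a (dual b)) 0 (f b)) = 0"
  proof (rule canonical_tensor_invariant)
    show "module_hom sg sW (\<lambda>y. R y 0 (f x))" for x by (rule hom_R_left)
    show "module_hom sg sW (\<lambda>x. R y 0 (f x))" for y
      by unfold_locales (simp_all add: f.add f.scale R_add_right R_scale_right)
  qed
  moreover have "R a 0 (R (dual b) 0 (f b))
      = R (dual b) 0 (R b 0 (f a)) + (R (dual b) 0 (f (br a b)) + R (br a (dual b)) 0 (f b))" for b
  proof -
    have "R a 0 (f b) = f (br a b) + R b 0 (f a)" by (simp add: cocycle)
    then show ?thesis using R_comm[of a 0 "dual b" 0 "f b"] by (simp add: R_add_right algebra_simps)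
  qed
  ultimately have "(\<Sum>b\<in>basis. R a 0 (R (dual b) 0 (f b))) = casimir (f a)"
    by (simp add: sum.distrib casimir_def)
  then show ?thesis using g by (simp add: R_scale_right R_sum)
qed

end

context affine_sugawara
begin

text \<open>Compare the Sugawara value of L(-1) a(-1) v with a(-2) v. The latter is nonzero for a
  suitable \<open>a\<close>, because b(2) a(-2) v is 2 l \<open>ip b a\<close> times v.\<close>

lemma sugawara_normalization:
  assumes \<gamma>: "\<And>x y. \<kappa> x y = \<gamma> * ip x y" and v: "v \<in> T" "\<And>a. R a 0 v = 0" "v \<noteq> 0"
    and l: "l \<noteq> 0" and nz: "\<exists>x::'a. x \<noteq> 0"
    and transl: "\<And>a. Om 0 (R a (- 1) v) = R a (- 2) v"
  shows "s * (2 * l + \<gamma>) = 1"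
proof -
  obtain a :: 'a where "a \<noteq> 0" using nz by blast
  then obtain b where ab: "ip b a \<noteq> 0" using ip_nondegenerate[of a] ip_sym by metis
  have "R b 2 (R a (- 2) v) \<noteq> 0" using R_two_current[OF v(1,2)] ab l v(3) by simp
  then have "R a (- 2) v \<noteq> 0" by force
  moreover have "sW (s * (2 * l + \<gamma>)) (R a (- 2) v) = sW 1 (R a (- 2) v)"
    using Om_current(2)[OF \<gamma> v(1,2), of a] transl[of a] by simp
  ultimately show ?thesis by (simp only: W.scale_cancel_right) simp
qed

text \<open>Besides the nonzero Casimir scalar, the conclusion contains the vanishing of exactly
  those terms by which the zero mode of \<open>w\<close> on a current differs from minus the zero
  mode of the current on \<open>w\<close>.\<close>

lemma weight_one_space:
  assumes simple: "simple_lie_algebra sg br"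
    and triple: "br t e = sg 2 e" "br e f = t" "ip t t = 2" "e \<noteq> 0"
    and \<gamma>: "\<And>x y. \<kappa> x y = of_nat S / 2 * ip x y" "S > 0"
    and l: "l = of_nat k" and norm: "s * (2 * l + of_nat S / 2) = 1"
    and d: "W.endo (Om 1)" "\<And>a n w. Om 1 (R a n w) = R a n (Om 1 w) - sW (of_int n) (R a n w)"
    and fin: "\<And>m. fin_dim sW (weight_space sW (Om 1) m)"
    and span: "W.span (\<Union>m. weight_space sW (Om 1) m) = UNIV"
    and T0: "T \<noteq> {0}"
    and irr: "\<And>S. W.subspace S \<Longrightarrow> S \<subseteq> T \<Longrightarrow> (\<And>a w. w \<in> S \<Longrightarrow> R a 0 w \<in> S) \<Longrightarrow> S = {0} \<or> S = T"
  shows "\<exists>g. g \<noteq> 0 \<and> (\<forall>w\<in>weight_space sW (Om 1) 1. casimir w = sW g w \<and>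
      (\<forall>a n. n \<ge> 2 \<longrightarrow> R a n w = 0) \<and> (\<forall>a. Om 0 (R a 1 w) = 0))"
proof -
  interpret d: module_hom sW sW "Om 1" by (rule d)
  interpret C: module_hom sW sW casimir by (rule endo_casimir)
  have s0: "s \<noteq> 0" using norm by force
  have cT: "casimir \<tau> \<in> T" if "\<tau> \<in> T" for \<tau>
    unfolding casimir_def using that T_zero by (intro W.subspace_sum[OF T_subspace]) blast
  have dT: "Om 1 \<tau> \<in> T" if "\<tau> \<in> T" for \<tau>
    using Om_1_top[OF that] cT[OF that] W.subspace_scale[OF T_subspace] by simp
  obtain h where h: "\<forall>\<tau>\<in>T. Om 1 \<tau> = sW h \<tau>" using top_eigenvalue[OF d span dT T0 irr] by blast
  have cas: "casimir \<tau> = sW (h / s) \<tau>" if "\<tau> \<in> T" for \<tau>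
  proof -
    have "sW s (casimir \<tau>) = sW s (sW (h / s) \<tau>)" using h that Om_1_top[OF that] s0 by simp
    then show ?thesis using s0 by (simp only: W.scale_cancel_left) simp
  qed
  have "fin_dim sW T"
    by (rule W.fin_dim_subset[OF fin[of h]]) (use h in \<open>auto simp: weight_space_def\<close>)
  from casimir_top_nonneg[OF simple this T0 triple cas]
  obtain r where r: "r \<ge> 0" "h / s = of_real r" "r = 0 \<longrightarrow> (\<forall>a. \<forall>\<tau>\<in>T. R a 0 \<tau> = 0)" by blast
  \<comment> \<open>The real form of h = r s, with 1 / s read off from \<open>norm\<close>; being
    real and nonnegative it can be compared with integers.\<close>
  define q where "q = r / (2 * real k + real S / 2)"
  have pos: "2 * real k + real S / 2 > 0" using \<gamma>(2) by (simp add: add_nonneg_pos)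
  have hq: "h = of_real q"
  proof -
    define D where "D = 2 * real k + real S / 2"
    have "of_real D = 2 * l + of_nat S / 2" unfolding l D_def by simp
    then have sD: "s * of_real D = 1" using norm by simp
    have "h = of_real r * s" using r(2) s0 by (simp add: field_simps)
    then have "h * of_real D = of_real r" using sD by (simp add: mult.assoc)
    moreover have "D \<noteq> 0" using pos unfolding D_def by simp
    ultimately show ?thesis unfolding q_def D_def[symmetric] by (simp add: eq_divide_eq)
  qed
  have q0: "q \<ge> 0" unfolding q_def using r(1) pos by simp
  have hT: "Om 1 \<tau> = sW h \<tau>" if "\<tau> \<in> T" for \<tau> using h that by blast
  note graded' = weight_vector_graded[OF d hT]
  have zT: "0 \<in> T" by (rule W.subspace_0[OF T_subspace])
  have Om00: "Om 0 0 = 0" by (rule Om_0_trivial[OF zT]) simp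
  show ?thesis
  proof (cases "weight_space sW (Om 1) 1 = {0}")
    case True
    \<comment> \<open>Without nonzero vectors of weight one every nonzero scalar serves.\<close>
    then show ?thesis using Om00 by (intro exI[of _ 1]) (simp add: C.zero)
  next
    case False
    have "0 \<in> weight_space sW (Om 1) 1" by (simp add: weight_space_def d.zero)
    then obtain w0 where "w0 \<in> weight_space sW (Om 1) 1" "w0 \<noteq> 0" using False by blast
    then obtain n where n: "1 = h + of_nat n" using graded'[where \<mu> = 1 and w = w0] unfolding weight_space_def by auto
    then have "of_real (q + real n) = (of_real 1 :: complex)" unfolding hq by simp
    then have qn: "q + real n = 1" by (simp only: of_real_eq_iff)
    then have "n = 0 \<or> n = 1" using q0 by auto
    then show ?thesis
    proof
      assume "n = 0"
      then have h1: "h = 1" using n by simp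
      have "casimir w = sW (1 / s) w \<and> (\<forall>a n. n \<ge> 2 \<longrightarrow> R a n w = 0) \<and> (\<forall>a. Om 0 (R a 1 w) = 0)"
        if w: "w \<in> weight_space sW (Om 1) 1" for w
      proof -
        have "w \<in> T"
        proof (cases "w = 0")
          case False
          then obtain m where "1 = h + of_nat m" "graded (int m) w"
            using graded'[where \<mu> = 1 and w = w] w unfolding weight_space_def by auto
          then show ?thesis using graded_0[of "int m" w] h1 by simp
        qed (use zT in simp)
        then show ?thesis using cas[of w] h1 T_pos Om00 by simp
      qed
      then show ?thesis using s0 by (intro exI[of _ "1 / s"]) simp
    next
      assume "n = 1"
      then have "q = 0" using qn by simp
      then have "r = 0" "h = 0" using pos hq unfolding q_def by auto
      then have triv: "R a 0 \<tau> = 0" if "\<tau> \<in> T" for a \<tau> using r(3) that by blast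
      have "casimir w = sW (of_nat S / 2) w \<and> (\<forall>a n. n \<ge> 2 \<longrightarrow> R a n w = 0) \<and> (\<forall>a. R a 1 w \<in> T)"
        if w: "w \<in> weight_space sW (Om 1) 1" for w
      proof -
        have "w \<in> W.span {R a (- 1) \<tau> |a \<tau>. \<tau> \<in> T}"
        proof (cases "w = 0")
          case False
          then obtain m where "1 = h + of_nat m" "graded (int m) w"
            using graded'[where \<mu> = 1 and w = w] w unfolding weight_space_def by auto
          then show ?thesis using graded_1[of "int m" w] \<open>h = 0\<close> by simp
        qed (simp add: W.span_zero)
        then show ?thesis
        proof (induction rule: W.span_induct_alt)
          case base
          then show ?case using zT by (simp add: C.zero)
        next
          case (step c x y)
          then obtain a \<tau> where x: "x = R a (- 1) \<tau>" "\<tau> \<in> T" by blast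
          note tr = x(2) triv[OF x(2)]
          have "casimir x = sW (of_nat S / 2) x" unfolding x(1) by (rule casimir_current[OF tr \<gamma>(1)])
          moreover have "R b n x = 0" if "n \<ge> 2" for b n
            unfolding x(1) by (rule R_big_current[OF tr that])
          moreover have "R b 1 x \<in> T" for b
            unfolding x(1) R_one_current[OF tr] by (rule W.subspace_scale[OF T_subspace x(2)])
          ultimately show ?case using step
            by (simp add: C.add C.scale R_add_right R_scale_right W.scale_right_distrib mult.commute
              W.subspace_add[OF T_subspace] W.subspace_scale[OF T_subspace])
        qed
      qed
      then show ?thesis using \<gamma>(2) triv Om_0_trivial by (intro exI[of _ "of_nat S / 2"]) simp
    qed
  qed
qed

end

text \<open>The iterate formula at k = -1, where the coefficient (-1)^i (-1 gchoose i) is 1 and the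
  factor (-1)^(-1) turns the difference into a sum.\<close>

lemma normally_ordered_mode:
  fixes sW :: "complex \<Rightarrow> 'w::ab_group_add \<Rightarrow> 'w"
  assumes "module sW" "jacobi_identity sW Y YW" "\<And>u n. YW u n 0 = 0"
    "\<And>i. i \<ge> N \<Longrightarrow> YW v (n + int i) w = 0" "\<And>i. i \<ge> N \<Longrightarrow> YW u (int i) w = 0"
  shows "YW (Y u (- 1) v) n w = (\<Sum>i<N. YW u (- 1 - int i) (YW v (n + int i) w) + YW v (n - 1 - int i) (YW u (int i) w))"
proof -
  interpret module sW by fact
  have c: "(-1) ^ i * (- 1 gchoose i) = (1::complex)" for i
    using gbinomial_minus[of "1::complex" i] binomial_gbinomial[of i i, where 'a = complex]
    by (simp flip: power_mult_distrib mult.assoc)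
  have "YW (Y u (- 1) v) n w = (\<Sum>i<N. sW ((-1) ^ i * (of_int (- 1) gchoose i))
     (YW u (- 1 - int i) (YW v (n + int i) w) - sW ((-1) powi (- 1)) (YW v (n + (- 1) - int i) (YW u (int i) w))))"
    by (rule jacobi_identity_iterate[OF assms])
  also have "\<dots> = (\<Sum>i<N. YW u (- 1 - int i) (YW v (n + int i) w) + YW v (n - 1 - int i) (YW u (int i) w))"
  proof (rule sum.cong)
    fix i
    have "(-1) ^ i * (of_int (- 1) gchoose i) = (1::complex)" using c[of i] by simp
    moreover have "(-1) powi (- 1) = (- 1 :: complex)" by (simp add: power_int_minus)
    ultimately show "sW ((-1) ^ i * (of_int (- 1) gchoose i))
     (YW u (- 1 - int i) (YW v (n + int i) w) - sW ((-1) powi (- 1)) (YW v (n + (- 1) - int i) (YW u (int i) w)))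
     = YW u (- 1 - int i) (YW v (n + int i) w) + YW v (n - 1 - int i) (YW u (int i) w)"
      by (simp only:) simp
  qed simp
  finally show ?thesis .
qed

text \<open>The conformal vector is a combination of products of currents at mode -1, so its modes
  on any module obeying the Jacobi identity are normally ordered. It applies to V acting on itself
  and to V acting on W.\<close>

lemma affine_sugawara_of_modes:
  fixes sW :: "complex \<Rightarrow> 'w::ab_group_add \<Rightarrow> 'w" and \<iota> :: "'g::ab_group_add \<Rightarrow> 'v::ab_group_add"
  assumes rep: "affine_rep sg br ip sW l (\<lambda>a. YW (\<iota> a)) T"
    and jac: "jacobi_identity sW Y YW"
    and Y: "\<And>u v n w. YW (u + v) n w = YW u n w + YW v n w" "\<And>c u n w. YW (sV c u) n w = sW c (YW u n w)"
      "\<And>u n. YW u n 0 = 0"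
    and om: "om = sV s (\<Sum>b\<in>some_basis sg. Y (\<iota> b) (- 1) (\<iota> (dual_vector ip (some_basis sg) b)))"
  shows "affine_sugawara sg br ip sW l (\<lambda>a. YW (\<iota> a)) T (YW om) s"
proof -
  interpret affine_rep sg br ip sW l "\<lambda>a. YW (\<iota> a)" T by (rule rep)
  show ?thesis
  proof unfold_locales
    fix N n w
    assume b1: "\<And>b i. i \<ge> N \<Longrightarrow> YW (\<iota> b) (n + int i) w = 0" and b2: "\<And>b i. i \<ge> N \<Longrightarrow> YW (\<iota> b) (int i) w = 0"
    have Ysum: "YW (sum u A) n w = (\<Sum>a\<in>A. YW (u a) n w)" for u :: "'g \<Rightarrow> 'v" and A
    proof (induction A rule: infinite_finite_induct)
      have "YW 0 n w = 0" using Y(1)[of 0 0 n w] by simp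
      then show "YW (sum u {}) n w = (\<Sum>a\<in>{}. YW (u a) n w)"
        and "\<And>A. infinite A \<Longrightarrow> YW (sum u A) n w = (\<Sum>a\<in>A. YW (u a) n w)" by auto
    qed (simp add: Y(1))
    show "YW om n w = sW s (\<Sum>b\<in>basis. \<Sum>i<N. YW (\<iota> b) (- 1 - int i) (YW (\<iota> (dual b)) (n + int i) w)
        + YW (\<iota> (dual b)) (n - 1 - int i) (YW (\<iota> b) (int i) w))"
      unfolding om Y(2) Ysum dual_def[symmetric]
      by (subst normally_ordered_mode[where N = N, OF W.module_axioms jac Y(3)]) (simp_all add: b1 b2)
  qed
qed

text \<open>Applying the rule to the vacuum as its own product at mode -1 gives F(1) = F(1) + F(1),
  since x_(-1) 1 = x for \<open>x\<close> in W.\<close>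

lemma (in voa_module) derivation_vacuum:
  assumes "derivation scale Y om wscale YW d F"
  shows "F vac = 0"
proof -
  have "opposite_mode wscale YW om x (- 1) vac = x" for x
  proof -
    have "skew vac (- 1) x = (\<Sum>p<1. wscale ((-1) ^ p) (DD p (YW vac (- 1 + int p) x)))"
      by (rule skew_eq) (simp add: YW_vacuum)
    then show ?thesis by (simp add: opposite_mode_skew YW_vacuum power_int_minus)
  qed
  moreover have "F (Y vac (- 1) vac) = YW vac (- 1) (F vac) + opposite_mode wscale YW om (F vac) (- 1) vac"
    using assms unfolding derivation_def by blast
  ultimately show ?thesis by (simp add: vacuum YW_vacuum)
qed

section \<open>Derivations from the simple affine vertex operator algebra into W\<close>

theorem theorem3p6:
  fixes sg :: "complex \<Rightarrow> 'g::ab_group_add \<Rightarrow> 'g" and br :: "'g \<Rightarrow> 'g \<Rightarrow> 'g"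
    and H :: "'g set" and P :: "('g \<Rightarrow> complex) set" and \<theta> \<Lambda> :: "'g \<Rightarrow> complex"
    and ip :: "'g \<Rightarrow> 'g \<Rightarrow> complex" and l :: nat
    and sU :: "complex \<Rightarrow> 'u::ab_group_add \<Rightarrow> 'u" and rU :: "'g affine \<Rightarrow> 'u \<Rightarrow> 'u"
    and YU :: "'u \<Rightarrow> int \<Rightarrow> 'u \<Rightarrow> 'u" and vacU omU :: 'u
    and sV :: "complex \<Rightarrow> 'v::ab_group_add \<Rightarrow> 'v"
    and YV :: "'v \<Rightarrow> int \<Rightarrow> 'v \<Rightarrow> 'v" and vacV omV :: 'v and p :: "'u \<Rightarrow> 'v"
    and sM :: "complex \<Rightarrow> 'm::ab_group_add \<Rightarrow> 'm" and rM :: "'g \<Rightarrow> 'm \<Rightarrow> 'm"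
    and sX :: "complex \<Rightarrow> 'x::ab_group_add \<Rightarrow> 'x" and rX :: "'g affine \<Rightarrow> 'x \<Rightarrow> 'x"
    and \<pi> :: "(('g affine list \<times> 'm) \<Rightarrow>\<^sub>0 complex) \<Rightarrow> 'x"
    and sW :: "complex \<Rightarrow> 'w::ab_group_add \<Rightarrow> 'w" and rW :: "'g affine \<Rightarrow> 'w \<Rightarrow> 'w"
    and YW :: "'v \<Rightarrow> int \<Rightarrow> 'w \<Rightarrow> 'w"
  assumes g: "simple_lie_algebra sg br" "fin_dim sg UNIV"
    and roots: "cartan_subalgebra sg br H" "positive_system sg br H P" "highest_root sg br H P \<theta>"
    and ip: "normalized_killing_form sg br H ip"
    and l: "l > 0"
    and \<Lambda>: "dominant_integral sg br H P \<Lambda>" "Re (\<Lambda> (coroot sg br H \<theta>)) \<le> real l"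
      \<comment> \<open>\<open>U\<close> is the universal affine vertex operator algebra of level \<open>l\<close> and \<open>V\<close> its simple quotient\<close>
    and U: "universal_affine_voa sg br ip (dual_coxeter_number sg br H P \<theta>) (of_nat l)
              sU rU YU vacU omU"
    and V: "simple_voa sV YV vacV omV" "voa_hom sU YU vacU omU sV YV vacV omV p" "surj p"
      \<comment> \<open>\<open>X\<close> is the module induced from \<open>M\<^sub>\<Lambda>\<close> and \<open>W\<close> its irreducible quotient\<close>
    and M: "irreducible_highest_weight_module sg br H P \<Lambda> sM rM"
    and X: "affine_induced_module sg br ip (of_nat l) sM rM sX rX \<pi>"
    and W: "irreducible_quotient (affine_scale sg) (affine_bracket br ip) sX rX sW rW"
      \<comment> \<open>the \<open>V\<close>-module structure on \<open>W\<close> is the one extending the action of the affine Lie algebra\<close>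
    and YW: "voa_module sV YV vacV omV sW YW (virasoro_mode YW omV 0)"
      "\<And>a n. YW (p (rU (loop a (-1)) vacU)) n = rW (loop a n)"
  shows "(\<forall>F. derivation sV YV omV sW YW (virasoro_mode YW omV 0) F \<longrightarrow>
            (\<exists>w\<in>weight_space sW (virasoro_mode YW omV 0) 1. \<forall>v. F v = opposite_mode sW YW omV w 0 v)) \<and>
         H1 sV YV omV sW YW (virasoro_mode YW omV 0) = Z1 sW YW omV (virasoro_mode YW omV 0)"
proof -
  let ?d = "virasoro_mode YW omV 0"
  obtain S t e f where quad: "quadratic_lie_algebra sg br ip" and S: "S > 0"
    and \<kappa>: "\<And>x y. killing_form sg br x y = of_nat S / 2 * ip x y"
    and triple: "br t e = sg 2 e" "br e f = t" "ip t t = 2" "e \<noteq> 0"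
    using normalized_form_structure[OF g roots ip] by metis
  interpret L: quadratic_lie_algebra sg br ip by (rule quad)
  interpret M: voa_module sV YV vacV omV sW YW ?d by (rule YW)
  have d_eq: "?d = YW omV 1" by (simp add: virasoro_mode_def fun_eq_iff)
  define \<iota> where "\<iota> a = p (rU (loop a (-1)) vacU)" for a
  \<comment> \<open>The Sugawara constant. A zero denominator would make it 0 by convention;
    \<open>norm\<close> below excludes that.\<close>
  define s where "s = 1 / (2 * (of_nat l + dual_coxeter_number sg br H P \<theta>))"

  obtain \<pi>U where \<pi>U: "affine_induced_module sg br ip (of_nat l) (*) (\<lambda>_ _. 0) sU rU \<pi>U"
    and vacU: "vacU = \<pi>U (Poly_Mapping.single ([], 1) 1)"
    using U unfolding universal_affine_voa_def by blast
  have YU: "YU (rU (loop a (-1)) vacU) n = rU (loop a n)" for a n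
    using U unfolding universal_affine_voa_def by blast
  have omU: "omU = sugawara_vector sg ip (dual_coxeter_number sg br H P \<theta>) (of_nat l) sU rU vacU"
    using U unfolding universal_affine_voa_def by blast
  have p: "Vector_Spaces.linear sU sV p" "\<And>u n v. p (YU u n v) = YV (p u) n (p v)" "p vacU = vacV" "p omU = omV"
    using V(2) unfolding voa_hom_def by blast+
  interpret p: Vector_Spaces.linear sU sV p by (rule p(1))
  have p_act: "YV (\<iota> a) n (p u) = p (rU (loop a n) u)" for a n u
    unfolding \<iota>_def p(2)[symmetric] YU ..
  have vac_neq: "vacV \<noteq> 0"
  proof
    assume "vacV = 0"
    then have "v = 0" for v :: 'v
      using M.vacuum[of "-1" v] M.Y_scale_left[of 0 0 "-1" v] by simp
    then show False using V(1) unfolding simple_voa_def by blast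
  qed

  have trivial: "lie_module sg br ((*) :: complex \<Rightarrow> complex \<Rightarrow> complex) (\<lambda>_ _. 0)"
    using trivial_irreducible_highest_weight_module[OF L.lie_algebra_axioms]
    unfolding irreducible_highest_weight_module_def irreducible_lie_module_def by blast
  define TV where "TV = p ` range (\<lambda>z. \<pi>U (Poly_Mapping.single ([], z) 1))"
  have repV: "affine_rep sg br ip sV (of_nat l) (\<lambda>a. YV (\<iota> a)) TV"
    unfolding TV_def
  proof (rule affine_rep_image)
    show "affine_rep sg br ip sU (of_nat l) (\<lambda>a n. rU (loop a n)) (range (\<lambda>z. \<pi>U (Poly_Mapping.single ([], z) 1)))"
      by (rule affine_induced_rep(1)[OF quad trivial \<pi>U])
  qed (rule p(1) V(3) p_act)+
  have vacTV: "vacV \<in> TV" unfolding TV_def p(3)[symmetric] vacU by blast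
  \<comment> \<open>The top space of V is spanned by the vacuum, so two derivations agree on it as
    soon as both vanish there.\<close>
  have TV: "TV = range (\<lambda>z. sV z vacV)"
  proof -
    interpret z: Vector_Spaces.linear "(*)" sU "\<lambda>z. \<pi>U (Poly_Mapping.single ([], z) 1)"
      by (rule affine_induced_rep(2)[OF quad trivial \<pi>U])
    have "p (\<pi>U (Poly_Mapping.single ([], z) 1)) = sV z vacV" for z
      using z.scale[of z 1] by (simp add: p.scale flip: vacU p(3))
    then show ?thesis unfolding TV_def image_image by simp
  qed
  have omV: "omV = sV s (\<Sum>b\<in>some_basis sg. YV (\<iota> b) (- 1) (\<iota> (dual_vector ip (some_basis sg) b)))"
    unfolding p(4)[symmetric] omU sugawara_vector_def p.scale p.sum s_def \<iota>_def
    by (simp add: p_act[unfolded \<iota>_def])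
  interpret V: affine_sugawara sg br ip sV "of_nat l" "\<lambda>a. YV (\<iota> a)" TV "YV omV" s
  proof (rule affine_sugawara_of_modes[OF repV M.jacobi M.Y_add_left M.Y_scale_left _ omV])
    show "YV u n 0 = 0" for u n using M.Y_scale_right[of u n 0 0] by simp
  qed
  have \<iota>_vac: "\<iota> a = YV (\<iota> a) (- 1) vacV" for a by (simp add: M.creation)
  have norm: "s * (2 * of_nat l + of_nat S / 2) = 1"
  proof (rule V.sugawara_normalization[OF \<kappa> vacTV])
    show "YV (\<iota> a) 0 vacV = 0" for a by (simp add: M.creation)
    show "\<exists>x::'g. x \<noteq> 0" using triple(4) by blast
    show "YV omV 0 (YV (\<iota> a) (- 1) vacV) = YV (\<iota> a) (- 2) vacV" for a
      using M.derivative[of "\<iota> a" "-1" vacV] by (simp add: virasoro_mode_def M.creation)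
  qed (use vac_neq l in auto)
  have \<iota>_weight: "virasoro_mode YV omV 0 (\<iota> a) = \<iota> a" for a
    using V.Om_current(1)[OF \<kappa> vacTV, of a] norm by (simp add: M.creation virasoro_mode_def)
  have \<iota>_bracket: "YV (\<iota> a) 0 (\<iota> b) = \<iota> (br a b)" for a b
    using V.R_zero_current[OF vacTV, of a b] by (simp add: M.creation)
  have \<iota>_hom: "module_hom sg sV \<iota>"
    using V.hom_R_left[of "- 1" vacV] by (simp add: M.creation)

  have Mlie: "irreducible_lie_module sg br sM rM" using M unfolding irreducible_highest_weight_module_def by blast
  then have Mmod: "lie_module sg br sM rM" unfolding irreducible_lie_module_def by blast
  interpret N: lie_module sg br sM rM by (rule Mmod)
  have Wirr: "irreducible_lie_module (affine_scale sg) (affine_bracket br ip) sW rW"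
    using W unfolding irreducible_quotient_def by blast
  obtain q where q: "Vector_Spaces.linear sX sW q" "surj q" "\<And>x v. q (rX x v) = rW x (q v)"
    using W unfolding irreducible_quotient_def by blast
  have q_act: "YW (\<iota> a) n (q v) = q (rX (loop a n) v)" for a n v
    unfolding \<iota>_def YW(2) q(3) ..
  define \<phi> where "\<phi> m = q (\<pi> (Poly_Mapping.single ([], m) 1))" for m
  define TW where "TW = range \<phi>"
  have TW': "TW = q ` range (\<lambda>m. \<pi> (Poly_Mapping.single ([], m) 1))"
    unfolding TW_def \<phi>_def by auto
  have repW: "affine_rep sg br ip sW (of_nat l) (\<lambda>a. YW (\<iota> a)) TW"
    unfolding TW'
  proof (rule affine_rep_image)
    show "affine_rep sg br ip sX (of_nat l) (\<lambda>a n. rX (loop a n)) (range (\<lambda>m. \<pi> (Poly_Mapping.single ([], m) 1)))"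
      by (rule affine_induced_rep(1)[OF quad Mmod X])
  qed (rule q(1,2) q_act)+
  interpret W: affine_sugawara sg br ip sW "of_nat l" "\<lambda>a. YW (\<iota> a)" TW "YW omV" s
    by (rule affine_sugawara_of_modes[OF repW M.YW_jacobi M.YW_add_left M.YW_scale_left M.YW_zero omV])
  interpret q: Vector_Spaces.linear sX sW q by (rule q(1))
  interpret \<phi>: Vector_Spaces.linear sM sW \<phi>
    using Vector_Spaces.linear_compose[OF affine_induced_rep(2)[OF quad Mmod X] q(1)]
    unfolding \<phi>_def[abs_def] comp_def .
  have \<phi>_act: "YW (\<iota> a) 0 (\<phi> m) = \<phi> (rM a m)" for a m
    unfolding \<phi>_def q_act affine_induced_rep(3)[OF quad Mmod X] ..
  have TW0: "TW \<noteq> {0}"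
  proof
    assume "TW = {0}"
    then have "{0} = (UNIV :: 'w set)" using W.T_generates[of "{0}"] M.W.subspace_single_0 by simp
    moreover have "\<exists>v::'w. v \<noteq> 0" using Wirr unfolding irreducible_lie_module_def by blast
    ultimately show False by blast
  qed
  \<comment> \<open>The top space is the image of the irreducible module under the equivariant map
    \<phi>, and stable subspaces pull back to submodules.\<close>
  have TW_irr: "Q = {0} \<or> Q = TW"
    if Q: "M.W.subspace Q" "Q \<subseteq> TW" "\<And>a w. w \<in> Q \<Longrightarrow> YW (\<iota> a) 0 w \<in> Q" for Q
  proof -
    have "N.mod.subspace (\<phi> -` Q)" by (rule \<phi>.subspace_vimage[OF Q(1)])
    moreover have "\<forall>x. \<forall>v\<in>\<phi> -` Q. rM x v \<in> \<phi> -` Q" using Q(3) by (simp flip: \<phi>_act)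
    ultimately have "\<phi> -` Q = {0} \<or> \<phi> -` Q = UNIV"
      using Mlie unfolding irreducible_lie_module_def by blast
    moreover have "Q = \<phi> ` (\<phi> -` Q)" using Q(2) unfolding TW_def by auto
    ultimately show ?thesis unfolding TW_def by (metis \<phi>.zero image_empty image_insert)
  qed
  have d_R: "YW omV 1 (YW (\<iota> a) n w) = YW (\<iota> a) n (YW omV 1 w) - sW (of_int n) (YW (\<iota> a) n w)" for a n w
    using M.d_bracket[of "\<iota> a" n w] unfolding d_eq \<iota>_weight by (simp add: algebra_simps)
  obtain g where g: "g \<noteq> 0" and one: "\<And>w. w \<in> weight_space sW (YW omV 1) 1 \<Longrightarrow> W.casimir w = sW g w"
      "\<And>w a n. w \<in> weight_space sW (YW omV 1) 1 \<Longrightarrow> n \<ge> 2 \<Longrightarrow> YW (\<iota> a) n w = 0"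
      "\<And>w a. w \<in> weight_space sW (YW omV 1) 1 \<Longrightarrow> YW omV 0 (YW (\<iota> a) 1 w) = 0"
    using W.weight_one_space[OF assms(1) triple \<kappa> S refl norm M.endo_YW d_R M.d_grading(2)[unfolded d_eq]
        M.d_grading(1)[unfolded d_eq] TW0 TW_irr]
    by blast
  \<comment> \<open>Of the skew-symmetry expansion only index 0 survives: L(-1) kills the term of
    index 1, and the higher modes vanish. This turns the derivation rule into the cocycle
    identity.\<close>
  have zero_mode_current: "opposite_mode sW YW omV w 0 (\<iota> a) = - YW (\<iota> a) 0 w"
    if w: "w \<in> weight_space sW (YW omV 1) 1" for w a
  proof -
    have "M.skew (\<iota> a) 0 w = (\<Sum>i<2. sW ((-1) ^ i) (M.DD i (YW (\<iota> a) (0 + int i) w)))"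
      by (rule M.skew_eq) (simp add: one(2)[OF w])
    also have "\<dots> = YW (\<iota> a) 0 w"
      by (simp add: eval_nat_numeral M.DD_def one(3)[OF w])
    finally show ?thesis by (simp add: M.opposite_mode_skew)
  qed

  have main: "\<exists>w\<in>weight_space sW ?d 1. \<forall>v. F v = opposite_mode sW YW omV w 0 v"
    if F: "derivation sV YV omV sW YW ?d F" for F
  proof -
    have Flin: "module_hom sV sW F" using F unfolding derivation_def by (simp add: module_hom_iff_linear)
    have Fd: "F (virasoro_mode YV omV 0 v) = ?d (F v)" for v
      using F unfolding derivation_def by (metis comp_apply)
    have FY: "F (YV u n v) = YW u n (F v) + opposite_mode sW YW omV (F u) n v" for u n v
      using F unfolding derivation_def by blast
    have F1: "F (\<iota> a) \<in> weight_space sW (YW omV 1) 1" for a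
      using Fd[of "\<iota> a"] unfolding \<iota>_weight d_eq weight_space_def by simp
    define w' where "w' = sW (1 / g) (\<Sum>b\<in>L.basis. YW (\<iota> (L.dual b)) 0 (F (\<iota> b)))"
    have cob: "F (\<iota> a) = YW (\<iota> a) 0 w'" for a
      unfolding w'_def
    proof (rule W.cocycle_coboundary[where f = "\<lambda>a. F (\<iota> a)"])
      show "module_hom sg sW (\<lambda>a. F (\<iota> a))"
        using module_hom_compose[OF \<iota>_hom Flin] by (simp add: comp_def)
      show "F (\<iota> (br a b)) = YW (\<iota> a) 0 (F (\<iota> b)) - YW (\<iota> b) 0 (F (\<iota> a))" for a b
        using FY[of "\<iota> a" 0 "\<iota> b"] by (simp add: \<iota>_bracket zero_mode_current[OF F1])
    qed (use g one(1)[OF F1] in auto)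
    have w'1: "YW omV 1 w' = w'"
    proof -
      have "YW omV 1 (YW (\<iota> a) 0 (F (\<iota> b))) = YW (\<iota> a) 0 (F (\<iota> b))" for a b
        using F1[of b] by (simp add: d_R weight_space_def)
      then show ?thesis unfolding w'_def by (simp add: M.YW_scale_right M.YW_sum)
    qed
    \<comment> \<open>The sign compensates the one in \<open>zero_mode_current\<close>: the zero
      mode of \<open>w\<close> sends a current to minus the action of the current on
      \<open>w\<close>.\<close>
    define w where "w = - w'"
    have w: "w \<in> weight_space sW (YW omV 1) 1" unfolding w_def weight_space_def by (simp add: M.YW_neg w'1)
    have E: "derivation sV YV omV sW YW ?d (opposite_mode sW YW omV w 0)"
      by (rule M.zero_mode_derivation) (use w d_eq in simp)
    have Elin: "module_hom sV sW (opposite_mode sW YW omV w 0)"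
      using E unfolding derivation_def by (simp add: module_hom_iff_linear)
    have EY: "opposite_mode sW YW omV w 0 (YV u n v) = YW u n (opposite_mode sW YW omV w 0 v)
        + opposite_mode sW YW omV (opposite_mode sW YW omV w 0 u) n v" for u n v
      using E unfolding derivation_def by blast
    have agree: "opposite_mode sW YW omV w 0 (\<iota> a) = F (\<iota> a)" for a
      unfolding zero_mode_current[OF w] cob by (simp add: w_def M.YW_neg)
    interpret F: module_hom sV sW F by (rule Flin)
    interpret E: module_hom sV sW "opposite_mode sW YW omV w 0" by (rule Elin)
    \<comment> \<open>Both maps obey the same Leibniz rule and agree on the currents, so the set
      where they agree is stable under all modes of currents.\<close>
    have "{v. F v = opposite_mode sW YW omV w 0 v} = UNIV"
    proof (rule V.T_generates)
      show "M.subspace {v. F v = opposite_mode sW YW omV w 0 v}"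
        by (rule M.subspaceI) (auto simp: F.zero E.zero F.add E.add F.scale E.scale)
      show "TV \<subseteq> {v. F v = opposite_mode sW YW omV w 0 v}"
        unfolding TV using M.derivation_vacuum[OF F] M.derivation_vacuum[OF E]
        by (auto simp: F.scale E.scale)
      show "YV (\<iota> a) n v \<in> {v. F v = opposite_mode sW YW omV w 0 v}"
        if "v \<in> {v. F v = opposite_mode sW YW omV w 0 v}" for a n v
        using that FY[of "\<iota> a" n v] EY[of "\<iota> a" n v] agree[of a] by simp
    qed
    then show ?thesis using w unfolding d_eq by (intro bexI[of _ w]) blast+
  qed
  moreover have "H1 sV YV omV sW YW ?d = Z1 sW YW omV ?d"
  proof
    show "H1 sV YV omV sW YW ?d \<subseteq> Z1 sW YW omV ?d"
    proof
      fix F assume "F \<in> H1 sV YV omV sW YW ?d"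
      then obtain w where "w \<in> weight_space sW ?d 1" "\<forall>v. F v = opposite_mode sW YW omV w 0 v"
        using main unfolding H1_def by blast
      then show "F \<in> Z1 sW YW omV ?d" unfolding Z1_def by blast
    qed
    show "Z1 sW YW omV ?d \<subseteq> H1 sV YV omV sW YW ?d"
    proof
      fix F assume "F \<in> Z1 sW YW omV ?d"
      then obtain w where w: "w \<in> weight_space sW ?d 1" "F = opposite_mode sW YW omV w 0"
        unfolding Z1_def by blast
      show "F \<in> H1 sV YV omV sW YW ?d"
        unfolding H1_def w(2) using M.zero_mode_derivation[OF w(1)] by blast
    qed
  qed
  ultimately show ?thesis by blast
qed

end
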